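(* Let $\mathcal X$ and $\mathcal Y$ be operator spaces and let $\mathcal N\subseteq B(K)$ be an injective von Neumann algebra. If $\phi:\mathcal X\times\mathcal Y\to\mathcal N$ is a completely bounded bilinear operator, then there exist completely bounded linear maps $\psi_j:\mathcal X\to\mathcal N$ and $\theta_j:\mathcal Y\to\mathcal N$ ($j\in\Lambda$, some index set) such that $\phi(x,y)=\sum_{j\in\Lambda}\psi_j(x)\theta_j(y)$ for all $x\in\mathcal X$, $y\in\mathcal Y$ (weakly convergent sum), the bilinear maps $\Psi(x_1,x_2^* )=\sum_{j\in\Lambda}\psi_j(x_1)\psi_j(x_2)^*$ on $\mathcal X\times\mathcal X^*$ and $\Theta(y_1^*,y_2)=\sum_{j\in\Lambda}\theta_j(y_1)^*\theta_j(y_2)$ on $\mathcal Y^*\times\mathcal Y$ (weakly convergent sums) are completely bounded, and $\|\phi\|_{cb}=\|\Psi\|_{cb}^{1/2}\|\Theta\|_{cb}^{1/2}$.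
   Context: Operator spaces are norm closed subspaces of some $B(H)$ with their matrix norms; $\mathcal X^*=\{x^*:x\in\mathcal X\}$. A von Neumann algebra $\mathcal N$ is injective if for every von Neumann algebra containing it there is a completely positive projection (conditional expectation) onto $\mathcal N$. The $n$-fold amplification of a bilinear map is $\phi_n((x_{ij}),(y_{ij}))=(\sum_{k=1}^n\phi(x_{ik},y_{kj}))$ and $\|\phi\|_{cb}=\sup_n\|\phi_n\|$. *)

theory Defs
  imports "HOL-Analysis.Analysis"
begin

class chilbert = ab_group_add +
  fixes cinner :: "'a \<Rightarrow> 'a \<Rightarrow> complex"
    and scaleC :: "complex \<Rightarrow> 'a \<Rightarrow> 'a"
  assumes scaleC_add_right: "scaleC a (x + y) = scaleC a x + scaleC a y"
    and scaleC_add_left: "scaleC (a + b) x = scaleC a x + scaleC b x"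
    and scaleC_scaleC: "scaleC a (scaleC b x) = scaleC (a * b) x"
    and scaleC_one: "scaleC 1 x = x"
    and cinner_add_left: "cinner (x + y) z = cinner x z + cinner y z"
    and cinner_scaleC_left: "cinner (scaleC a x) z = a * cinner x z"
    and cinner_commute: "cinner x y = cnj (cinner y x)"
    and cinner_ge0: "0 \<le> Re (cinner x x)"
    and cinner_eq0: "cinner x x = 0 \<Longrightarrow> x = 0"
    and chilbert_complete:
      "(\<forall>e>0. \<exists>N::nat. \<forall>m\<ge>N. \<forall>n\<ge>N. sqrt (Re (cinner ((X::nat \<Rightarrow> 'a) m - X n) (X m - X n))) < e)
       \<Longrightarrow> (\<exists>L. \<forall>e>0. \<exists>N::nat. \<forall>n\<ge>N. sqrt (Re (cinner (X n - L) (X n - L))) < e)"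

definition cnorm :: "'a::chilbert \<Rightarrow> real" where
  "cnorm x = sqrt (Re (cinner x x))"

definition clinear_map :: "('a::chilbert \<Rightarrow> 'a) \<Rightarrow> bool" where
  "clinear_map T \<longleftrightarrow> (\<forall>x y. T (x + y) = T x + T y) \<and> (\<forall>c x. T (scaleC c x) = scaleC c (T x))"

definition Bop :: "('a::chilbert \<Rightarrow> 'a) set" where
  "Bop = {T. clinear_map T \<and> (\<exists>C. \<forall>x. cnorm (T x) \<le> C * cnorm x)}"

definition opnorm :: "('a::chilbert \<Rightarrow> 'a) \<Rightarrow> real" where
  "opnorm T = Sup {cnorm (T x) | x. cnorm x \<le> 1}"

definition adjoint :: "('a::chilbert \<Rightarrow> 'a) \<Rightarrow> ('a \<Rightarrow> 'a)" where
  "adjoint T = (THE S. \<forall>x y. cinner (T x) y = cinner x (S y))"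

definition oadd :: "('a::chilbert \<Rightarrow> 'a) \<Rightarrow> ('a \<Rightarrow> 'a) \<Rightarrow> ('a \<Rightarrow> 'a)" where
  "oadd S T = (\<lambda>v. S v + T v)"

definition oscale :: "complex \<Rightarrow> ('a::chilbert \<Rightarrow> 'a) \<Rightarrow> ('a \<Rightarrow> 'a)" where
  "oscale c T = (\<lambda>v. scaleC c (T v))"

definition adj_set :: "('a::chilbert \<Rightarrow> 'a) set \<Rightarrow> ('a \<Rightarrow> 'a) set" where
  "adj_set X = adjoint ` X"

definition vnorm :: "nat \<Rightarrow> (nat \<Rightarrow> 'a::chilbert) \<Rightarrow> real" where
  "vnorm n \<xi> = sqrt (\<Sum>i<n. Re (cinner (\<xi> i) (\<xi> i)))"

text \<open>Norm of (A i j) in M_n(B(H)) = B(H^n).\<close>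
definition mnorm :: "nat \<Rightarrow> (nat \<Rightarrow> nat \<Rightarrow> ('a::chilbert \<Rightarrow> 'a)) \<Rightarrow> real" where
  "mnorm n A = Sup {vnorm n (\<lambda>i. \<Sum>j<n. A i j (\<xi> j)) | \<xi>. vnorm n \<xi> \<le> 1}"

definition Mn :: "nat \<Rightarrow> ('a::chilbert \<Rightarrow> 'a) set \<Rightarrow> (nat \<Rightarrow> nat \<Rightarrow> ('a \<Rightarrow> 'a)) set" where
  "Mn n X = {A. \<forall>i<n. \<forall>j<n. A i j \<in> X}"

definition mpositive :: "nat \<Rightarrow> (nat \<Rightarrow> nat \<Rightarrow> ('a::chilbert \<Rightarrow> 'a)) \<Rightarrow> bool" where
  "mpositive n A \<longleftrightarrow> (\<forall>\<xi>. let z = (\<Sum>i<n. \<Sum>j<n. cinner (A i j (\<xi> j)) (\<xi> i)) in Im z = 0 \<and> 0 \<le> Re z)"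

definition opspace :: "('a::chilbert \<Rightarrow> 'a) set \<Rightarrow> bool" where
  "opspace X \<longleftrightarrow> X \<subseteq> Bop \<and> (\<lambda>v. 0) \<in> X
     \<and> (\<forall>S\<in>X. \<forall>T\<in>X. oadd S T \<in> X) \<and> (\<forall>c. \<forall>S\<in>X. oscale c S \<in> X)
     \<and> (\<forall>T\<in>Bop. (\<forall>e>0. \<exists>S\<in>X. opnorm (\<lambda>v. T v - S v) < e) \<longrightarrow> T \<in> X)"

definition linear_on :: "('a::chilbert \<Rightarrow> 'a) set \<Rightarrow> (('a \<Rightarrow> 'a) \<Rightarrow> ('b::chilbert \<Rightarrow> 'b)) \<Rightarrow> bool" where
  "linear_on X f \<longleftrightarrow> (\<forall>a\<in>X. \<forall>b\<in>X. f (oadd a b) = oadd (f a) (f b))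
                     \<and> (\<forall>c. \<forall>a\<in>X. f (oscale c a) = oscale c (f a))"

definition bilinear_on :: "('a::chilbert \<Rightarrow> 'a) set \<Rightarrow> ('b::chilbert \<Rightarrow> 'b) set
      \<Rightarrow> (('a \<Rightarrow> 'a) \<Rightarrow> ('b \<Rightarrow> 'b) \<Rightarrow> ('c::chilbert \<Rightarrow> 'c)) \<Rightarrow> bool" where
  "bilinear_on X Y \<phi> \<longleftrightarrow> (\<forall>y\<in>Y. linear_on X (\<lambda>x. \<phi> x y)) \<and> (\<forall>x\<in>X. linear_on Y (\<lambda>y. \<phi> x y))"

definition cb_vals_lin :: "('a::chilbert \<Rightarrow> 'a) set \<Rightarrow> (('a \<Rightarrow> 'a) \<Rightarrow> ('b::chilbert \<Rightarrow> 'b)) \<Rightarrow> real set" where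
  "cb_vals_lin X \<psi> = {mnorm n (\<lambda>i j. \<psi> (x i j)) | n x. n \<ge> 1 \<and> x \<in> Mn n X \<and> mnorm n x \<le> 1}"

definition cb_lin where "cb_lin X \<psi> \<longleftrightarrow> bdd_above (cb_vals_lin X \<psi>)"
definition cbnorm_lin where "cbnorm_lin X \<psi> = Sup (cb_vals_lin X \<psi>)"

definition amp2 :: "nat \<Rightarrow> (('a::chilbert \<Rightarrow> 'a) \<Rightarrow> ('b::chilbert \<Rightarrow> 'b) \<Rightarrow> ('c::chilbert \<Rightarrow> 'c))
      \<Rightarrow> (nat \<Rightarrow> nat \<Rightarrow> ('a \<Rightarrow> 'a)) \<Rightarrow> (nat \<Rightarrow> nat \<Rightarrow> ('b \<Rightarrow> 'b)) \<Rightarrow> (nat \<Rightarrow> nat \<Rightarrow> ('c \<Rightarrow> 'c))" where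
  "amp2 n \<phi> x y = (\<lambda>i j v. \<Sum>k<n. \<phi> (x i k) (y k j) v)"

definition cb_vals_bil :: "('a::chilbert \<Rightarrow> 'a) set \<Rightarrow> ('b::chilbert \<Rightarrow> 'b) set
      \<Rightarrow> (('a \<Rightarrow> 'a) \<Rightarrow> ('b \<Rightarrow> 'b) \<Rightarrow> ('c::chilbert \<Rightarrow> 'c)) \<Rightarrow> real set" where
  "cb_vals_bil X Y \<phi> = {mnorm n (amp2 n \<phi> x y) | n x y.
       n \<ge> 1 \<and> x \<in> Mn n X \<and> y \<in> Mn n Y \<and> mnorm n x \<le> 1 \<and> mnorm n y \<le> 1}"

definition cb_bil where "cb_bil X Y \<phi> \<longleftrightarrow> bdd_above (cb_vals_bil X Y \<phi>)"
definition cbnorm_bil where "cbnorm_bil X Y \<phi> = Sup (cb_vals_bil X Y \<phi>)"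

definition commutant :: "('a::chilbert \<Rightarrow> 'a) set \<Rightarrow> ('a \<Rightarrow> 'a) set" where
  "commutant S = {T \<in> Bop. \<forall>s\<in>S. T \<circ> s = s \<circ> T}"

definition vN_algebra :: "('a::chilbert \<Rightarrow> 'a) set \<Rightarrow> bool" where
  "vN_algebra N \<longleftrightarrow> N \<subseteq> Bop \<and> (\<forall>T\<in>N. adjoint T \<in> N) \<and> commutant (commutant N) = N"

definition cp_on :: "('a::chilbert \<Rightarrow> 'a) set \<Rightarrow> (('a \<Rightarrow> 'a) \<Rightarrow> ('a \<Rightarrow> 'a)) \<Rightarrow> bool" where
  "cp_on M E \<longleftrightarrow> (\<forall>n. \<forall>A \<in> Mn n M. mpositive n A \<longrightarrow> mpositive n (\<lambda>i j. E (A i j)))"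

definition injective_vN :: "('a::chilbert \<Rightarrow> 'a) set \<Rightarrow> bool" where
  "injective_vN N \<longleftrightarrow> vN_algebra N \<and>
     (\<forall>M. vN_algebra M \<and> N \<subseteq> M \<longrightarrow>
        (\<exists>E. linear_on M E \<and> cp_on M E \<and> (\<forall>T\<in>M. E T \<in> N) \<and> (\<forall>T\<in>N. E T = T)))"

definition wsum :: "'j set \<Rightarrow> ('j \<Rightarrow> ('a::chilbert \<Rightarrow> 'a)) \<Rightarrow> ('a \<Rightarrow> 'a) \<Rightarrow> bool" where
  "wsum \<Lambda> f T \<longleftrightarrow> (\<forall>\<xi> \<eta>. ((\<lambda>j. cinner (f j \<xi>) \<eta>) has_sum cinner (T \<xi>) \<eta>) \<Lambda>)"

end

theory Submission
  imports Defs
begin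

text \<open>
Suppose \<open>\<parallel>\<phi>\<parallel>\<^sub>c\<^sub>b = c > 0\<close>. A Hahn--Banach argument (in the spirit of Christensen and Sinclair) gives
completely positive kernels \<open>\<Psi>(x\<^sub>1, x\<^sub>2)\<close>, \<open>\<Theta>(y\<^sub>1, y\<^sub>2)\<close> with values in \<open>B(K)\<close> and completely bounded norm at
most \<open>c\<close> such that the block matrix with diagonal \<open>\<Psi>, \<Theta>\<close> and corner \<open>\<phi>\<close> is a positive definite kernel
on the disjoint union of \<open>X\<close> and \<open>Y\<close>. Its consistency rests on the Cholesky decomposition
\<open>a = S S\<^sup>*\<close>: if \<open>x x\<^sup>* \<le> a \<otimes> 1\<close> for a matrix \<open>x\<close> over \<open>X\<close>, then \<open>x = S x'\<close> with a contraction \<open>x'\<close> over \<open>X\<close>.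
The completely positive projection \<open>B(K) \<rightarrow> N\<close>, applied entrywise, makes the kernel \<open>N\<close>-valued
and leaves the corner \<open>\<phi>\<close> unchanged.

A positive definite \<open>N\<close>-valued kernel \<open>\<kappa>\<close> is a weak sum \<open>\<kappa>(s, t) = \<Sum>\<^sub>v v(s) v(t)\<^sup>*\<close> of functions \<open>v\<close> with values
in \<open>N\<close>, by Zorn's lemma. Setting \<open>\<psi>(x) = v(x)\<close> and \<open>\<theta>(y) = v(y)\<^sup>*\<close> gives the three sums at once; linearity and
complete boundedness of \<open>\<psi>\<close> and \<open>\<theta>\<close> follow from \<open>v(s) v(t)\<^sup>* \<le> \<kappa>(s, t)\<close> as kernels. The inequality
\<open>c \<le> \<parallel>\<Psi>\<parallel>\<^sub>c\<^sub>b\<^sup>1\<^sup>/\<^sup>2 \<parallel>\<Theta>\<parallel>\<^sub>c\<^sub>b\<^sup>1\<^sup>/\<^sup>2\<close> is the Cauchy--Schwarz inequality for \<open>\<kappa>\<close>.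
\<close>

subsection \<open>Hilbert spaces and bounded operators\<close>

text \<open>\<Psi> and \<Theta> are found without constructing a representation. They come from
  means of h^* x x'^* h over all maps h from K to H1, linear or not, and of h^* y^* y' h over all
  maps h from K to H2. Arbitrary maps are the point: finitely many values of h can be prescribed
  freely, so that domination of quadratic expressions in h says that a scalar matrix dominates an
  operator matrix, which is the input of the Cholesky argument. Linearity returns in the mean,
  because a combination of vectors that vanishes has prescribed mean square zero. Estimates are kept
  in the additive form 2 Re ab \<le> a^2 + b^2. It is linear in the data, as separation demands, and
  products of norms are recovered later by optimising a scale. The symmetric normalisation gives
  both kernels the same bound c, so the product of the two square roots cannot exceed c. This bound
  survives the projection into N because the projection is unital.\<close>

lemma scaleC_zero_right [simp]: "scaleC c (0::'a::chilbert) = 0"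
  using scaleC_add_right[of c "0::'a" 0] by simp

lemma scaleC_zero_left [simp]: "scaleC 0 (x::'a::chilbert) = 0"
  using scaleC_add_left[of 0 0 x] by simp

lemma scaleC_minus_left: "scaleC (- c) x = - scaleC c (x::'a::chilbert)"
proof -
  have "scaleC (- c) x + scaleC c x = 0"
    by (simp flip: scaleC_add_left)
  then show ?thesis by (simp add: add_eq_0_iff2)
qed

lemma scaleC_sum_right: "scaleC c (\<Sum>i\<in>I. f i) = (\<Sum>i\<in>I. scaleC c (f i :: 'a::chilbert))"
  by (induction I rule: infinite_finite_induct) (auto simp: scaleC_add_right)

lemma scaleC_sum_left: "scaleC (\<Sum>i\<in>I. f i) x = (\<Sum>i\<in>I. scaleC (f i) (x :: 'a::chilbert))"
  by (induction I rule: infinite_finite_induct) (auto simp: scaleC_add_left)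

lemma cinner_zero_left [simp]: "cinner 0 (x::'a::chilbert) = 0"
  using cinner_add_left[of 0 0 x] by simp

lemma cinner_zero_right [simp]: "cinner (x::'a::chilbert) 0 = 0"
  using cinner_commute[of x 0] by simp

lemma cinner_add_right: "cinner x (y + z) = cinner x y + cinner x (z::'a::chilbert)"
  by (metis cinner_add_left cinner_commute complex_cnj_add)

lemma cinner_scaleC_right: "cinner x (scaleC c y) = cnj c * cinner x (y::'a::chilbert)"
  by (metis cinner_scaleC_left cinner_commute complex_cnj_mult)

lemma cinner_minus_left: "cinner (- x) y = - cinner x (y::'a::chilbert)"
  using cinner_add_left[of x "- x" y] by (simp add: add_eq_0_iff)

lemma cinner_minus_right: "cinner x (- y) = - cinner x (y::'a::chilbert)"
  using cinner_add_right[of x y "- y"] by (simp add: add_eq_0_iff)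

lemma cinner_diff_left: "cinner (x - y) z = cinner x z - cinner y (z::'a::chilbert)"
  by (metis cinner_add_left cinner_minus_left diff_conv_add_uminus)

lemma cinner_diff_right: "cinner x (y - z) = cinner x y - cinner x (z::'a::chilbert)"
  by (metis cinner_add_right cinner_minus_right diff_conv_add_uminus)

lemma cinner_sum_left: "cinner (\<Sum>i\<in>I. f i) x = (\<Sum>i\<in>I. cinner (f i) (x :: 'a::chilbert))"
  by (induction I rule: infinite_finite_induct) (auto simp: cinner_add_left)

lemma cinner_sum_right: "cinner x (\<Sum>i\<in>I. f i) = (\<Sum>i\<in>I. cinner (x :: 'a::chilbert) (f i))"
  by (induction I rule: infinite_finite_induct) (auto simp: cinner_add_right)

lemmas cinner_simps = cinner_add_left cinner_add_right cinner_diff_left cinner_diff_right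
  cinner_minus_left cinner_minus_right cinner_scaleC_left cinner_scaleC_right

lemma cnorm_power2: "(cnorm x)\<^sup>2 = Re (cinner x (x::'a::chilbert))"
  by (simp add: cnorm_def cinner_ge0)

lemma cnorm_ge0 [simp]: "0 \<le> cnorm (x::'a::chilbert)"
  by (simp add: cnorm_def cinner_ge0)

lemma cinner_self: "cinner x x = complex_of_real ((cnorm (x::'a::chilbert))\<^sup>2)"
proof -
  have "Im (cinner x x) = - Im (cinner x x)"
    by (subst cinner_commute) simp
  then show ?thesis by (simp add: cnorm_power2 complex_eq_iff)
qed

lemma cnorm_zero [simp]: "cnorm (0::'a::chilbert) = 0"
  by (simp add: cnorm_def)

lemma cnorm_eq_0 [simp]: "cnorm (x::'a::chilbert) = 0 \<longleftrightarrow> x = 0"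
  using cinner_self[of x] cinner_eq0[of x] by auto

lemma cnorm_minus [simp]: "cnorm (- x) = cnorm (x::'a::chilbert)"
  by (simp add: cnorm_def cinner_simps)

lemma cnorm_scaleC: "cnorm (scaleC c x) = norm c * cnorm (x::'a::chilbert)"
proof (rule power2_eq_imp_eq)
  have "cinner (scaleC c x) (scaleC c x) = (c * cnj c) * cinner x x"
    by (simp add: cinner_simps)
  also have "\<dots> = complex_of_real ((norm c)\<^sup>2 * (cnorm x)\<^sup>2)"
    by (simp add: cinner_self flip: complex_norm_square)
  finally show "(cnorm (scaleC c x))\<^sup>2 = (norm c * cnorm x)\<^sup>2"
    by (simp add: cnorm_power2 power_mult_distrib)
qed auto

lemma Re_cinner_commute: "Re (cinner x y) = Re (cinner y (x::'a::chilbert))"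
  by (subst cinner_commute) simp

lemma cnorm_add_power2: "(cnorm (x + y))\<^sup>2 = (cnorm x)\<^sup>2 + 2 * Re (cinner x y) + (cnorm (y::'a::chilbert))\<^sup>2"
  by (simp add: cnorm_power2 cinner_simps Re_cinner_commute[of y x])

lemma cnorm_diff_power2: "(cnorm (x - y))\<^sup>2 = (cnorm x)\<^sup>2 - 2 * Re (cinner x y) + (cnorm (y::'a::chilbert))\<^sup>2"
  by (simp add: cnorm_power2 cinner_simps Re_cinner_commute[of y x])

lemma two_Re_cinner_le: "2 * Re (cinner x y) \<le> (cnorm x)\<^sup>2 + (cnorm (y::'a::chilbert))\<^sup>2"
  using cnorm_diff_power2[of x y] zero_le_power2[of "cnorm (x - y)"] by linarith

text \<open>A unimodular phase u rotates the inner product onto the positive real axis and leaves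
  the norms unchanged.\<close>

lemma two_norm_cinner_le: "2 * norm (cinner x y) \<le> (cnorm x)\<^sup>2 + (cnorm (y::'a::chilbert))\<^sup>2"
proof (cases "cinner x y = 0")
  case False
  define u where "u = cnj (cinner x y) / norm (cinner x y)"
  have u: "norm u = 1" using False by (simp add: u_def norm_divide)
  have "u * cinner x y = complex_of_real (norm (cinner x y))"
  proof -
    have "u * cinner x y = complex_of_real ((norm (cinner x y))\<^sup>2) / norm (cinner x y)"
      unfolding u_def complex_norm_square by (simp add: mult.commute)
    then show ?thesis using False by (simp add: power2_eq_square)
  qed
  then have "Re (cinner (scaleC u x) y) = norm (cinner x y)"
    by (simp add: cinner_simps)
  then show ?thesis
    using two_Re_cinner_le[of "scaleC u x" y] u by (simp add: cnorm_scaleC)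
qed auto

text \<open>The additive inequality loses nothing between vectors of equal norm, so x is first
  rescaled by r to the norm of y.\<close>

lemma cauchy_schwarz: "norm (cinner x y) \<le> cnorm x * cnorm (y::'a::chilbert)"
proof (cases "x = 0 \<or> y = 0")
  case False
  then have pos: "cnorm x > 0" "cnorm y > 0"
    by (simp_all add: order_less_le)
  define r where "r = cnorm y / cnorm x"
  have r: "r > 0" using pos by (simp add: r_def)
  have "2 * norm (cinner (scaleC (of_real r) x) y) \<le> (r * cnorm x)\<^sup>2 + (cnorm y)\<^sup>2"
    using two_norm_cinner_le[of "scaleC (of_real r) x" y] r by (simp add: cnorm_scaleC)
  then have "2 * r * norm (cinner x y) \<le> 2 * (cnorm y)\<^sup>2"
    using r pos False by (simp add: cinner_simps norm_mult r_def norm_divide)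
  then show ?thesis using r pos by (simp add: r_def field_simps power2_eq_square)
qed auto

lemma cnorm_triangle: "cnorm (x + y) \<le> cnorm x + cnorm (y::'a::chilbert)"
proof (rule power2_le_imp_le)
  have "Re (cinner x y) \<le> cnorm x * cnorm y"
    using cauchy_schwarz[of x y] complex_Re_le_cmod[of "cinner x y"] by linarith
  then show "(cnorm (x + y))\<^sup>2 \<le> (cnorm x + cnorm y)\<^sup>2"
    by (simp add: cnorm_add_power2 power2_sum)
qed auto

lemma cnorm_sum_le: "cnorm (\<Sum>i\<in>I. f i :: 'a::chilbert) \<le> (\<Sum>i\<in>I. cnorm (f i))"
proof (induction I rule: infinite_finite_induct)
  case (insert i I)
  then show ?case using cnorm_triangle[of "f i" "sum f I"] by simp
qed auto

lemma cinner_ext_left: "(\<And>z. cinner x z = cinner y z) \<Longrightarrow> x = (y::'a::chilbert)"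
proof -
  assume "\<And>z. cinner x z = cinner y z"
  then have "cinner (x - y) (x - y) = 0" by (simp add: cinner_diff_left)
  then show ?thesis using cinner_eq0 by fastforce
qed

lemma cinner_ext_right: "(\<And>z. cinner z x = cinner z y) \<Longrightarrow> x = (y::'a::chilbert)"
  by (rule cinner_ext_left) (metis cinner_commute)

text \<open>The representing vector is the minimiser of J x = |x|^2 - 2 Re (f x). Minimising
  sequences are Cauchy by the parallelogram law, and the vanishing first variation at the minimum is
  the representation formula. This is where completeness of the space enters.\<close>

theorem riesz:
  fixes f :: "'a::chilbert \<Rightarrow> complex"
  assumes add: "\<And>x y. f (x + y) = f x + f y"
    and scale: "\<And>c x. f (scaleC c x) = c * f x"
    and bd: "\<And>x. norm (f x) \<le> C * cnorm x"
  shows "\<exists>w. \<forall>x. f x = cinner x w"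
proof -
  define J where "J x = (cnorm x)\<^sup>2 - 2 * Re (f x)" for x
  have J_bd: "- C\<^sup>2 \<le> J x" for x
  proof -
    have "Re (f x) \<le> C * cnorm x"
      using bd[of x] complex_Re_le_cmod[of "f x"] by linarith
    moreover have "0 \<le> (cnorm x - C)\<^sup>2" by simp
    ultimately show ?thesis unfolding J_def power2_diff by (simp add: algebra_simps)
  qed
  define d where "d = Inf (range J)"
  have d_le: "d \<le> J x" for x
    unfolding d_def by (rule cInf_lower) (use J_bd in \<open>auto simp: bdd_below_def\<close>)
  have "\<exists>x. J x < d + 1 / real (Suc n)" for n
  proof -
    have "Inf (range J) < d + 1 / real (Suc n)" by (simp add: d_def)
    then show ?thesis by (subst (asm) cInf_less_iff) (use J_bd in \<open>auto simp: bdd_below_def\<close>)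
  qed
  then obtain s where s: "\<And>n. J (s n) < d + 1 / real (Suc n)" by metis
  \<comment> \<open>The value of J at the midpoint is at least d, so two vectors that almost
    minimise J are close to each other.\<close>
  have par: "(cnorm (x - y))\<^sup>2 \<le> 2 * (J x - d) + 2 * (J y - d)" for x y
  proof -
    define m where "m = scaleC (1/2) (x + y)"
    have "(cnorm m)\<^sup>2 = ((cnorm x)\<^sup>2 + 2 * Re (cinner x y) + (cnorm y)\<^sup>2) / 4"
      by (simp add: m_def cnorm_scaleC cnorm_add_power2 power_mult_distrib power_divide norm_divide)
    moreover have "Re (f m) = (Re (f x) + Re (f y)) / 2"
      by (simp add: m_def scale add)
    ultimately have "(cnorm (x - y))\<^sup>2 = 2 * J x + 2 * J y - 4 * J m"
      by (simp add: J_def cnorm_diff_power2)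
    moreover have "4 * d \<le> 4 * J m" using d_le[of m] by simp
    ultimately show ?thesis by (simp add: algebra_simps)
  qed
  have inv0: "\<exists>N. \<forall>n\<ge>N. 1 / real (Suc n) < e" if e: "e > 0" for e :: real
  proof -
    obtain N where "inverse (real (Suc N)) < e" using reals_Archimedean[OF e] by blast
    moreover have "1 / real (Suc n) \<le> 1 / real (Suc N)" if "n \<ge> N" for n
      using that by (intro divide_left_mono) auto
    ultimately show ?thesis by (intro exI[of _ N]) (auto simp: inverse_eq_divide intro: le_less_trans)
  qed
  have "\<exists>N. \<forall>m\<ge>N. \<forall>n\<ge>N. sqrt (Re (cinner (s m - s n) (s m - s n))) < e" if e: "e > 0" for e :: real
  proof -
    obtain N where N: "\<And>n. n \<ge> N \<Longrightarrow> 1 / real (Suc n) < e\<^sup>2 / 4"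
      using inv0[of "e\<^sup>2 / 4"] e by auto
    have "cnorm (s m - s n) < e" if "m \<ge> N" "n \<ge> N" for m n
    proof (rule power2_less_imp_less)
      have "J (s m) - d < e\<^sup>2 / 4" "J (s n) - d < e\<^sup>2 / 4"
        using s[of m] s[of n] N[OF that(1)] N[OF that(2)] by simp_all
      then show "(cnorm (s m - s n))\<^sup>2 < e\<^sup>2"
        using par[of "s m" "s n"] by argo
    qed (use e in auto)
    then show ?thesis unfolding cnorm_def by blast
  qed
  then obtain L where L: "\<And>e. e > 0 \<Longrightarrow> \<exists>N. \<forall>n\<ge>N. cnorm (s n - L) < e"
    using chilbert_complete[of s] unfolding cnorm_def by blast
  \<comment> \<open>Continuity of J at L with explicit constants: e is so small that J L exceeds J
    (s n) by at most half of the assumed gap J L - d, while s n itself misses d by less than half of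
    it.\<close>
  have JL: "J L = d"
  proof (rule ccontr)
    assume "J L \<noteq> d"
    then have gt: "J L - d > 0" using d_le[of L] by simp
    define B where "B = 2 * cnorm L + 2 * \<bar>C\<bar> + 1"
    have B: "B > 0" by (simp add: B_def add_nonneg_pos)
    define e where "e = min 1 ((J L - d) / (2 * B))"
    have e: "e > 0" using gt B by (simp add: e_def)
    obtain N1 where N1: "\<And>n. n \<ge> N1 \<Longrightarrow> cnorm (s n - L) < e" using L[OF e] by blast
    obtain N2 where N2: "\<And>n. n \<ge> N2 \<Longrightarrow> 1 / real (Suc n) < (J L - d) / 2" using inv0 gt by (metis half_gt_zero)
    define n where "n = max N1 N2"
    define u where "u = s n - L"
    have u: "cnorm u < e" using N1[of n] by (simp add: u_def n_def)
    have sn: "J (s n) < d + (J L - d) / 2" using s[of n] N2[of n] max.cobounded2[of N2 N1] unfolding n_def by argo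
    have "J (s n) = J L + (cnorm u)\<^sup>2 + 2 * Re (cinner L u) - 2 * Re (f u)"
    proof -
      have "s n = L + u" by (simp add: u_def)
      then show ?thesis by (simp add: J_def add cnorm_add_power2)
    qed
    moreover have "\<bar>Re (cinner L u)\<bar> \<le> cnorm L * cnorm u"
      using cauchy_schwarz[of L u] abs_Re_le_cmod[of "cinner L u"] by linarith
    moreover have "\<bar>Re (f u)\<bar> \<le> \<bar>C\<bar> * cnorm u"
      using bd[of u] abs_Re_le_cmod[of "f u"] mult_right_mono[OF abs_ge_self[of C] cnorm_ge0[of u]] by linarith
    ultimately have "J L - J (s n) \<le> 2 * (cnorm L * cnorm u) + 2 * (\<bar>C\<bar> * cnorm u)"
      using zero_le_power2[of "cnorm u"] by linarith
    also have "\<dots> = (2 * cnorm L + 2 * \<bar>C\<bar>) * cnorm u"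
      by (simp add: algebra_simps)
    also have "\<dots> \<le> B * e" using u B by (intro mult_mono) (auto simp: B_def)
    also have "\<dots> \<le> (J L - d) / 2" using B gt by (simp add: e_def min_def field_simps)
    finally show False using sn by argo
  qed
  have Re_eq: "Re (f y) = Re (cinner y L)" for y
  proof (rule ccontr)
    define r where "r = Re (f y) - Re (cinner y L)"
    assume "Re (f y) \<noteq> Re (cinner y L)"
    then have r: "r \<noteq> 0" by (simp add: r_def)
    \<comment> \<open>First variation at the minimiser in direction y. For t = r / b the linear term
      on the left outweighs the quadratic one on the right unless r = 0.\<close>
    have q: "2 * t * r \<le> t\<^sup>2 * (cnorm y)\<^sup>2" for t :: real
    proof -
      have "J L \<le> J (L + scaleC (of_real t) y)" using JL d_le by simp
      then show ?thesis
        by (simp add: J_def add scale cnorm_add_power2 cinner_simps cnorm_scaleC r_def power_mult_distrib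
          Re_cinner_commute[of L y] algebra_simps)
    qed
    define b where "b = (cnorm y)\<^sup>2 + 1"
    have b: "b > 0" by (simp add: b_def add_nonneg_pos)
    have "2 * r\<^sup>2 / b \<le> r\<^sup>2 * (cnorm y)\<^sup>2 / b\<^sup>2"
      using q[of "r / b"] by (simp add: power_divide power2_eq_square)
    also have "\<dots> \<le> r\<^sup>2 * b / b\<^sup>2" by (intro divide_right_mono mult_left_mono) (auto simp: b_def)
    also have "\<dots> = r\<^sup>2 / b" using b by (simp add: power2_eq_square)
    finally have "r\<^sup>2 / b \<le> 0" by simp
    then show False using r b by (simp add: divide_le_0_iff)
  qed
  have "f y = cinner y L" for y
  proof (rule complex_eqI)
    show "Re (f y) = Re (cinner y L)" by (rule Re_eq)
    have "Re (f (scaleC (-\<i>) y)) = Re (cinner (scaleC (-\<i>) y) L)" by (rule Re_eq)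
    then show "Im (f y) = Im (cinner y L)" by (simp add: scale cinner_simps)
  qed
  then show ?thesis by blast
qed

section \<open>Bounded operators and their adjoints\<close>

lemma Bop_add: "T \<in> Bop \<Longrightarrow> T (x + y) = T x + T y"
  by (simp add: Bop_def clinear_map_def)

lemma Bop_scale: "T \<in> Bop \<Longrightarrow> T (scaleC c x) = scaleC c (T x)"
  by (simp add: Bop_def clinear_map_def)

lemma Bop_zero [simp]: "T \<in> Bop \<Longrightarrow> T 0 = 0"
  using Bop_scale[of T 0 0] by simp

lemma Bop_minus: "T \<in> Bop \<Longrightarrow> T (- x) = - T x"
  using Bop_scale[of T "-1" x] by (simp add: scaleC_minus_left scaleC_one)

lemma Bop_sum: "T \<in> Bop \<Longrightarrow> T (\<Sum>i\<in>I. f i) = (\<Sum>i\<in>I. T (f i))"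
  by (induction I rule: infinite_finite_induct) (auto simp: Bop_add)

lemma Bop_bound: "T \<in> Bop \<Longrightarrow> \<exists>C>0. \<forall>x. cnorm (T x) \<le> C * cnorm x"
proof -
  assume "T \<in> Bop"
  then obtain C where C: "\<And>x. cnorm (T x) \<le> C * cnorm x" by (auto simp: Bop_def)
  have "cnorm (T x) \<le> (\<bar>C\<bar> + 1) * cnorm x" for x
    using C[of x] mult_right_mono[of C "\<bar>C\<bar> + 1" "cnorm x"] by fastforce
  then show ?thesis by (intro exI[of _ "\<bar>C\<bar> + 1"]) auto
qed

lemma BopI:
  assumes "\<And>x y. T (x + y) = T x + T y" "\<And>c x. T (scaleC c x) = scaleC c (T x)"
    and "\<And>x. cnorm (T x) \<le> C * cnorm x"
  shows "T \<in> Bop"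
  using assms unfolding Bop_def clinear_map_def by blast

lemma Bop_eqI:
  assumes "\<And>x y. cinner (S x) y = cinner (T x) y"
  shows "S = T"
  using assms cinner_ext_left by blast

lemma Bop_oadd: "S \<in> Bop \<Longrightarrow> T \<in> Bop \<Longrightarrow> oadd S T \<in> Bop"
proof -
  assume S: "S \<in> Bop" and T: "T \<in> Bop"
  obtain C D where "\<And>x. cnorm (S x) \<le> C * cnorm x" "\<And>x. cnorm (T x) \<le> D * cnorm x"
    using Bop_bound[OF S] Bop_bound[OF T] by blast
  then have "cnorm (S x + T x) \<le> (C + D) * cnorm x" for x
    using cnorm_triangle[of "S x" "T x"] by (smt (verit) distrib_right)
  then show ?thesis
    by (intro BopI[where C = "C + D"]) (auto simp: oadd_def Bop_add[OF S] Bop_add[OF T] Bop_scale[OF S]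
      Bop_scale[OF T] scaleC_add_right)
qed

lemma Bop_oscale: "T \<in> Bop \<Longrightarrow> oscale c T \<in> Bop"
proof -
  assume T: "T \<in> Bop"
  obtain D where D: "\<And>x. cnorm (T x) \<le> D * cnorm x"
    using Bop_bound[OF T] by blast
  have "cnorm (scaleC c (T x)) \<le> (norm c * D) * cnorm x" for x
    using mult_left_mono[OF D[of x], of "norm c"] by (simp add: cnorm_scaleC mult.assoc)
  then show ?thesis
    by (intro BopI[where C = "norm c * D"])
      (auto simp: oscale_def Bop_add[OF T] Bop_scale[OF T] scaleC_add_right scaleC_scaleC mult.commute)
qed

lemma Bop_0: "(\<lambda>v. 0) \<in> Bop"
  by (rule BopI[where C = 0]) auto

lemma Bop_id: "(\<lambda>v. v) \<in> Bop"
  by (rule BopI[where C = 1]) auto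

text \<open>The bound is assumed in the additive form; rescaling one of the arguments turns it into
  the usual one.\<close>
lemma sesquilinear_operator:
  fixes B :: "'a::chilbert \<Rightarrow> 'a \<Rightarrow> complex"
  assumes addl: "\<And>x y z. B (x + y) z = B x z + B y z"
    and scl: "\<And>c x z. B (scaleC c x) z = c * B x z"
    and addr: "\<And>x y z. B x (y + z) = B x y + B x z"
    and scr: "\<And>c x z. B x (scaleC c z) = cnj c * B x z"
    and bd: "\<And>x y. norm (B x y) \<le> C * ((cnorm x)\<^sup>2 + (cnorm y)\<^sup>2)"
  shows "\<exists>T\<in>Bop. \<forall>x y. cinner (T x) y = B x y"
proof -
  have bd': "norm (B x y) \<le> 2 * C * cnorm x * cnorm y" for x y
  proof (cases "x = 0 \<or> y = 0")
    case True
    then show ?thesis using scl[of 0 0 y] scr[of x 0 0] by auto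
  next
    case False
    then have pos: "cnorm x > 0" "cnorm y > 0" by (simp_all add: order_less_le)
    define r where "r = cnorm y / cnorm x"
    have r: "r > 0" using pos by (simp add: r_def)
    have "r * norm (B x y) \<le> C * ((r * cnorm x)\<^sup>2 + (cnorm y)\<^sup>2)"
      using bd[of "scaleC (of_real r) x" y] r by (simp add: scl norm_mult cnorm_scaleC)
    also have "\<dots> = 2 * C * (cnorm y)\<^sup>2" using pos False by (simp add: r_def)
    finally show ?thesis using r pos by (simp add: r_def field_simps power2_eq_square)
  qed
  have "\<exists>w. \<forall>y. cnj (B x y) = cinner y w" for x
    by (rule riesz[where C = "2 * C * cnorm x"]) (auto simp: addr scr bd')
  then obtain T where T: "\<And>x y. cnj (B x y) = cinner y (T x)" by metis
  have T: "cinner (T x) y = B x y" for x y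
    using T[of x y] by (metis cinner_commute complex_cnj_cnj)
  have "T \<in> Bop"
  proof (rule BopI[where C = "2 * C"])
    show "T (x + y) = T x + T y" for x y
      by (rule cinner_ext_left) (simp add: T cinner_simps addl)
    show "T (scaleC c x) = scaleC c (T x)" for c x
      by (rule cinner_ext_left) (simp add: T cinner_simps scl)
    show "cnorm (T x) \<le> 2 * C * cnorm x" for x
    proof (cases "T x = 0")
      case True
      have "0 \<le> C * (cnorm x)\<^sup>2" using bd[of x 0] norm_ge_zero[of "B x 0"] by (simp del: norm_ge_zero)
      then have "x \<noteq> 0 \<Longrightarrow> 0 \<le> C" by (simp add: zero_le_mult_iff)
      then show ?thesis using True by (cases "x = 0") auto
    next
      case False
      then have "cnorm (T x) > 0" by (simp add: order_less_le)
      moreover have "cnorm (T x) * cnorm (T x) \<le> 2 * C * cnorm x * cnorm (T x)"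
        using bd'[of x "T x"] cinner_self[of "T x"] by (simp add: power2_eq_square norm_mult flip: T)
      ultimately show ?thesis by simp
    qed
  qed
  with T show ?thesis by blast
qed

lemma adjoint_ex:
  assumes T: "T \<in> Bop"
  shows "\<exists>S\<in>Bop. \<forall>x y. cinner (T x) y = cinner x (S y)"
proof -
  obtain C where C: "C > 0" "\<And>x. cnorm (T x) \<le> C * cnorm x" using Bop_bound[OF T] by blast
  have "\<exists>S\<in>Bop. \<forall>x y. cinner (S x) y = cinner x (T y)"
  proof (rule sesquilinear_operator[where C = "C"])
    fix x y
    have "norm (cinner x (T y)) \<le> cnorm x * (C * cnorm y)"
      using cauchy_schwarz[of x "T y"] mult_left_mono[OF C(2)[of y] cnorm_ge0[of x]] by linarith
    also have "\<dots> = C * (cnorm x * cnorm y)" by simp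
    also have "\<dots> \<le> C * ((cnorm x)\<^sup>2 + (cnorm y)\<^sup>2)"
      using sum_squares_bound[of "cnorm x" "cnorm y"] C(1) mult_nonneg_nonneg[OF cnorm_ge0[of x] cnorm_ge0[of y]]
      by (intro mult_left_mono) linarith+
    finally show "norm (cinner x (T y)) \<le> C * ((cnorm x)\<^sup>2 + (cnorm y)\<^sup>2)" .
  qed (auto simp: cinner_simps Bop_add[OF T] Bop_scale[OF T])
  then show ?thesis by (metis cinner_commute)
qed

lemma
  assumes T: "T \<in> Bop"
  shows adjoint_Bop: "adjoint T \<in> Bop"
    and cinner_adjoint: "cinner (T x) y = cinner x (adjoint T y)"
proof -
  obtain S where S: "S \<in> Bop" "\<And>x y. cinner (T x) y = cinner x (S y)" using adjoint_ex[OF T] by blast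
  have "adjoint T = S" unfolding adjoint_def
  proof (rule the_equality)
    fix S' assume S': "\<forall>x y. cinner (T x) y = cinner x (S' y)"
    show "S' = S"
    proof
      show "S' y = S y" for y by (rule cinner_ext_right) (use S' S(2) in simp)
    qed
  qed (use S in auto)
  then show "adjoint T \<in> Bop" "cinner (T x) y = cinner x (adjoint T y)" using S by auto
qed

lemma cinner_adjoint': "T \<in> Bop \<Longrightarrow> cinner (adjoint T x) y = cinner x (T y)"
  by (subst (1 2) cinner_commute) (simp add: cinner_adjoint)

lemma adjoint_eqI:
  assumes "T \<in> Bop" "\<And>x y. cinner (T x) y = cinner x (S y)"
  shows "adjoint T = S"
proof
  show "adjoint T y = S y" for y
    by (rule cinner_ext_right) (simp add: assms flip: cinner_adjoint)
qed

lemma adjoint_adjoint: "T \<in> Bop \<Longrightarrow> adjoint (adjoint T) = T"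
  by (intro adjoint_eqI adjoint_Bop cinner_adjoint')

lemma adjoint_oadd:
  assumes "S \<in> Bop" "T \<in> Bop"
  shows "adjoint (oadd S T) = oadd (adjoint S) (adjoint T)"
  by (rule adjoint_eqI) (use assms Bop_oadd[OF assms] in \<open>auto simp: oadd_def cinner_simps cinner_adjoint\<close>)

lemma adjoint_oscale:
  assumes "T \<in> Bop"
  shows "adjoint (oscale c T) = oscale (cnj c) (adjoint T)"
  by (rule adjoint_eqI) (use assms Bop_oscale[OF assms] in \<open>auto simp: oscale_def cinner_simps cinner_adjoint\<close>)

section \<open>Von Neumann algebras and commutants\<close>

lemma vN_BopD: "vN_algebra N \<Longrightarrow> T \<in> N \<Longrightarrow> T \<in> Bop"
  by (auto simp: vN_algebra_def)

lemma vN_adjoint: "vN_algebra N \<Longrightarrow> T \<in> N \<Longrightarrow> adjoint T \<in> N"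
  by (auto simp: vN_algebra_def)

text \<open>The bicommutant condition makes membership algebraic: an operator known only through
  weak sums lies in N as soon as it commutes with the commutant, without any appeal to operator
  topologies.\<close>

lemma vN_memI: "vN_algebra N \<Longrightarrow> T \<in> Bop \<Longrightarrow> (\<And>S. S \<in> commutant N \<Longrightarrow> T \<circ> S = S \<circ> T) \<Longrightarrow> T \<in> N"
  unfolding vN_algebra_def by (auto simp: commutant_def)

lemma commutantD: "S \<in> commutant N \<Longrightarrow> T \<in> N \<Longrightarrow> S (T x) = T (S x)"
  unfolding commutant_def by (auto simp: fun_eq_iff)

lemma commutant_Bop: "S \<in> commutant N \<Longrightarrow> S \<in> Bop"
  by (simp add: commutant_def)

lemma vN_id: "vN_algebra N \<Longrightarrow> (\<lambda>v. v) \<in> N"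
  by (rule vN_memI) (auto simp: Bop_id)

lemma vN_oscale: "vN_algebra N \<Longrightarrow> T \<in> N \<Longrightarrow> oscale c T \<in> N"
proof (rule vN_memI)
  assume N: "vN_algebra N" and T: "T \<in> N"
  show "oscale c T \<in> Bop" using N T by (intro Bop_oscale vN_BopD)
  show "oscale c T \<circ> S = S \<circ> oscale c T" if "S \<in> commutant N" for S
    using commutantD[OF that T] by (auto simp: oscale_def Bop_scale[OF commutant_Bop[OF that]])
qed

text \<open>Holds because N is closed under adjoints. It is needed when weak sums are tested for
  commutation: moving T across the inner product leaves its adjoint on the other side.\<close>

lemma commutant_adjoint:
  assumes N: "vN_algebra N" and S: "S \<in> commutant N"
  shows "adjoint S \<in> commutant N"
proof -
  have SB: "S \<in> Bop" using S by (rule commutant_Bop)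
  have "adjoint S (T x) = T (adjoint S x)" if T: "T \<in> N" for T x
  proof (rule cinner_ext_left)
    fix z
    have TB: "T \<in> Bop" using N T by (rule vN_BopD)
    have "cinner (adjoint S (T x)) z = cinner x (adjoint T (S z))"
      by (simp add: cinner_adjoint'[OF SB] cinner_adjoint[OF TB])
    also have "\<dots> = cinner x (S (adjoint T z))"
      using commutantD[OF S vN_adjoint[OF N T]] by simp
    also have "\<dots> = cinner (T (adjoint S x)) z"
      by (simp add: cinner_adjoint'[OF SB] cinner_adjoint[OF TB])
    finally show "cinner (adjoint S (T x)) z = cinner (T (adjoint S x)) z" .
  qed
  then show ?thesis by (auto simp: commutant_def adjoint_Bop[OF SB] fun_eq_iff)
qed

text \<open>Every bounded operator commutes with the commutant of \<open>Bop\<close> by definition,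
  so there is no need to identify that commutant with the scalars. Injectivity of N is applied to
  this algebra.\<close>

lemma vN_Bop: "vN_algebra (Bop :: ('a::chilbert \<Rightarrow> 'a) set)"
proof -
  have "T \<circ> S = S \<circ> T" if "T \<in> Bop" "S \<in> commutant Bop" for T S :: "'a \<Rightarrow> 'a"
    using commutantD[OF that(2,1)] by (auto simp: fun_eq_iff)
  then show ?thesis by (auto simp: vN_algebra_def adjoint_Bop commutant_def[of "commutant _"])
qed

subsection \<open>Positive definite operator kernels\<close>

definition kform :: "('s \<Rightarrow> 's \<Rightarrow> ('k::chilbert \<Rightarrow> 'k)) \<Rightarrow> nat \<Rightarrow> (nat \<Rightarrow> 's) \<Rightarrow> (nat \<Rightarrow> 'k) \<Rightarrow> complex" where
  "kform \<kappa> n t \<xi> = (\<Sum>i<n. \<Sum>j<n. cinner (\<kappa> (t i) (t j) (\<xi> j)) (\<xi> i))"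

text \<open>Phrased through \<open>mpositive\<close>, so that a completely positive map applied
  entrywise preserves it by definition.\<close>

definition pd :: "('s \<Rightarrow> 's \<Rightarrow> ('k::chilbert \<Rightarrow> 'k)) \<Rightarrow> bool" where
  "pd \<kappa> \<longleftrightarrow> (\<forall>n t. mpositive n (\<lambda>i j. \<kappa> (t i) (t j)))"

lemma pd_iff: "pd \<kappa> \<longleftrightarrow> (\<forall>n t \<xi>. Im (kform \<kappa> n t \<xi>) = 0 \<and> 0 \<le> Re (kform \<kappa> n t \<xi>))"
  by (simp add: pd_def mpositive_def kform_def Let_def)

lemma pd_Re: "pd \<kappa> \<Longrightarrow> 0 \<le> Re (kform \<kappa> n t \<xi>)"
  by (simp add: pd_iff)

lemma kform_cong:
  "(\<And>i. i < n \<Longrightarrow> t i = t' i) \<Longrightarrow> (\<And>i. i < n \<Longrightarrow> \<xi> i = \<xi>' i) \<Longrightarrow> kform \<kappa> n t \<xi> = kform \<kappa> n t' \<xi>'"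
  unfolding kform_def by (intro sum.cong) auto

lemma kform_1: "kform \<kappa> 1 t \<xi> = cinner (\<kappa> (t 0) (t 0) (\<xi> 0)) (\<xi> 0)"
  by (simp add: kform_def)

lemma kform_Suc: "kform \<kappa> (Suc n) t \<xi> = kform \<kappa> n t \<xi> + (\<Sum>i<n. cinner (\<kappa> (t i) (t n) (\<xi> n)) (\<xi> i))
    + (\<Sum>j<n. cinner (\<kappa> (t n) (t j) (\<xi> j)) (\<xi> n)) + cinner (\<kappa> (t n) (t n) (\<xi> n)) (\<xi> n)"
  by (simp add: kform_def sum.distrib algebra_simps)

text \<open>Polarisation: the form at two points is real, which relates the imaginary parts of the
  two mixed terms, and replacing \<xi> by i\<xi> does the same for the real parts.\<close>

lemma pd_hermitian:
  assumes pd: "pd \<kappa>" and B: "\<And>s t. \<kappa> s t \<in> Bop"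
  shows "cinner (\<kappa> s t \<xi>) \<eta> = cinner \<xi> (\<kappa> t s \<eta>)"
proof -
  have eq: "Im (cinner (\<kappa> s t \<xi>) \<eta>) + Im (cinner (\<kappa> t s \<eta>) \<xi>) = 0" for \<xi> \<eta>
  proof -
    let ?t = "\<lambda>i. if i = 0 then s else t" and ?z = "\<lambda>i::nat. if i = 0 then \<eta> else \<xi>"
    have "Im (kform \<kappa> 2 ?t ?z) = 0" "Im (kform \<kappa> 1 (\<lambda>_. s) (\<lambda>_. \<eta>)) = 0"
      "Im (kform \<kappa> 1 (\<lambda>_. t) (\<lambda>_. \<xi>)) = 0"
      using pd unfolding pd_iff by blast+
    then show ?thesis by (simp add: kform_1 numeral_2_eq_2 kform_Suc) (simp add: kform_def)
  qed
  have "Re (cinner (\<kappa> s t \<xi>) \<eta>) = Re (cinner (\<kappa> t s \<eta>) \<xi>)"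
    using eq[of "scaleC \<i> \<xi>" \<eta>] by (simp add: cinner_simps Bop_scale[OF B])
  with eq[of \<xi> \<eta>] have "cinner (\<kappa> s t \<xi>) \<eta> = cnj (cinner (\<kappa> t s \<eta>) \<xi>)"
    by (simp add: complex_eq_iff)
  then show ?thesis using cinner_commute by metis
qed

text \<open>Positivity is used at one additional point t0. In terms of kernels, \<kappa>(s, t0)
  \<kappa>(t0, t) / C is dominated by \<kappa>, so the square of a column can be split off and the
  rest remains positive.\<close>

lemma pd_column_le:
  assumes pd: "pd \<kappa>" and B: "\<And>s t. \<kappa> s t \<in> Bop" and C: "C > 0" "\<And>x. cnorm (\<kappa> t0 t0 x) \<le> C * cnorm x"
  shows "(cnorm (\<Sum>i<n. \<kappa> t0 (t i) (\<xi> i)))\<^sup>2 / C \<le> Re (kform \<kappa> n t \<xi>)"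
proof -
  define \<eta> where "\<eta> = (\<Sum>i<n. \<kappa> t0 (t i) (\<xi> i))"
  \<comment> \<open>With C in place of \<kappa>(t0, t0), the new point contributes 2 Re <\<eta>,
    \<zeta>> + C |\<zeta>|^2, which is smallest at this \<zeta>.\<close>
  define \<zeta> where "\<zeta> = scaleC (of_real (- 1 / C)) \<eta>"
  let ?t = "t(n := t0)" and ?\<xi> = "\<xi>(n := \<zeta>)"
  have row: "(\<Sum>j<n. cinner (\<kappa> t0 (t j) (\<xi> j)) \<zeta>) = of_real (- (cnorm \<eta>)\<^sup>2 / C)"
  proof -
    have "(\<Sum>j<n. cinner (\<kappa> t0 (t j) (\<xi> j)) \<zeta>) = cinner \<eta> \<zeta>" by (simp add: \<eta>_def cinner_sum_left)
    then show ?thesis by (simp add: \<zeta>_def cinner_scaleC_right cinner_self)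
  qed
  have "(\<Sum>i<n. cinner (\<kappa> (t i) t0 \<zeta>) (\<xi> i)) = (\<Sum>j<n. cnj (cinner (\<kappa> t0 (t j) (\<xi> j)) \<zeta>))"
    using pd_hermitian[OF pd B] by (intro sum.cong) (auto simp: cinner_commute[symmetric])
  also have "\<dots> = of_real (- (cnorm \<eta>)\<^sup>2 / C)"
    using row by (simp flip: cnj_sum)
  finally have col: "(\<Sum>i<n. cinner (\<kappa> (t i) t0 \<zeta>) (\<xi> i)) = of_real (- (cnorm \<eta>)\<^sup>2 / C)" .
  have "kform \<kappa> (Suc n) ?t ?\<xi> = kform \<kappa> n t \<xi> + 2 * of_real (- (cnorm \<eta>)\<^sup>2 / C) + cinner (\<kappa> t0 t0 \<zeta>) \<zeta>"
    unfolding kform_Suc using row col kform_cong[of n ?t t ?\<xi> \<xi> \<kappa>] by simp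
  moreover have "Re (cinner (\<kappa> t0 t0 \<zeta>) \<zeta>) \<le> (cnorm \<eta>)\<^sup>2 / C"
  proof -
    have "Re (cinner (\<kappa> t0 t0 \<zeta>) \<zeta>) \<le> cnorm (\<kappa> t0 t0 \<zeta>) * cnorm \<zeta>"
      using complex_Re_le_cmod cauchy_schwarz by (rule order_trans)
    also have "\<dots> \<le> C * cnorm \<zeta> * cnorm \<zeta>"
      using C(2) by (intro mult_right_mono) auto
    also have "\<dots> = (cnorm \<eta>)\<^sup>2 / C"
      using C(1) by (simp add: \<zeta>_def cnorm_scaleC power2_eq_square norm_divide)
    finally show ?thesis .
  qed
  moreover have "0 \<le> Re (kform \<kappa> (Suc n) ?t ?\<xi>)" using pd by (rule pd_Re)
  ultimately have "0 \<le> Re (kform \<kappa> n t \<xi>) + 2 * (- (cnorm \<eta>)\<^sup>2 / C) + (cnorm \<eta>)\<^sup>2 / C" by simp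
  then show ?thesis unfolding \<eta>_def by simp
qed

lemma has_sum_finite_sum:
  fixes f :: "'i \<Rightarrow> 'v \<Rightarrow> 'b::{topological_comm_monoid_add}"
  assumes "\<And>i. i \<in> I \<Longrightarrow> (f i has_sum s i) A"
  shows "((\<lambda>v. \<Sum>i\<in>I. f i v) has_sum (\<Sum>i\<in>I. s i)) A"
  using assms by (induction I rule: infinite_finite_induct) (auto intro!: has_sum_add has_sum_0)

text \<open>The set \<open>F\<close> is maximal among those whose finite partial sums are dominated by \<open>\<kappa>\<close>. If the remainder
  \<open>\<rho>\<close> of \<open>\<kappa>\<close> did not vanish, a multiple of one of its columns \<open>\<rho>(\<cdot>, t\<^sub>0)\<close> could be added to \<open>F\<close>; as
  \<open>F\<close> is a set without multiplicities, the multiple has to be chosen outside \<open>F\<close>.\<close>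
theorem kernel_decomposition:
  fixes \<kappa> :: "'s \<Rightarrow> 's \<Rightarrow> ('k::chilbert \<Rightarrow> 'k)"
  assumes N: "vN_algebra N" and \<kappa>N: "\<And>s t. \<kappa> s t \<in> N" and pd: "pd \<kappa>"
  obtains F :: "('s \<Rightarrow> 'k \<Rightarrow> 'k) set"
    where "\<And>v s. v \<in> F \<Longrightarrow> v s \<in> N"
    and "\<And>v n t \<xi>. v \<in> F \<Longrightarrow> (cnorm (\<Sum>i<n. adjoint (v (t i)) (\<xi> i)))\<^sup>2 \<le> Re (kform \<kappa> n t \<xi>)"
    and "\<And>s t. wsum F (\<lambda>v. v s \<circ> adjoint (v t)) (\<kappa> s t)"
proof -
  \<comment> \<open>The form of the kernel v(s) v(t)^* at the points t and vectors \<xi>.\<close>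
  define sq where "sq n t \<xi> v = (cnorm (\<Sum>i<n. adjoint (v (t i)) (\<xi> i)))\<^sup>2"
    for n and t :: "nat \<Rightarrow> 's" and \<xi> :: "nat \<Rightarrow> 'k" and v :: "'s \<Rightarrow> 'k \<Rightarrow> 'k"
  define A where "A = {F. (\<forall>v\<in>F. \<forall>s. v s \<in> N) \<and>
    (\<forall>F0 n t \<xi>. finite F0 \<longrightarrow> F0 \<subseteq> F \<longrightarrow> sum (sq n t \<xi>) F0 \<le> Re (kform \<kappa> n t \<xi>))}"
  have "\<exists>M\<in>A. \<forall>X\<in>A. M \<subseteq> X \<longrightarrow> X = M"
  proof (rule subset_Zorn')
    fix \<C> assume ch: "subset.chain A \<C>"
    then have sub: "\<C> \<subseteq> A" by (simp add: subset.chain_def)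
    show "\<Union>\<C> \<in> A"
      unfolding A_def mem_Collect_eq
    proof (intro conjI allI impI)
      show "\<forall>v\<in>\<Union>\<C>. \<forall>s. v s \<in> N" using sub by (auto simp: A_def)
      fix F0 n t \<xi> assume F0: "finite F0" "F0 \<subseteq> \<Union>\<C>"
      show "sum (sq n t \<xi>) F0 \<le> Re (kform \<kappa> n t \<xi>)"
      proof (cases "F0 = {}")
        case True
        then show ?thesis using pd_Re[OF pd] by simp
      next
        case False
        with F0 have "\<C> \<noteq> {}" by auto
        then obtain B where "B \<in> \<C>" "F0 \<subseteq> B" using finite_subset_Union_chain[OF F0 _ ch] by blast
        then show ?thesis using sub F0(1) by (auto simp: A_def)
      qed
    qed
  qed
  then obtain F where F: "F \<in> A" and max: "\<And>X. X \<in> A \<Longrightarrow> F \<subseteq> X \<Longrightarrow> X = F" by blast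
  have FN: "v s \<in> N" if "v \<in> F" for v s using F that by (auto simp: A_def)
  note FB = vN_BopD[OF N FN]
  have Fle: "sum (sq n t \<xi>) F0 \<le> Re (kform \<kappa> n t \<xi>)" if "finite F0" "F0 \<subseteq> F" for F0 n t \<xi>
    using F that by (auto simp: A_def)
  have \<kappa>B: "\<kappa> s t \<in> Bop" for s t using N \<kappa>N by (rule vN_BopD)
  have sq_summable: "sq n t \<xi> summable_on F" for n t \<xi>
    by (rule nonneg_bdd_above_summable_on) (auto simp: sq_def bdd_above_def intro!: exI Fle[unfolded sq_def])
  define U where "U n t \<xi> = infsum (sq n t \<xi>) F" for n t \<xi>
  have U: "(sq n t \<xi> has_sum U n t \<xi>) F" for n t \<xi>
    using sq_summable by (simp add: U_def)
  have U_le: "U n t \<xi> \<le> Re (kform \<kappa> n t \<xi>)" for n t \<xi>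
    by (rule has_sum_le_finite_sums[OF U Fle])
  have single: "((\<lambda>v. (cnorm (adjoint (v t) \<xi>))\<^sup>2) has_sum U 1 (\<lambda>_. t) (\<lambda>_. \<xi>)) F" for t \<xi>
    using U[of 1 "\<lambda>_. t" "\<lambda>_. \<xi>"] by (simp add: sq_def[abs_def])
  define r where "r s t \<xi> \<eta> v = cinner (adjoint (v t) \<xi>) (adjoint (v s) \<eta>)"
    for s t \<xi> \<eta> and v :: "'s \<Rightarrow> 'k \<Rightarrow> 'k"
  define R where "R s t \<xi> \<eta> = infsum (r s t \<xi> \<eta>) F" for s t \<xi> \<eta>
  have r_le: "norm (r s t \<xi> \<eta> v) \<le> (cnorm (adjoint (v t) \<xi>))\<^sup>2 + (cnorm (adjoint (v s) \<eta>))\<^sup>2" for s t \<xi> \<eta> v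
    using two_norm_cinner_le[of "adjoint (v t) \<xi>" "adjoint (v s) \<eta>"] norm_ge_zero[of "r s t \<xi> \<eta> v"]
    unfolding r_def by linarith
  have r_summable: "r s t \<xi> \<eta> summable_on F" for s t \<xi> \<eta>
  proof (rule abs_summable_summable, rule Infinite_Sum.abs_summable_on_comparison_test')
    show "(\<lambda>v. (cnorm (adjoint (v t) \<xi>))\<^sup>2 + (cnorm (adjoint (v s) \<eta>))\<^sup>2) summable_on F"
      using has_sum_add[OF single single] unfolding summable_on_def by blast
  qed (rule r_le)
  have R: "(r s t \<xi> \<eta> has_sum R s t \<xi> \<eta>) F" for s t \<xi> \<eta>
    using r_summable by (simp add: R_def)
  have R_cnj: "R s t \<xi> \<eta> = cnj (R t s \<eta> \<xi>)" for s t \<xi> \<eta>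
    unfolding R_def infsum_cnj[symmetric] r_def by (intro infsum_cong cinner_commute)
  have R_add: "R s t (\<xi> + \<xi>') \<eta> = R s t \<xi> \<eta> + R s t \<xi>' \<eta>" for s t \<xi> \<xi>' \<eta>
  proof -
    have "R s t (\<xi> + \<xi>') \<eta> = (\<Sum>\<^sub>\<infinity>v\<in>F. r s t \<xi> \<eta> v + r s t \<xi>' \<eta> v)"
      unfolding R_def by (rule infsum_cong) (simp add: r_def Bop_add[OF adjoint_Bop[OF FB]] cinner_simps)
    then show ?thesis by (simp add: R_def infsum_add r_summable)
  qed
  have R_scale: "R s t (scaleC c \<xi>) \<eta> = c * R s t \<xi> \<eta>" for c s t \<xi> \<eta>
  proof -
    have "R s t (scaleC c \<xi>) \<eta> = (\<Sum>\<^sub>\<infinity>v\<in>F. c * r s t \<xi> \<eta> v)"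
      unfolding R_def by (rule infsum_cong) (simp add: r_def Bop_scale[OF adjoint_Bop[OF FB]] cinner_simps)
    then show ?thesis by (simp add: R_def infsum_cmult_right')
  qed
  \<comment> \<open>The remainder exists as an operator because its matrix coefficients are bounded:
    \<kappa> controls the diagonal sums U, and these control the mixed sums R.\<close>
  have "\<exists>T\<in>Bop. \<forall>\<xi> \<eta>. cinner (T \<xi>) \<eta> = cinner (\<kappa> s t \<xi>) \<eta> - R s t \<xi> \<eta>" for s t
  proof -
    obtain C D where C: "\<And>x. cnorm (\<kappa> s s x) \<le> C * cnorm x" "C > 0"
      and D: "\<And>x. cnorm (\<kappa> t t x) \<le> D * cnorm x" "D > 0"
      using Bop_bound[OF \<kappa>B[of s s]] Bop_bound[OF \<kappa>B[of t t]] by metis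
    obtain E where E: "\<And>x. cnorm (\<kappa> s t x) \<le> E * cnorm x" "E > 0" using Bop_bound[OF \<kappa>B] by metis
    have bd: "U 1 (\<lambda>_. t) (\<lambda>_. \<xi>) \<le> D * (cnorm \<xi>)\<^sup>2"
      if "\<And>x. cnorm (\<kappa> t t x) \<le> D * cnorm x" for t \<xi> D
    proof -
      have "U 1 (\<lambda>_. t) (\<lambda>_. \<xi>) \<le> Re (cinner (\<kappa> t t \<xi>) \<xi>)"
        using U_le[of 1 "\<lambda>_. t" "\<lambda>_. \<xi>"] by (simp add: kform_1[simplified])
      also have "\<dots> \<le> cnorm (\<kappa> t t \<xi>) * cnorm \<xi>"
        using complex_Re_le_cmod cauchy_schwarz by (rule order_trans)
      also have "\<dots> \<le> D * cnorm \<xi> * cnorm \<xi>"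
        using that by (intro mult_right_mono) auto
      finally show ?thesis by (simp add: power2_eq_square)
    qed
    show ?thesis
    proof (rule sesquilinear_operator[where C = "C + D + E"])
      fix \<xi> \<eta>
      have "norm (R s t \<xi> \<eta>) \<le> U 1 (\<lambda>_. t) (\<lambda>_. \<xi>) + U 1 (\<lambda>_. s) (\<lambda>_. \<eta>)"
        by (rule norm_infsum_le[OF R has_sum_add[OF single single] r_le])
      also have "\<dots> \<le> D * (cnorm \<xi>)\<^sup>2 + C * (cnorm \<eta>)\<^sup>2"
        using bd[OF D(1)] bd[OF C(1)] by (rule add_mono)
      finally have 1: "norm (R s t \<xi> \<eta>) \<le> D * (cnorm \<xi>)\<^sup>2 + C * (cnorm \<eta>)\<^sup>2" .
      have "norm (cinner (\<kappa> s t \<xi>) \<eta>) \<le> cnorm (\<kappa> s t \<xi>) * cnorm \<eta>" by (rule cauchy_schwarz)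
      also have "\<dots> \<le> E * cnorm \<xi> * cnorm \<eta>" using E by (intro mult_right_mono) auto
      also have "\<dots> = E * (cnorm \<xi> * cnorm \<eta>)" by simp
      also have "\<dots> \<le> E * ((cnorm \<xi>)\<^sup>2 + (cnorm \<eta>)\<^sup>2)"
        using sum_squares_bound[of "cnorm \<xi>" "cnorm \<eta>"] E(2) mult_nonneg_nonneg[OF cnorm_ge0[of \<xi>] cnorm_ge0[of \<eta>]]
        by (intro mult_left_mono) linarith+
      finally have 2: "norm (cinner (\<kappa> s t \<xi>) \<eta>) \<le> E * ((cnorm \<xi>)\<^sup>2 + (cnorm \<eta>)\<^sup>2)" .
      have 3: "0 \<le> C * (cnorm \<xi>)\<^sup>2" "0 \<le> D * (cnorm \<eta>)\<^sup>2" using C D by simp_all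
      show "norm (cinner (\<kappa> s t \<xi>) \<eta> - R s t \<xi> \<eta>) \<le> (C + D + E) * ((cnorm \<xi>)\<^sup>2 + (cnorm \<eta>)\<^sup>2)"
        using norm_triangle_ineq4[of "cinner (\<kappa> s t \<xi>) \<eta>" "R s t \<xi> \<eta>"] 1 2 3
        by (simp add: distrib_left distrib_right)
    qed (simp_all add: R_cnj[of s t _ "_ + _"] R_cnj[of s t _ "scaleC _ _"] R_add R_scale R_cnj[of t s]
        right_diff_distrib Bop_add[OF \<kappa>B] Bop_scale[OF \<kappa>B] cinner_simps)
  qed
  then obtain \<rho> where \<rho>B: "\<And>s t. \<rho> s t \<in> Bop"
    and \<rho>: "\<And>s t \<xi> \<eta>. cinner (\<rho> s t \<xi>) \<eta> = cinner (\<kappa> s t \<xi>) \<eta> - R s t \<xi> \<eta>" by metis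
  \<comment> \<open>The sum inside \<rho> converges only weakly, so membership is tested by
    commutation. An element T of the commutant passes through each \<open>adjoint (v t)\<close>, and
    its adjoint passes through each \<open>adjoint (v s)\<close>.\<close>
  have \<rho>N: "\<rho> s t \<in> N" for s t
  proof (rule vN_memI[OF N \<rho>B])
    fix T assume T: "T \<in> commutant N"
    have TB: "T \<in> Bop" using T by (rule commutant_Bop)
    have T': "adjoint T \<in> commutant N" using N T by (rule commutant_adjoint)
    have "r s t (T \<xi>) \<eta> v = r s t \<xi> (adjoint T \<eta>) v" if v: "v \<in> F" for \<xi> \<eta> v
    proof -
      have "adjoint (v t) (T \<xi>) = T (adjoint (v t) \<xi>)"
        using commutantD[OF T vN_adjoint[OF N FN[OF v]]] by simp
      moreover have "adjoint (v s) (adjoint T \<eta>) = adjoint T (adjoint (v s) \<eta>)"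
        using commutantD[OF T' vN_adjoint[OF N FN[OF v]]] by simp
      ultimately show ?thesis by (simp add: r_def cinner_adjoint[OF TB])
    qed
    then have "R s t (T \<xi>) \<eta> = R s t \<xi> (adjoint T \<eta>)" for \<xi> \<eta>
      unfolding R_def by (rule infsum_cong)
    moreover have "cinner (\<kappa> s t (T \<xi>)) \<eta> = cinner (\<kappa> s t \<xi>) (adjoint T \<eta>)" for \<xi> \<eta>
      using commutantD[OF T \<kappa>N] by (simp flip: cinner_adjoint[OF TB])
    ultimately have "cinner (\<rho> s t (T \<xi>)) \<eta> = cinner (T (\<rho> s t \<xi>)) \<eta>" for \<xi> \<eta>
      by (simp add: \<rho> cinner_adjoint[OF TB])
    then show "\<rho> s t \<circ> T = T \<circ> \<rho> s t" by (intro Bop_eqI) simp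
  qed
  have kform_\<rho>: "kform \<rho> n t \<xi> = kform \<kappa> n t \<xi> - of_real (U n t \<xi>)" for n t \<xi>
  proof -
    have "((\<lambda>v. \<Sum>i<n. \<Sum>j<n. r (t i) (t j) (\<xi> j) (\<xi> i) v) has_sum (\<Sum>i<n. \<Sum>j<n. R (t i) (t j) (\<xi> j) (\<xi> i))) F"
      by (intro has_sum_finite_sum R)
    moreover have "(\<Sum>i<n. \<Sum>j<n. r (t i) (t j) (\<xi> j) (\<xi> i) v) = of_real (sq n t \<xi> v)" for v
    proof -
      have "of_real (sq n t \<xi> v) = cinner (\<Sum>j<n. adjoint (v (t j)) (\<xi> j)) (\<Sum>i<n. adjoint (v (t i)) (\<xi> i))"
        by (simp only: sq_def cinner_self)
      also have "\<dots> = (\<Sum>i<n. \<Sum>j<n. r (t i) (t j) (\<xi> j) (\<xi> i) v)"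
        unfolding cinner_sum_right unfolding cinner_sum_left r_def ..
      finally show ?thesis ..
    qed
    ultimately have "((\<lambda>v. complex_of_real (sq n t \<xi> v)) has_sum (\<Sum>i<n. \<Sum>j<n. R (t i) (t j) (\<xi> j) (\<xi> i))) F"
      by simp
    moreover have "((\<lambda>v. complex_of_real (sq n t \<xi> v)) has_sum of_real (U n t \<xi>)) F"
      using U by (rule has_sum_of_real)
    ultimately have "(\<Sum>i<n. \<Sum>j<n. R (t i) (t j) (\<xi> j) (\<xi> i)) = of_real (U n t \<xi>)"
      by (rule has_sum_unique)
    then show ?thesis by (simp add: kform_def \<rho> sum_subtractf)
  qed
  have pd_\<rho>: "pd \<rho>"
    using pd U_le by (simp add: pd_iff kform_\<rho>)
  have \<rho>0: "cinner (\<rho> s0 t0 \<xi>0) \<eta>0 = 0" for s0 t0 \<xi>0 \<eta>0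
  proof (rule ccontr)
    assume ne: "cinner (\<rho> s0 t0 \<xi>0) \<eta>0 \<noteq> 0"
    obtain C where C: "C > 0" "\<And>x. cnorm (\<rho> t0 t0 x) \<le> C * cnorm x" using Bop_bound[OF \<rho>B] by metis
    define v where "v c t = oscale (of_real (c / sqrt C)) (\<rho> t t0)" for c :: real and t
    have adj: "adjoint (v c t) = oscale (of_real (c / sqrt C)) (\<rho> t0 t)" for c t
      unfolding v_def by (rule adjoint_eqI, rule Bop_oscale[OF \<rho>B])
        (auto simp: oscale_def cinner_simps pd_hermitian[OF pd_\<rho> \<rho>B])
    have sq_v: "sq n t \<xi> (v c) = c\<^sup>2 * ((cnorm (\<Sum>i<n. \<rho> t0 (t i) (\<xi> i)))\<^sup>2 / C)" for c n t \<xi>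
      using C(1) by (simp add: sq_def adj oscale_def cnorm_scaleC power_mult_distrib power_divide
        norm_divide flip: scaleC_sum_right)
    \<comment> \<open>For c \<le> 1 the form of the multiple is at most that of \<rho>, which is
      exactly what F leaves free. Maximality therefore puts every such multiple into F, and the
      contradiction will be that there are too many of them.\<close>
    have vF: "v c \<in> F" if c: "0 \<le> c" "c \<le> 1" for c
    proof (rule ccontr)
      assume nF: "v c \<notin> F"
      have "insert (v c) F \<in> A"
        unfolding A_def mem_Collect_eq
      proof (intro conjI allI impI)
        show "\<forall>u\<in>insert (v c) F. \<forall>s. u s \<in> N"
          using FN vN_oscale[OF N \<rho>N] by (auto simp: v_def)
        fix F0 n t \<xi> assume F0: "finite F0" "F0 \<subseteq> insert (v c) F"
        have "sum (sq n t \<xi>) F0 \<le> sum (sq n t \<xi>) (insert (v c) (F0 - {v c}))"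
          using F0 by (intro sum_mono2) (auto simp: sq_def)
        also have "\<dots> = sq n t \<xi> (v c) + sum (sq n t \<xi>) (F0 - {v c})"
          using F0 by (subst sum.insert) auto
        also have "sum (sq n t \<xi>) (F0 - {v c}) \<le> U n t \<xi>"
          using F0 by (intro has_sum_mono'[OF has_sum_finite U]) (auto simp: sq_def)
        also have "sq n t \<xi> (v c) \<le> 1 * ((cnorm (\<Sum>i<n. \<rho> t0 (t i) (\<xi> i)))\<^sup>2 / C)"
          unfolding sq_v using c C(1) by (intro mult_right_mono) (auto simp: power_le_one)
        also have "1 * ((cnorm (\<Sum>i<n. \<rho> t0 (t i) (\<xi> i)))\<^sup>2 / C) \<le> Re (kform \<rho> n t \<xi>)"
          using pd_column_le[OF pd_\<rho> \<rho>B C] by simp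
        finally show "sum (sq n t \<xi>) F0 \<le> Re (kform \<kappa> n t \<xi>)" by (simp add: kform_\<rho>)
      qed
      then show False using max nF by blast
    qed
    define m where "m = (cnorm (\<rho> t0 s0 \<eta>0))\<^sup>2 / C"
    have "\<rho> t0 s0 \<eta>0 \<noteq> 0" using ne pd_hermitian[OF pd_\<rho> \<rho>B, of s0 t0 \<xi>0 \<eta>0] by auto
    then have m: "m > 0" using C(1) by (simp add: m_def)
    have sq_m: "sq 1 (\<lambda>_. s0) (\<lambda>_. \<eta>0) (v c) = c\<^sup>2 * m" for c by (simp add: sq_v m_def)
    define q where "q = Re (kform \<kappa> 1 (\<lambda>_. s0) (\<lambda>_. \<eta>0))"
    \<comment> \<open>A multiple with c \<ge> 1/2 contributes at least m / 4 to the form at s0 and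
      \<eta>0, and q bounds the total, so M distinct multiples cannot all fit.\<close>
    obtain M :: nat where M: "4 * q / m < real M" using reals_Archimedean2 by blast
    have "infinite {1/2..1::real}" by simp
    then obtain S where S: "finite S" "card S = M" "S \<subseteq> {1/2..1::real}"
      using infinite_arbitrarily_large by blast
    have inj: "inj_on v S"
    proof (rule inj_onI)
      fix c d assume "v c = v d"
      then have "cinner (v c s0 \<xi>0) \<eta>0 = cinner (v d s0 \<xi>0) \<eta>0" by simp
      then show "c = d" using ne C(1) by (simp add: v_def oscale_def cinner_simps)
    qed
    have "real M * (m / 4) = (\<Sum>c\<in>S. m / 4)" using S by simp
    also have "\<dots> \<le> (\<Sum>c\<in>S. c\<^sup>2 * m)"
    proof (rule sum_mono)
      fix c assume "c \<in> S"
      then have "(1/2)\<^sup>2 \<le> c\<^sup>2" using S by (intro power_mono) auto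
      then show "m / 4 \<le> c\<^sup>2 * m" using mult_right_mono[of "(1/2)\<^sup>2" "c\<^sup>2" m] m by (simp add: power2_eq_square)
    qed
    also have "\<dots> = sum (sq 1 (\<lambda>_. s0) (\<lambda>_. \<eta>0)) (v ` S)"
      using inj by (simp add: sum.reindex sq_m[simplified])
    also have "\<dots> \<le> q" unfolding q_def using S by (intro Fle) (auto intro!: vF)
    finally show False using M m by (simp add: field_simps)
  qed
  show ?thesis
  proof (rule that)
    show "v s \<in> N" if "v \<in> F" for v s using that by (rule FN)
    show "(cnorm (\<Sum>i<n. adjoint (v (t i)) (\<xi> i)))\<^sup>2 \<le> Re (kform \<kappa> n t \<xi>)" if "v \<in> F" for v n t \<xi>
      using Fle[of "{v}" n t \<xi>] that by (simp add: sq_def)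
    show "wsum F (\<lambda>v. v s \<circ> adjoint (v t)) (\<kappa> s t)" for s t
      unfolding wsum_def
    proof (intro allI)
      fix \<xi> \<eta>
      have "R s t \<xi> \<eta> = cinner (\<kappa> s t \<xi>) \<eta>" using \<rho>[of s t \<xi> \<eta>] \<rho>0 by simp
      moreover have "r s t \<xi> \<eta> v = cinner ((v s \<circ> adjoint (v t)) \<xi>) \<eta>" if "v \<in> F" for v
        by (simp add: r_def cinner_adjoint[OF FB[OF that]])
      ultimately show "((\<lambda>v. cinner ((v s \<circ> adjoint (v t)) \<xi>) \<eta>) has_sum cinner (\<kappa> s t \<xi>) \<eta>) F"
        using R[of s t \<xi> \<eta>] by (metis (no_types, lifting) has_sum_cong)
    qed
  qed
qed

subsection \<open>The Hahn--Banach theorem\<close>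

text \<open>A cone in \<open>V \<times> \<real>\<close> plays the role of the epigraph of the sublinear functional; a maximal cone
  containing no \<open>(0, t)\<close> with \<open>t < 0\<close> is the epigraph of a linear functional.\<close>
theorem hahn_banach_cone:
  fixes V :: "('z \<Rightarrow> real) set" and R0 :: "(('z \<Rightarrow> real) \<times> real) set"
  assumes V_add: "\<And>f g. f \<in> V \<Longrightarrow> g \<in> V \<Longrightarrow> (\<lambda>z. f z + g z) \<in> V"
    and V_scale: "\<And>c f. f \<in> V \<Longrightarrow> (\<lambda>z. c * f z) \<in> V"
    and R0_V: "\<And>f t. (f, t) \<in> R0 \<Longrightarrow> f \<in> V"
    and R0_ex: "\<And>f. f \<in> V \<Longrightarrow> \<exists>t. (f, t) \<in> R0"
    and R0_zero: "((\<lambda>z. 0), 0) \<in> R0"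
    and R0_add: "\<And>f g t u. (f, t) \<in> R0 \<Longrightarrow> (g, u) \<in> R0 \<Longrightarrow> ((\<lambda>z. f z + g z), t + u) \<in> R0"
    and R0_scale: "\<And>c f t. c > 0 \<Longrightarrow> (f, t) \<in> R0 \<Longrightarrow> ((\<lambda>z. c * f z), c * t) \<in> R0"
    and R0_ge0: "\<And>t. ((\<lambda>z. 0), t) \<in> R0 \<Longrightarrow> 0 \<le> t"
  obtains s :: "('z \<Rightarrow> real) \<Rightarrow> real"
    where "\<And>f g. f \<in> V \<Longrightarrow> g \<in> V \<Longrightarrow> s (\<lambda>z. f z + g z) = s f + s g"
    and "\<And>c f. f \<in> V \<Longrightarrow> s (\<lambda>z. c * f z) = c * s f"
    and "\<And>f t. (f, t) \<in> R0 \<Longrightarrow> s f \<le> t"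
proof -
  define good where "good R \<longleftrightarrow> R0 \<subseteq> R \<and> (\<forall>f t. (f, t) \<in> R \<longrightarrow> f \<in> V)
    \<and> (\<forall>f g t u. (f, t) \<in> R \<longrightarrow> (g, u) \<in> R \<longrightarrow> ((\<lambda>z. f z + g z), t + u) \<in> R)
    \<and> (\<forall>c f t. c > 0 \<longrightarrow> (f, t) \<in> R \<longrightarrow> ((\<lambda>z. c * f z), c * t) \<in> R)
    \<and> (\<forall>t. ((\<lambda>z. 0), t) \<in> R \<longrightarrow> 0 \<le> t)" for R :: "(('z \<Rightarrow> real) \<times> real) set"
  have "good R0" unfolding good_def using R0_V R0_add R0_scale R0_ge0 by blast
  have "\<exists>M\<in>Collect good. \<forall>X\<in>Collect good. M \<subseteq> X \<longrightarrow> X = M"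
  proof (rule subset_Zorn_nonempty)
    show "Collect good \<noteq> {}" using \<open>good R0\<close> by blast
    fix \<C> assume ne: "\<C> \<noteq> {}" and ch: "subset.chain (Collect good) \<C>"
    have g: "good R" if "R \<in> \<C>" for R using ch that by (auto simp: subset.chain_def)
    have add: "((\<lambda>z. f z + g z), t + u) \<in> \<Union>\<C>" if ft: "(f, t) \<in> R" "R \<in> \<C>" and gu: "(g, u) \<in> S" "S \<in> \<C>" for f g t u R S
    proof -
      from ch ft(2) gu(2) have "R \<subseteq> S \<or> S \<subseteq> R" unfolding subset.chain_def by blast
      then obtain Q where "Q \<in> \<C>" "(f, t) \<in> Q" "(g, u) \<in> Q" using ft gu by blast
      then show ?thesis using g[of Q] unfolding good_def by blast
    qed
    show "\<Union>\<C> \<in> Collect good"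
      unfolding mem_Collect_eq good_def[of "\<Union>\<C>"]
    proof (intro conjI allI impI)
      show "R0 \<subseteq> \<Union>\<C>" using ne g unfolding good_def by blast
      fix f t assume "(f, t) \<in> \<Union>\<C>"
      then obtain R where R: "R \<in> \<C>" "(f, t) \<in> R" by blast
      show "f \<in> V" using g[OF R(1)] R(2) unfolding good_def by blast
      show "((\<lambda>z. c * f z), c * t) \<in> \<Union>\<C>" if "0 < c" for c
        using g[OF R(1)] R that unfolding good_def by blast
      show "((\<lambda>z. f z + h z), t + u) \<in> \<Union>\<C>" if "(h, u) \<in> \<Union>\<C>" for h u
        using add[OF R(2,1)] that by blast
    next
      fix t assume "((\<lambda>z. 0), t) \<in> \<Union>\<C>"
      then show "0 \<le> t" using g unfolding good_def by blast
    qed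
  qed
  then obtain R where R: "good R" and max: "\<And>X. good X \<Longrightarrow> R \<subseteq> X \<Longrightarrow> X = R" by blast
  have sub: "R0 \<subseteq> R" and R_V: "\<And>f t. (f, t) \<in> R \<Longrightarrow> f \<in> V"
    and R_add: "\<And>f g t u. (f, t) \<in> R \<Longrightarrow> (g, u) \<in> R \<Longrightarrow> ((\<lambda>z. f z + g z), t + u) \<in> R"
    and R_scale: "\<And>c f t. c > 0 \<Longrightarrow> (f, t) \<in> R \<Longrightarrow> ((\<lambda>z. c * f z), c * t) \<in> R"
    and R_ge0: "\<And>t. ((\<lambda>z. 0), t) \<in> R \<Longrightarrow> 0 \<le> t"
    using R unfolding good_def by blast+
  have R_ex: "\<exists>t. (f, t) \<in> R" if "f \<in> V" for f using R0_ex[OF that] sub by blast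
  have V_minus: "(\<lambda>z. - f z) \<in> V" if "f \<in> V" for f using V_scale[OF that, of "-1"] by simp
  define s where "s f = Inf {t. (f, t) \<in> R}" for f
  \<comment> \<open>A point over f and a point over -f add up to a point over 0. This keeps the
    infimum that defines \<open>s\<close> finite.\<close>
  have opp: "0 \<le> t + u" if "(f, t) \<in> R" "((\<lambda>z. - f z), u) \<in> R" for f t u
    using R_add[OF that] by (intro R_ge0) simp
  have s_le: "s f \<le> t" if ft: "(f, t) \<in> R" for f t
  proof -
    obtain u where u: "((\<lambda>z. - f z), u) \<in> R" using R_ex[OF V_minus[OF R_V[OF ft]]] by blast
    have "bdd_below {t. (f, t) \<in> R}"
      unfolding bdd_below_def using opp[OF _ u] by (intro exI[of _ "- u"]) (force simp: algebra_simps)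
    then show ?thesis unfolding s_def using ft by (intro cInf_lower) auto
  qed
  have s_ge: "b \<le> s f" if "f \<in> V" "\<And>t. (f, t) \<in> R \<Longrightarrow> b \<le> t" for f b
    unfolding s_def using that R_ex[OF that(1)] by (intro cInf_greatest) auto
  \<comment> \<open>R' is generated by R and the ray through (-f, - s f). It is admissible because a
    point of R over c f with c > 0 has height at least c times s f; by maximality nothing new was
    added. The resulting inequality s (-f) \<le> - s f is what makes the sublinear functional
    linear.\<close>
  have neg: "((\<lambda>z. - f z), - s f) \<in> R" if f: "f \<in> V" for f
  proof -
    define R' where "R' = {((\<lambda>z. g z - c * f z), t - c * s f) | g t c. (g, t) \<in> R \<and> 0 \<le> c}"
    have R'I: "(h, u) \<in> R'" if "(g, t) \<in> R" "0 \<le> c" "h = (\<lambda>z. g z - c * f z)" "u = t - c * s f" for h u g t c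
      using that unfolding R'_def by blast
    have "good R'"
      unfolding good_def
    proof (intro conjI allI impI)
      show RR: "R0 \<subseteq> R'" using sub R'I[of _ _ 0] by fastforce
      fix h u assume "(h, u) \<in> R'"
      then obtain g t c where g: "(g, t) \<in> R" "0 \<le> c" "h = (\<lambda>z. g z - c * f z)" "u = t - c * s f"
        unfolding R'_def by blast
      show "h \<in> V" using V_add[OF R_V[OF g(1)] V_scale[OF f, of "- c"]] g(3) by simp
      show "((\<lambda>z. d * h z), d * u) \<in> R'" if "0 < d" for d
        by (rule R'I[OF R_scale[OF that g(1)], of "d * c"]) (use g that in \<open>auto simp: algebra_simps\<close>)
      show "((\<lambda>z. h z + h' z), u + u') \<in> R'" if "(h', u') \<in> R'" for h' u'
      proof -
        obtain g' t' c' where g': "(g', t') \<in> R" "0 \<le> c'" "h' = (\<lambda>z. g' z - c' * f z)" "u' = t' - c' * s f"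
          using \<open>(h', u') \<in> R'\<close> unfolding R'_def by blast
        show ?thesis
          by (rule R'I[OF R_add[OF g(1) g'(1)], of "c + c'"]) (use g g' in \<open>auto simp: algebra_simps\<close>)
      qed
    next
      fix u assume "((\<lambda>z. 0), u) \<in> R'"
      then obtain g t c where g: "(g, t) \<in> R" "0 \<le> c" "(\<lambda>z. 0) = (\<lambda>z. g z - c * f z)" "u = t - c * s f"
        unfolding R'_def by blast
      have gf: "g = (\<lambda>z. c * f z)" using fun_cong[OF g(3)] by (auto simp: fun_eq_iff)
      show "0 \<le> u"
      proof (cases "c = 0")
        case True
        then have "g = (\<lambda>z. 0)" using gf by simp
        then show ?thesis using g(1,4) True R_ge0[of t] by simp
      next
        case False
        then have c: "c > 0" using g(2) by simp
        have "(f, t / c) \<in> R" using R_scale[of "1 / c" g t] c g(1) gf by simp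
        then have "s f \<le> t / c" by (rule s_le)
        then show ?thesis using c g(4) by (simp add: field_simps)
      qed
    qed
    moreover have "R \<subseteq> R'" using R'I[of _ _ 0] by fastforce
    ultimately have "R' = R" by (rule max)
    moreover have "((\<lambda>z. - f z), - s f) \<in> R'"
      by (rule R'I[of "\<lambda>z. 0" 0 1]) (use sub R0_zero in auto)
    ultimately show ?thesis by simp
  qed
  have s_minus: "s (\<lambda>z. - f z) = - s f" if f: "f \<in> V" for f
  proof (rule antisym)
    show "s (\<lambda>z. - f z) \<le> - s f" using neg[OF f] by (rule s_le)
    have "- u \<le> s f" if u: "((\<lambda>z. - f z), u) \<in> R" for u
      by (rule s_ge[OF f]) (use opp[OF _ u] in force)
    then show "- s f \<le> s (\<lambda>z. - f z)" by (intro s_ge[OF V_minus[OF f]]) force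
  qed
  have mem: "(f, s f) \<in> R" if f: "f \<in> V" for f
    using neg[OF V_minus[OF f]] s_minus[OF f] by simp
  have add_le: "s (\<lambda>z. f z + g z) \<le> s f + s g" if "f \<in> V" "g \<in> V" for f g
    using R_add[OF mem[OF that(1)] mem[OF that(2)]] by (rule s_le)
  have scale_le: "s (\<lambda>z. c * f z) \<le> c * s f" if "f \<in> V" "c > 0" for f c
    using R_scale[OF that(2) mem[OF that(1)]] by (rule s_le)
  show ?thesis
  proof (rule that)
    show "s (\<lambda>z. f z + g z) = s f + s g" if fg: "f \<in> V" "g \<in> V" for f g
    proof (rule antisym[OF add_le[OF fg]])
      have "s (\<lambda>z. - f z + - g z) \<le> - s f - s g"
        using add_le[OF V_minus[OF fg(1)] V_minus[OF fg(2)]] by (simp add: s_minus fg)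
      then show "s f + s g \<le> s (\<lambda>z. f z + g z)"
        using s_minus[OF V_add[OF fg]] by simp
    qed
    have pos: "s (\<lambda>z. c * f z) = c * s f" if f: "f \<in> V" and c: "c > 0" for c f
    proof (rule antisym[OF scale_le[OF f c]])
      show "c * s f \<le> s (\<lambda>z. c * f z)"
        using scale_le[OF V_minus[OF f] c] s_minus[OF f] s_minus[OF V_scale[OF f, of c]] by simp
    qed
    have zero: "s (\<lambda>z. 0) = 0"
      using pos[OF R_V, of "\<lambda>z. 0" 0 2] sub R0_zero by auto
    show "s (\<lambda>z. c * f z) = c * s f" if f: "f \<in> V" for c f
    proof (cases c "0::real" rule: linorder_cases)
      case less
      then show ?thesis using pos[OF V_minus[OF f], of "- c"] s_minus[OF f] by simp
    qed (use zero pos[OF f] in auto)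
    show "s f \<le> t" if "(f, t) \<in> R0" for f t using that sub by (intro s_le) auto
  qed
qed

subsection \<open>Square sums of vectors and operator matrices\<close>

text \<open>The index set is arbitrary because the rows of a matrix will later be indexed by a
  finite set of vectors of K instead of an initial segment of the numbers.\<close>

definition nsq :: "'i set \<Rightarrow> ('i \<Rightarrow> 'a::chilbert) \<Rightarrow> real" where
  "nsq I \<xi> = (\<Sum>i\<in>I. (cnorm (\<xi> i))\<^sup>2)"

lemma nsq_ge0 [simp]: "0 \<le> nsq I \<xi>"
  by (simp add: nsq_def sum_nonneg)

lemma vnorm_eq: "vnorm n \<xi> = sqrt (nsq {..<n} \<xi>)"
  by (simp add: vnorm_def nsq_def cnorm_power2)

lemma nsq_scale: "nsq I (\<lambda>i. scaleC c (\<xi> i)) = (norm c)\<^sup>2 * nsq I \<xi>"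
  by (simp add: nsq_def cnorm_scaleC power_mult_distrib sum_distrib_left)

lemma two_Re_sum_le: "2 * Re (\<Sum>i\<in>I. cinner (\<xi> i) (\<eta> i)) \<le> nsq I \<xi> + nsq I \<eta>"
proof -
  have "2 * Re (\<Sum>i\<in>I. cinner (\<xi> i) (\<eta> i)) = (\<Sum>i\<in>I. 2 * Re (cinner (\<xi> i) (\<eta> i)))"
    by (simp add: sum_distrib_left)
  also have "\<dots> \<le> (\<Sum>i\<in>I. (cnorm (\<xi> i))\<^sup>2 + (cnorm (\<eta> i))\<^sup>2)"
    by (intro sum_mono two_Re_cinner_le)
  finally show ?thesis by (simp add: nsq_def sum.distrib)
qed

text \<open>Test with \<eta> = t w. The best scale is t = 1 / B; for B = 0 a large t forces w to
  vanish. This converts additive estimates back into products of bounds.\<close>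

lemma nsq_le_of_dual:
  assumes le: "\<And>\<eta>. 2 * Re (\<Sum>i\<in>I. cinner (w i) (\<eta> i)) \<le> A + B * nsq I \<eta>" and B: "0 \<le> B"
  shows "nsq I w \<le> A * B"
proof -
  have self: "Re (\<Sum>i\<in>I. cinner (w i) (scaleC (of_real t) (w i))) = t * nsq I w" for t
    by (simp add: cinner_simps cinner_self nsq_def sum_distrib_left)
  have t: "2 * t * nsq I w \<le> A + B * (t\<^sup>2 * nsq I w)" for t
    using le[of "\<lambda>i. scaleC (of_real t) (w i)"] unfolding self by (simp add: nsq_scale)
  show ?thesis
  proof (cases "B = 0")
    case True
    have "nsq I w = 0"
    proof (rule ccontr)
      assume "nsq I w \<noteq> 0"
      then show False using t[of "(A + 1) / (2 * nsq I w)"] True by simp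
    qed
    then show ?thesis using True by simp
  next
    case False
    then have "2 * (nsq I w / B) \<le> A + nsq I w / B"
      using t[of "1 / B"] by (simp add: power2_eq_square)
    then show ?thesis using False B by (simp add: field_simps)
  qed
qed

lemma two_Re_sum_le_weighted:
  assumes "0 < a"
  shows "2 * Re (\<Sum>i\<in>I. cinner (\<xi> i) (\<eta> i)) \<le> nsq I \<xi> / a + a * nsq I \<eta>"
proof -
  define d where "d = sqrt a"
  have d: "d > 0" "d\<^sup>2 = a" using assms by (simp_all add: d_def)
  have "(\<Sum>i\<in>I. cinner (scaleC (of_real (1 / d)) (\<xi> i)) (scaleC (of_real d) (\<eta> i))) = (\<Sum>i\<in>I. cinner (\<xi> i) (\<eta> i))"
    using d by (simp add: cinner_simps)
  then show ?thesis
    using two_Re_sum_le[of "\<lambda>i. scaleC (of_real (1 / d)) (\<xi> i)" "\<lambda>i. scaleC (of_real d) (\<eta> i)" I] d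
    by (simp add: nsq_scale norm_divide power_divide)
qed

text \<open>Moving the matrix across the inner product and balancing with the weight 1 / C brings
  the claim into the dual form.\<close>

lemma adjoint_bound:
  assumes x: "\<And>i j. i \<in> I \<Longrightarrow> j \<in> J \<Longrightarrow> x i j \<in> Bop"
    and c: "\<And>\<xi>. nsq I (\<lambda>i. \<Sum>j\<in>J. x i j (\<xi> j)) \<le> C * nsq J \<xi>" and C: "C > 0"
  shows "nsq J (\<lambda>j. \<Sum>i\<in>I. adjoint (x i j) (\<eta> i)) \<le> C * nsq I \<eta>"
proof -
  have "2 * Re (\<Sum>j\<in>J. cinner (\<Sum>i\<in>I. adjoint (x i j) (\<eta> i)) (\<zeta> j)) \<le> C * nsq I \<eta> + 1 * nsq J \<zeta>" for \<zeta>
  proof -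
    have "(\<Sum>j\<in>J. cinner (\<Sum>i\<in>I. adjoint (x i j) (\<eta> i)) (\<zeta> j)) = (\<Sum>j\<in>J. \<Sum>i\<in>I. cinner (\<eta> i) (x i j (\<zeta> j)))"
      unfolding cinner_sum_left by (intro sum.cong refl cinner_adjoint' x)
    also have "\<dots> = (\<Sum>i\<in>I. cinner (\<eta> i) (\<Sum>j\<in>J. x i j (\<zeta> j)))"
      unfolding cinner_sum_right by (rule sum.swap)
    also have "2 * Re \<dots> \<le> nsq I \<eta> / (1 / C) + 1 / C * nsq I (\<lambda>i. \<Sum>j\<in>J. x i j (\<zeta> j))"
      using C by (intro two_Re_sum_le_weighted) simp
    also have "\<dots> \<le> nsq I \<eta> / (1 / C) + 1 / C * (C * nsq J \<zeta>)"
      using c[of \<zeta>] C by (intro add_left_mono mult_left_mono) auto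
    finally show ?thesis using C by (simp add: mult.commute)
  qed
  from nsq_le_of_dual[OF this] show ?thesis by simp
qed

lemma adjoint_contraction:
  assumes "\<And>i j. i \<in> I \<Longrightarrow> j \<in> J \<Longrightarrow> x i j \<in> Bop"
    and "\<And>\<xi>. nsq I (\<lambda>i. \<Sum>j\<in>J. x i j (\<xi> j)) \<le> nsq J \<xi>"
  shows "nsq J (\<lambda>j. \<Sum>i\<in>I. adjoint (x i j) (\<eta> i)) \<le> nsq I \<eta>"
  using adjoint_bound[of I J x 1 \<eta>] assms by simp

section \<open>Norms of operator matrices\<close>

lemma MnD: "x \<in> Mn n X \<Longrightarrow> i < n \<Longrightarrow> j < n \<Longrightarrow> x i j \<in> X"
  by (simp add: Mn_def)

text \<open>\<open>mnorm\<close> is a supremum of reals and bounds the values only if these are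
  known to be bounded. A crude sum of bounds of the entries suffices for that.\<close>

lemma mnorm_bdd:
  assumes "x \<in> Mn n Bop"
  shows "\<exists>C>0. \<forall>\<xi>. vnorm n (\<lambda>i. \<Sum>j<n. x i j (\<xi> j)) \<le> C * vnorm n \<xi>"
proof -
  have "\<exists>C. \<forall>i<n. \<forall>j<n. C i j > 0 \<and> (\<forall>v. cnorm (x i j v) \<le> C i j * cnorm v)"
    using Bop_bound[OF MnD[OF assms]] by metis
  then obtain C where C: "\<And>i j. i < n \<Longrightarrow> j < n \<Longrightarrow> C i j > 0"
    "\<And>i j v. i < n \<Longrightarrow> j < n \<Longrightarrow> cnorm (x i j v) \<le> C i j * cnorm v" by blast
  have cn: "cnorm (\<xi> j) \<le> vnorm n \<xi>" if "j < n" for j and \<xi> :: "nat \<Rightarrow> 'a"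
  proof -
    have "(cnorm (\<xi> j))\<^sup>2 \<le> nsq {..<n} \<xi>" unfolding nsq_def using that by (intro member_le_sum) auto
    then show ?thesis unfolding vnorm_eq by (rule real_le_rsqrt)
  qed
  define D where "D = (\<Sum>i<n. \<Sum>j<n. C i j) + 1"
  have D: "D > 0" unfolding D_def by (intro add_nonneg_pos sum_nonneg) (auto intro: less_imp_le[OF C(1)])
  have "vnorm n (\<lambda>i. \<Sum>j<n. x i j (\<xi> j)) \<le> D * vnorm n \<xi>" for \<xi>
  proof -
    have "vnorm n (\<lambda>i. \<Sum>j<n. x i j (\<xi> j)) = L2_set (\<lambda>i. cnorm (\<Sum>j<n. x i j (\<xi> j))) {..<n}"
      by (simp add: vnorm_eq nsq_def L2_set_def)
    also have "\<dots> \<le> (\<Sum>i<n. cnorm (\<Sum>j<n. x i j (\<xi> j)))"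
      by (rule L2_set_le_sum) simp
    also have "\<dots> \<le> (\<Sum>i<n. \<Sum>j<n. cnorm (x i j (\<xi> j)))"
      by (intro sum_mono cnorm_sum_le)
    also have "\<dots> \<le> (\<Sum>i<n. \<Sum>j<n. C i j * vnorm n \<xi>)"
    proof (intro sum_mono)
      fix i j assume ij: "i \<in> {..<n}" "j \<in> {..<n}"
      then have "cnorm (x i j (\<xi> j)) \<le> C i j * cnorm (\<xi> j)" using C(2) by simp
      also have "\<dots> \<le> C i j * vnorm n \<xi>" using ij C(1)[of i j] by (intro mult_left_mono cn) auto
      finally show "cnorm (x i j (\<xi> j)) \<le> C i j * vnorm n \<xi>" .
    qed
    also have "\<dots> \<le> D * vnorm n \<xi>"
      by (simp add: D_def distrib_right sum_distrib_right vnorm_eq)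
    finally show ?thesis .
  qed
  with D show ?thesis by blast
qed

lemma mnorm_bound:
  assumes x: "x \<in> Mn n Bop"
  shows "nsq {..<n} (\<lambda>i. \<Sum>j<n. x i j (\<xi> j)) \<le> (mnorm n x)\<^sup>2 * nsq {..<n} \<xi>"
    and mnorm_ge0: "0 \<le> mnorm n x"
proof -
  obtain C where C: "C > 0" "\<And>\<xi>. vnorm n (\<lambda>i. \<Sum>j<n. x i j (\<xi> j)) \<le> C * vnorm n \<xi>"
    using mnorm_bdd[OF x] by blast
  have bdd: "bdd_above {vnorm n (\<lambda>i. \<Sum>j<n. x i j (\<xi> j)) | \<xi>. vnorm n \<xi> \<le> 1}"
    unfolding bdd_above_def
  proof (intro exI[of _ C] ballI)
    fix r assume "r \<in> {vnorm n (\<lambda>i. \<Sum>j<n. x i j (\<xi> j)) | \<xi>. vnorm n \<xi> \<le> 1}"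
    then obtain \<xi> where "r = vnorm n (\<lambda>i. \<Sum>j<n. x i j (\<xi> j))" "vnorm n \<xi> \<le> 1" by blast
    moreover have "C * vnorm n \<xi> \<le> C * 1" using C(1) \<open>vnorm n \<xi> \<le> 1\<close> by (intro mult_left_mono) auto
    ultimately show "r \<le> C" using C(2)[of \<xi>] by simp
  qed
  have upper: "vnorm n (\<lambda>i. \<Sum>j<n. x i j (\<xi> j)) \<le> mnorm n x" if "vnorm n \<xi> \<le> 1" for \<xi>
    unfolding mnorm_def using that by (intro cSup_upper[OF _ bdd]) auto
  show m0: "0 \<le> mnorm n x"
    using upper[of "\<lambda>_. 0"] by (simp add: vnorm_eq nsq_def) (smt (verit) real_sqrt_ge_zero sum_nonneg zero_le_power2)
  have "vnorm n (\<lambda>i. \<Sum>j<n. x i j (\<xi> j)) \<le> mnorm n x * vnorm n \<xi>"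
  proof (cases "vnorm n \<xi> = 0")
    case True
    then show ?thesis using C(2)[of \<xi>] by simp
  next
    case False
    define d where "d = vnorm n \<xi>"
    have d: "d > 0" using False by (simp add: d_def order_less_le vnorm_eq)
    have sc: "vnorm n (\<lambda>i. scaleC (of_real (1 / d)) (\<zeta> i)) = vnorm n \<zeta> / d" for \<zeta> :: "nat \<Rightarrow> 'a"
      using d by (simp add: vnorm_eq nsq_scale real_sqrt_mult norm_divide real_sqrt_divide)
    have "vnorm n (\<lambda>i. \<Sum>j<n. x i j (scaleC (of_real (1 / d)) (\<xi> j))) \<le> mnorm n x"
      using d by (intro upper) (simp only: sc, simp add: d_def)
    moreover have "(\<Sum>j<n. x i j (scaleC (of_real (1 / d)) (\<xi> j))) = scaleC (of_real (1 / d)) (\<Sum>j<n. x i j (\<xi> j))"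
      if "i < n" for i
      unfolding scaleC_sum_right using that by (intro sum.cong refl Bop_scale MnD[OF x]) auto
    ultimately have "vnorm n (\<lambda>i. scaleC (of_real (1 / d)) (\<Sum>j<n. x i j (\<xi> j))) \<le> mnorm n x"
      by (simp add: vnorm_eq nsq_def)
    then show ?thesis using d unfolding sc by (simp add: d_def field_simps)
  qed
  then have "(vnorm n (\<lambda>i. \<Sum>j<n. x i j (\<xi> j)))\<^sup>2 \<le> (mnorm n x * vnorm n \<xi>)\<^sup>2"
    by (intro power_mono) (simp_all add: vnorm_eq)
  then show "nsq {..<n} (\<lambda>i. \<Sum>j<n. x i j (\<xi> j)) \<le> (mnorm n x)\<^sup>2 * nsq {..<n} \<xi>"
    by (simp add: vnorm_eq power_mult_distrib)
qed

lemma mnorm_le: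
  assumes "0 \<le> C" "\<And>\<xi>. nsq {..<n} (\<lambda>i. \<Sum>j<n. x i j (\<xi> j)) \<le> C\<^sup>2 * nsq {..<n} \<xi>"
  shows "mnorm n x \<le> C"
  unfolding mnorm_def
proof (rule cSup_least)
  show "{vnorm n (\<lambda>i. \<Sum>j<n. x i j (\<xi> j)) |\<xi>. vnorm n \<xi> \<le> 1} \<noteq> {}"
    by (auto intro!: exI[of _ "\<lambda>_. 0"] simp: vnorm_eq nsq_def)
  fix r assume "r \<in> {vnorm n (\<lambda>i. \<Sum>j<n. x i j (\<xi> j)) | \<xi>. vnorm n \<xi> \<le> 1}"
  then obtain \<xi> where r: "r = vnorm n (\<lambda>i. \<Sum>j<n. x i j (\<xi> j))" "vnorm n \<xi> \<le> 1" by blast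
  have "nsq {..<n} \<xi> \<le> 1" using r(2) by (simp add: vnorm_eq)
  then have "C\<^sup>2 * nsq {..<n} \<xi> \<le> C\<^sup>2" using mult_left_mono[of "nsq {..<n} \<xi>" 1 "C\<^sup>2"] by simp
  then have "nsq {..<n} (\<lambda>i. \<Sum>j<n. x i j (\<xi> j)) \<le> C\<^sup>2" using assms(2)[of \<xi>] by linarith
  then show "r \<le> C" using assms(1) r(1) by (simp add: vnorm_eq real_le_lsqrt)
qed

lemma mnorm_contraction:
  assumes "x \<in> Mn n Bop" "mnorm n x \<le> 1"
  shows "nsq {..<n} (\<lambda>i. \<Sum>j<n. x i j (\<xi> j)) \<le> nsq {..<n} \<xi>"
proof -
  have "(mnorm n x)\<^sup>2 \<le> 1" using mnorm_ge0[OF assms(1)] assms(2) by (simp add: power_le_one)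
  then have "(mnorm n x)\<^sup>2 * nsq {..<n} \<xi> \<le> 1 * nsq {..<n} \<xi>" by (intro mult_right_mono) auto
  then show ?thesis using mnorm_bound(1)[OF assms(1), of \<xi>] by simp
qed

subsection \<open>Cholesky decomposition\<close>

text \<open>Induction on the index set, bordering the matrix by one row and one column. Strict
  positivity makes the Schur complement positive; its root can then be divided by, which yields the
  inverse R along with S.\<close>

lemma cholesky:
  fixes a :: "'i \<Rightarrow> 'i \<Rightarrow> complex"
  assumes "finite F"
    and "\<And>i j. i \<in> F \<Longrightarrow> j \<in> F \<Longrightarrow> a j i = cnj (a i j)"
    and "\<And>z. \<exists>i\<in>F. z i \<noteq> 0 \<Longrightarrow> 0 < Re (\<Sum>i\<in>F. \<Sum>j\<in>F. a i j * z j * cnj (z i))"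
  shows "\<exists>S R. (\<forall>i\<in>F. \<forall>j\<in>F. a i j = (\<Sum>r\<in>F. S i r * cnj (S j r)))
    \<and> (\<forall>i\<in>F. \<forall>j\<in>F. (\<Sum>r\<in>F. S i r * R r j) = of_bool (i = j))
    \<and> (\<forall>i\<in>F. \<forall>j\<in>F. (\<Sum>r\<in>F. R i r * S r j) = of_bool (i = j))"
  using assms
proof (induction F rule: finite_induct)
  case empty
  then show ?case by simp
next
  case (insert p F)
  have pos: "0 < Re (\<Sum>i\<in>F. \<Sum>j\<in>F. a i j * z j * cnj (z i))" if z: "\<exists>i\<in>F. z i \<noteq> 0" for z
  proof -
    define y where "y = z(p := 0)"
    have y: "y i = z i" if "i \<in> F" for i using that insert.hyps by (auto simp: y_def)
    have "0 < Re (\<Sum>i\<in>insert p F. \<Sum>j\<in>insert p F. a i j * y j * cnj (y i))"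
      using z y by (intro insert.prems(2)) auto
    also have "(\<Sum>i\<in>insert p F. \<Sum>j\<in>insert p F. a i j * y j * cnj (y i)) = (\<Sum>i\<in>F. \<Sum>j\<in>F. a i j * y j * cnj (y i))"
      using insert.hyps by (simp add: y_def[of, THEN fun_cong, of p, simplified])
    finally show ?thesis by (simp add: y cong: sum.cong)
  qed
  have herm: "a j i = cnj (a i j)" if "i \<in> F" "j \<in> F" for i j
    using that by (intro insert.prems(1)) auto
  obtain S R where S: "\<And>i j. i \<in> F \<Longrightarrow> j \<in> F \<Longrightarrow> a i j = (\<Sum>r\<in>F. S i r * cnj (S j r))"
    and SR: "\<And>i j. i \<in> F \<Longrightarrow> j \<in> F \<Longrightarrow> (\<Sum>r\<in>F. S i r * R r j) = of_bool (i = j)"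
    and RS: "\<And>i j. i \<in> F \<Longrightarrow> j \<in> F \<Longrightarrow> (\<Sum>r\<in>F. R i r * S r j) = of_bool (i = j)"
    using insert.IH herm pos by blast
  \<comment> \<open>The new column in the coordinates given by S: S w = a(., p). The Schur
    complement is therefore \<alpha> - W.\<close>
  define w where "w r = (\<Sum>i\<in>F. R r i * a i p)" for r
  define W where "W = (\<Sum>r\<in>F. (norm (w r))\<^sup>2)"
  define \<alpha> where "\<alpha> = Re (a p p)"
  have app: "a p p = of_real \<alpha>"
    using insert.prems(1)[of p p] by (simp add: \<alpha>_def complex_eq_iff)
  have Wc: "(\<Sum>r\<in>F. w r * cnj (w r)) = of_real W" unfolding W_def of_real_sum complex_norm_square ..
  have bilin: "(\<Sum>i\<in>F. b i * (\<Sum>j\<in>F. M i j * c j)) = (\<Sum>j\<in>F. (\<Sum>i\<in>F. b i * M i j) * c j)"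
    for b c :: "'i \<Rightarrow> complex" and M
    by (simp add: sum_distrib_left sum_distrib_right mult.assoc) (rule sum.swap)
  have delta: "(\<Sum>j\<in>F. of_bool (i = j) * c j) = c i" if "i \<in> F" for i and c :: "'i \<Rightarrow> complex"
    using that insert.hyps by (simp add: of_bool_def if_distrib[of "\<lambda>x. x * _"] cong: if_cong)
  have Sw: "(\<Sum>r\<in>F. S i r * w r) = a i p" if "i \<in> F" for i
    unfolding w_def bilin using that by (simp add: SR delta)
  have "W < \<alpha>"
  proof -
    \<comment> \<open>With last entry 1 this is the vector whose remaining part is minus the inverse
      of the old matrix applied to the new column. The form takes the value \<alpha> - W
      there.\<close>
    define x where "x i = - (\<Sum>r\<in>F. cnj (R r i) * w r)" for i
    define z where "z = x(p := 1)"
    have zF: "z i = x i" if "i \<in> F" for i using that insert.hyps by (auto simp: z_def)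
    have Sx: "(\<Sum>i\<in>F. cnj (S i r) * x i) = - w r" if r: "r \<in> F" for r
    proof -
      have "(\<Sum>i\<in>F. cnj (S i r) * (\<Sum>q\<in>F. cnj (R q i) * w q)) = (\<Sum>q\<in>F. (\<Sum>i\<in>F. cnj (S i r) * cnj (R q i)) * w q)"
        by (rule bilin)
      also have "\<dots> = (\<Sum>q\<in>F. of_bool (r = q) * w q)"
      proof (intro sum.cong refl)
        fix q assume "q \<in> F"
        have "(\<Sum>i\<in>F. cnj (S i r) * cnj (R q i)) = cnj (\<Sum>i\<in>F. R q i * S i r)"
          by (simp add: mult.commute)
        then show "(\<Sum>i\<in>F. cnj (S i r) * cnj (R q i)) * w q = of_bool (r = q) * w q"
          using RS[OF \<open>q \<in> F\<close> r] by auto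
      qed
      finally show ?thesis using r by (simp add: x_def sum_negf delta)
    qed
    have xS: "(\<Sum>i\<in>F. S i r * cnj (x i)) = - cnj (w r)" if r: "r \<in> F" for r
      using arg_cong[OF Sx[OF r], of cnj] by simp
    have 1: "(\<Sum>i\<in>F. a i p * cnj (x i)) = - of_real W"
    proof -
      have "(\<Sum>i\<in>F. a i p * cnj (x i)) = (\<Sum>i\<in>F. cnj (x i) * (\<Sum>r\<in>F. S i r * w r))"
        by (intro sum.cong refl) (simp add: Sw)
      also have "\<dots> = (\<Sum>r\<in>F. (\<Sum>i\<in>F. cnj (x i) * S i r) * w r)" by (rule bilin)
      also have "\<dots> = (\<Sum>r\<in>F. - (w r * cnj (w r)))"
        by (intro sum.cong refl) (simp add: xS mult.commute[of "cnj (x _)"])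
      finally show ?thesis by (simp add: Wc sum_negf)
    qed
    have 2: "(\<Sum>j\<in>F. a p j * x j) = - of_real W"
    proof -
      have "(\<Sum>j\<in>F. a p j * x j) = cnj (\<Sum>i\<in>F. a i p * cnj (x i))"
        unfolding cnj_sum by (intro sum.cong refl) (simp add: insert.prems(1)[of _ p])
      then show ?thesis by (simp add: 1)
    qed
    have 3: "(\<Sum>i\<in>F. \<Sum>j\<in>F. a i j * x j * cnj (x i)) = of_real W"
    proof -
      have "(\<Sum>i\<in>F. \<Sum>j\<in>F. a i j * x j * cnj (x i)) = (\<Sum>i\<in>F. cnj (x i) * (\<Sum>j\<in>F. (\<Sum>r\<in>F. S i r * cnj (S j r)) * x j))"
        by (simp add: S sum_distrib_left mult_ac cong: sum.cong)
      also have "\<dots> = (\<Sum>i\<in>F. cnj (x i) * (\<Sum>r\<in>F. S i r * (\<Sum>j\<in>F. cnj (S j r) * x j)))"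
        by (simp only: bilin)
      also have "\<dots> = (\<Sum>i\<in>F. cnj (x i) * (\<Sum>r\<in>F. S i r * (- w r)))"
        by (simp add: Sx cong: sum.cong)
      also have "\<dots> = - (\<Sum>i\<in>F. a i p * cnj (x i))"
        by (simp add: Sw sum_negf mult.commute[of "cnj _"] cong: sum.cong)
      finally show ?thesis by (simp add: 1)
    qed
    have "0 < Re (\<Sum>i\<in>insert p F. \<Sum>j\<in>insert p F. a i j * z j * cnj (z i))"
      by (intro insert.prems(2)) (auto simp: z_def)
    also have "(\<Sum>i\<in>insert p F. \<Sum>j\<in>insert p F. a i j * z j * cnj (z i)) =
        a p p + (\<Sum>j\<in>F. a p j * x j) + (\<Sum>i\<in>F. a i p * cnj (x i)) + (\<Sum>i\<in>F. \<Sum>j\<in>F. a i j * x j * cnj (x i))"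
      using insert.hyps zF by (simp add: z_def[THEN fun_cong, of p, simplified] sum.distrib cong: sum.cong)
    finally show ?thesis unfolding 1 2 3 app by simp
  qed
  define \<beta> where "\<beta> = sqrt (\<alpha> - W)"
  have \<beta>: "\<beta> > 0" "\<beta>\<^sup>2 = \<alpha> - W" using \<open>W < \<alpha>\<close> by (simp_all add: \<beta>_def)
  \<comment> \<open>Block lower triangular: the rows of S are extended by 0, and the new row is w^*
    followed by \<beta>. R' is the inverse obtained by forward substitution.\<close>
  define S' where "S' i r = (if i = p then (if r = p then of_real \<beta> else cnj (w r)) else if r = p then 0 else S i r)" for i r
  define R' where "R' i j = (if i = p then (if j = p then 1 / of_real \<beta> else - (\<Sum>r\<in>F. cnj (w r) * R r j) / of_real \<beta>)
    else if j = p then 0 else R i j)" for i j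
  have nF: "i \<noteq> p" if "i \<in> F" for i using that insert.hyps by auto
  have S'F: "S' i r = S i r" "S' i p = 0" "S' p r = cnj (w r)" "S' p p = of_real \<beta>" if "i \<in> F" "r \<in> F" for i r
    using that nF by (auto simp: S'_def)
  show ?case
  proof (rule exI[of _ S'], rule exI[of _ R'], intro conjI ballI)
    fix i j assume ij: "i \<in> insert p F" "j \<in> insert p F"
    have ins: "(\<Sum>r\<in>insert p F. g r) = g p + (\<Sum>r\<in>F. g r)" for g :: "'i \<Rightarrow> complex"
      using insert.hyps by simp
    have pp: "of_real \<beta> * of_real \<beta> + (\<Sum>r\<in>F. cnj (w r) * w r) = a p p"
      using \<beta>(2) Wc by (simp add: app power2_eq_square mult.commute[of "cnj _"] flip: of_real_mult of_real_add)
    have cw: "(\<Sum>r\<in>F. cnj (w r) * cnj (S j r)) = a p j" if "j \<in> F" for j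
      using arg_cong[OF Sw[OF that], of cnj] insert.prems(1)[of j p] that by (simp add: mult.commute)
    show "a i j = (\<Sum>r\<in>insert p F. S' i r * cnj (S' j r))"
      using ij nF insert.hyps unfolding ins
      by (auto simp: S'_def S Sw cw pp cong: sum.cong)
    show "(\<Sum>r\<in>insert p F. S' i r * R' r j) = of_bool (i = j)"
      using ij nF insert.hyps \<beta>(1) unfolding ins
      by (auto simp: S'_def R'_def SR cong: sum.cong)
    have cRS: "(\<Sum>r\<in>F. (\<Sum>q\<in>F. cnj (w q) * R q r) * S r j) = cnj (w j)" if "j \<in> F" for j
    proof -
      have "(\<Sum>r\<in>F. (\<Sum>q\<in>F. cnj (w q) * R q r) * S r j) = (\<Sum>q\<in>F. cnj (w q) * of_bool (q = j))"
        unfolding bilin[symmetric] using that by (intro sum.cong refl) (simp add: RS)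
      then show ?thesis
        using that insert.hyps by (simp add: of_bool_def if_distrib[of "\<lambda>x. _ * x"] cong: if_cong)
    qed
    show "(\<Sum>r\<in>insert p F. R' i r * S' r j) = of_bool (i = j)"
      using ij nF insert.hyps \<beta>(1) unfolding ins
      by (auto simp: S'_def R'_def RS cRS sum_negf simp flip: sum_divide_distrib cong: sum.cong)
  qed
qed

text \<open>For a = S S^* the left side is the form of a \<otimes> 1 at g, and the right side is the
  squared length of g after applying S^* \<otimes> 1.\<close>

lemma gram_square:
  fixes g :: "'i \<Rightarrow> 'b::chilbert"
  assumes "\<And>i j. i \<in> F \<Longrightarrow> j \<in> F \<Longrightarrow> a i j = (\<Sum>r\<in>F. S i r * cnj (S j r))"
  shows "(\<Sum>i\<in>F. \<Sum>j\<in>F. a i j * cinner (g j) (g i)) = of_real (nsq F (\<lambda>r. \<Sum>j\<in>F. scaleC (cnj (S j r)) (g j)))"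
proof -
  have "of_real (nsq F (\<lambda>r. \<Sum>j\<in>F. scaleC (cnj (S j r)) (g j)))
      = (\<Sum>r\<in>F. \<Sum>i\<in>F. \<Sum>j\<in>F. S i r * cnj (S j r) * cinner (g j) (g i))"
    unfolding nsq_def of_real_sum cinner_self[symmetric] cinner_sum_right
    unfolding cinner_sum_left cinner_scaleC_left cinner_scaleC_right by (simp add: mult.assoc sum_distrib_left)
  also have "\<dots> = (\<Sum>i\<in>F. \<Sum>r\<in>F. \<Sum>j\<in>F. S i r * cnj (S j r) * cinner (g j) (g i))" by (rule sum.swap)
  also have "\<dots> = (\<Sum>i\<in>F. \<Sum>j\<in>F. \<Sum>r\<in>F. S i r * cnj (S j r) * cinner (g j) (g i))"
    by (intro sum.cong refl sum.swap)
  also have "\<dots> = (\<Sum>i\<in>F. \<Sum>j\<in>F. a i j * cinner (g j) (g i))"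
    by (intro sum.cong refl) (simp add: assms sum_distrib_right)
  finally show ?thesis ..
qed

subsection \<open>Completely bounded bilinear maps\<close>

lemma Bop_sum_op: "(\<And>i. i \<in> I \<Longrightarrow> T i \<in> Bop) \<Longrightarrow> (\<lambda>v. \<Sum>i\<in>I. T i v) \<in> Bop"
proof (induction I rule: infinite_finite_induct)
  case (insert i I)
  then show ?case using Bop_oadd[of "T i" "\<lambda>v. \<Sum>i\<in>I. T i v"] by (simp add: oadd_def)
qed (auto simp: Bop_0)

lemma adjoint_sum_op:
  assumes "\<And>i. i \<in> I \<Longrightarrow> T i \<in> Bop"
  shows "adjoint (\<lambda>v. \<Sum>i\<in>I. T i v) = (\<lambda>v. \<Sum>i\<in>I. adjoint (T i) v)"
  by (rule adjoint_eqI[OF Bop_sum_op[OF assms]])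
    (auto simp: cinner_sum_left cinner_sum_right cinner_adjoint assms)

lemma opspace_Bop: "opspace X \<Longrightarrow> T \<in> X \<Longrightarrow> T \<in> Bop"
  by (auto simp: opspace_def)

lemma opspace_zero: "opspace X \<Longrightarrow> (\<lambda>v. 0) \<in> X"
  by (simp add: opspace_def)

lemma opspace_oscale: "opspace X \<Longrightarrow> T \<in> X \<Longrightarrow> oscale a T \<in> X"
  by (simp add: opspace_def)

lemma opspace_sum: "opspace X \<Longrightarrow> (\<And>i. i \<in> I \<Longrightarrow> T i \<in> X) \<Longrightarrow> (\<lambda>v. \<Sum>i\<in>I. T i v) \<in> X"
proof (induction I rule: infinite_finite_induct)
  case (insert i I)
  then have "oadd (T i) (\<lambda>v. \<Sum>i\<in>I. T i v) \<in> X" unfolding opspace_def by blast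
  then show ?case using insert.hyps by (simp add: oadd_def)
qed (auto simp: opspace_zero)

lemma opspace_lincomb:
  "opspace X \<Longrightarrow> (\<And>i. i \<in> I \<Longrightarrow> T i \<in> X) \<Longrightarrow> (\<lambda>v. \<Sum>i\<in>I. scaleC (a i) (T i v)) \<in> X"
  using opspace_sum[of X I "\<lambda>i. oscale (a i) (T i)"] by (simp add: opspace_oscale) (simp add: oscale_def)

lemma linear_on_zero: "opspace X \<Longrightarrow> linear_on X f \<Longrightarrow> f (\<lambda>v. 0) = (\<lambda>v. 0)"
proof -
  assume X: "opspace X" and f: "linear_on X f"
  have "oscale 0 (\<lambda>v. 0) = (\<lambda>v. 0 :: 'a)" by (simp add: oscale_def)
  then have "f (\<lambda>v. 0) = oscale 0 (f (\<lambda>v. 0))"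
    using f opspace_zero[OF X] unfolding linear_on_def by metis
  then show ?thesis by (simp add: oscale_def)
qed

lemma linear_on_lincomb:
  assumes X: "opspace X" and f: "linear_on X f" and T: "\<And>i. i \<in> I \<Longrightarrow> T i \<in> X"
  shows "f (\<lambda>v. \<Sum>i\<in>I. scaleC (a i) (T i v)) = (\<lambda>v. \<Sum>i\<in>I. scaleC (a i) (f (T i) v))"
  using T
proof (induction I rule: infinite_finite_induct)
  case (insert i I)
  have 1: "oscale (a i) (T i) \<in> X" using X insert.prems by (intro opspace_oscale) auto
  have 2: "(\<lambda>v. \<Sum>i\<in>I. scaleC (a i) (T i v)) \<in> X" using X insert.prems by (intro opspace_lincomb) auto
  have "f (\<lambda>v. \<Sum>i\<in>insert i I. scaleC (a i) (T i v)) = f (oadd (oscale (a i) (T i)) (\<lambda>v. \<Sum>i\<in>I. scaleC (a i) (T i v)))"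
    using insert.hyps by (simp add: oadd_def oscale_def)
  also have "\<dots> = oadd (f (oscale (a i) (T i))) (f (\<lambda>v. \<Sum>i\<in>I. scaleC (a i) (T i v)))"
    using f 1 2 unfolding linear_on_def by blast
  also have "f (oscale (a i) (T i)) = oscale (a i) (f (T i))"
    using f insert.prems unfolding linear_on_def by blast
  finally show ?case using insert by (simp add: oadd_def oscale_def)
qed (use linear_on_zero[OF X f] in auto)

text \<open>The vectors \<open>u1\<close>, \<open>u2\<close> exclude trivial spaces, over which \<open>a \<otimes> 1 \<ge> 0\<close> would not imply \<open>a \<ge> 0\<close> for scalar
  matrices.\<close>
locale cb_bilinear =
  fixes X :: "('h1::chilbert \<Rightarrow> 'h1) set" and Y :: "('h2::chilbert \<Rightarrow> 'h2) set"
    and \<phi> :: "('h1 \<Rightarrow> 'h1) \<Rightarrow> ('h2 \<Rightarrow> 'h2) \<Rightarrow> ('k::chilbert \<Rightarrow> 'k)" and c :: real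
    and u1 :: 'h1 and u2 :: 'h2
  assumes X: "opspace X" and Y: "opspace Y" and bil: "bilinear_on X Y \<phi>"
    and \<phi>B: "\<And>x y. x \<in> X \<Longrightarrow> y \<in> Y \<Longrightarrow> \<phi> x y \<in> Bop"
    and c: "c > 0"
    and \<phi>_cb: "\<And>n x y. n \<ge> 1 \<Longrightarrow> x \<in> Mn n X \<Longrightarrow> y \<in> Mn n Y \<Longrightarrow> mnorm n x \<le> 1 \<Longrightarrow> mnorm n y \<le> 1
      \<Longrightarrow> mnorm n (amp2 n \<phi> x y) \<le> c"
    and u1: "u1 \<noteq> 0" and u2: "u2 \<noteq> 0"
begin

lemmas XB = opspace_Bop[OF X] and YB = opspace_Bop[OF Y]

lemma \<phi>_lincomb:
  assumes "\<And>i. i \<in> I \<Longrightarrow> x i \<in> X" "\<And>j. j \<in> J \<Longrightarrow> y j \<in> Y"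
  shows "\<phi> (\<lambda>v. \<Sum>i\<in>I. scaleC (a i) (x i v)) (\<lambda>v. \<Sum>j\<in>J. scaleC (b j) (y j v)) =
    (\<lambda>v. \<Sum>i\<in>I. \<Sum>j\<in>J. scaleC (a i * b j) (\<phi> (x i) (y j) v))"
proof -
  have "(\<lambda>v. \<Sum>j\<in>J. scaleC (b j) (y j v)) \<in> Y" using Y assms(2) by (rule opspace_lincomb)
  then have "linear_on X (\<lambda>x. \<phi> x (\<lambda>v. \<Sum>j\<in>J. scaleC (b j) (y j v)))"
    using bil by (simp add: bilinear_on_def)
  from linear_on_lincomb[OF X this, of I x a, OF assms(1)]
  have "\<phi> (\<lambda>v. \<Sum>i\<in>I. scaleC (a i) (x i v)) (\<lambda>v. \<Sum>j\<in>J. scaleC (b j) (y j v))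
      = (\<lambda>v. \<Sum>i\<in>I. scaleC (a i) (\<phi> (x i) (\<lambda>v. \<Sum>j\<in>J. scaleC (b j) (y j v)) v))" .
  also have "\<dots> = (\<lambda>v. \<Sum>i\<in>I. scaleC (a i) (\<Sum>j\<in>J. scaleC (b j) (\<phi> (x i) (y j) v)))"
  proof (intro ext sum.cong refl)
    fix v i assume "i \<in> I"
    then have "linear_on Y (\<phi> (x i))" using bil assms(1) by (simp add: bilinear_on_def)
    from linear_on_lincomb[OF Y this, of J y b, OF assms(2)]
    show "scaleC (a i) (\<phi> (x i) (\<lambda>v. \<Sum>j\<in>J. scaleC (b j) (y j v)) v) = scaleC (a i) (\<Sum>j\<in>J. scaleC (b j) (\<phi> (x i) (y j) v))"
      by simp
  qed
  finally show ?thesis by (simp add: scaleC_sum_right scaleC_scaleC)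
qed

lemma \<phi>_sum:
  assumes "\<And>i. i \<in> I \<Longrightarrow> x i \<in> X" "\<And>j. j \<in> J \<Longrightarrow> y j \<in> Y"
  shows "\<phi> (\<lambda>v. \<Sum>i\<in>I. x i v) (\<lambda>v. \<Sum>j\<in>J. y j v) = (\<lambda>v. \<Sum>i\<in>I. \<Sum>j\<in>J. \<phi> (x i) (y j) v)"
  using \<phi>_lincomb[of I x J y "\<lambda>_. 1" "\<lambda>_. 1"] assms by (simp add: scaleC_one)

lemma \<phi>_zero_left: "y \<in> Y \<Longrightarrow> \<phi> (\<lambda>v. 0) y = (\<lambda>v. 0)"
  using linear_on_zero[OF X, of "\<lambda>x. \<phi> x y"] bil by (simp add: bilinear_on_def)

lemma \<phi>_zero_right: "x \<in> X \<Longrightarrow> \<phi> x (\<lambda>v. 0) = (\<lambda>v. 0)"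
  using linear_on_zero[OF Y, of "\<phi> x"] bil by (simp add: bilinear_on_def)

text \<open>The norm bound of the amplification in dual, additive form. Being linear in the squared
  norms of the vectors, it can be compared with quadratic forms.\<close>

lemma amp_square_bound:
  assumes x: "x \<in> Mn n X" and y: "y \<in> Mn n Y"
    and cx: "\<And>\<xi>. nsq {..<n} (\<lambda>i. \<Sum>j<n. x i j (\<xi> j)) \<le> nsq {..<n} \<xi>"
    and cy: "\<And>\<xi>. nsq {..<n} (\<lambda>i. \<Sum>j<n. y i j (\<xi> j)) \<le> nsq {..<n} \<xi>"
  shows "2 * Re (\<Sum>i<n. \<Sum>j<n. \<Sum>k<n. cinner (\<phi> (x i k) (y k j) (\<zeta> j)) (\<eta> i)) \<le> c * (nsq {..<n} \<eta> + nsq {..<n} \<zeta>)"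
proof (cases "n = 0")
  case True
  then show ?thesis by (simp add: nsq_def)
next
  case False
  have B: "amp2 n \<phi> x y \<in> Mn n Bop"
    unfolding Mn_def amp2_def using x y by (auto intro!: Bop_sum_op \<phi>B MnD)
  have m: "mnorm n (amp2 n \<phi> x y) \<le> c"
    using False x y cx cy by (intro \<phi>_cb mnorm_le) auto
  define w where "w i = (\<Sum>j<n. amp2 n \<phi> x y i j (\<zeta> j))" for i
  have "nsq {..<n} w \<le> (mnorm n (amp2 n \<phi> x y))\<^sup>2 * nsq {..<n} \<zeta>"
    unfolding w_def by (rule mnorm_bound(1)[OF B])
  also have "\<dots> \<le> c\<^sup>2 * nsq {..<n} \<zeta>"
    using m mnorm_ge0[OF B] by (intro mult_right_mono power_mono) auto
  finally have w: "nsq {..<n} w \<le> c\<^sup>2 * nsq {..<n} \<zeta>" .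
  have "2 * Re (\<Sum>i<n. cinner (w i) (\<eta> i)) \<le> nsq {..<n} w / c + c * nsq {..<n} \<eta>"
    using c by (rule two_Re_sum_le_weighted)
  also have "\<dots> \<le> c\<^sup>2 * nsq {..<n} \<zeta> / c + c * nsq {..<n} \<eta>"
    using w c by (intro add_right_mono divide_right_mono) auto
  also have "\<dots> = c * (nsq {..<n} \<eta> + nsq {..<n} \<zeta>)"
    using c by (simp add: power2_eq_square distrib_left)
  finally show ?thesis by (simp add: w_def amp2_def cinner_sum_left)
qed

text \<open>Amplifications exist for square matrices only, so x (rows F, columns M) and y (rows M,
  columns F) are padded with zeros to size \<open>max (card F) M\<close>. Neither the contractivity
  nor the value changes, as \<phi> vanishes when one argument is 0.\<close>

lemma amp_rect_bound:
  fixes \<zeta> \<eta> :: "'i \<Rightarrow> 'k" and M :: nat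
  assumes F: "finite F" and x: "\<And>m r. m < M \<Longrightarrow> r \<in> F \<Longrightarrow> x m r \<in> X" and y: "\<And>m r. m < M \<Longrightarrow> r \<in> F \<Longrightarrow> y m r \<in> Y"
    and cx: "\<And>\<xi>. nsq F (\<lambda>r. \<Sum>m<M. x m r (\<xi> m)) \<le> nsq {..<M} \<xi>"
    and cy: "\<And>\<xi>. nsq {..<M} (\<lambda>m. \<Sum>r\<in>F. y m r (\<xi> r)) \<le> nsq F \<xi>"
  shows "2 * Re (\<Sum>r\<in>F. \<Sum>s\<in>F. \<Sum>m<M. cinner (\<phi> (x m r) (y m s) (\<zeta> s)) (\<eta> r)) \<le> c * (nsq F \<eta> + nsq F \<zeta>)"
proof -
  obtain e where e: "bij_betw e {..<card F} F"
    using ex_bij_betw_nat_finite[OF F] by (auto simp: atLeast0LessThan)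
  have eF: "e i \<in> F" if "i < card F" for i using e that by (auto simp: bij_betw_def)
  define n where "n = max (card F) M"
  have n: "card F \<le> n" "M \<le> n" by (simp_all add: n_def)
  have sumF: "(\<Sum>i<n. if i < card F then g (e i) else 0) = sum g F" for g :: "'i \<Rightarrow> 'b::comm_monoid_add"
  proof -
    have "(\<Sum>i<n. if i < card F then g (e i) else 0) = (\<Sum>i<card F. g (e i))"
      using n by (intro sum.mono_neutral_cong_right) auto
    then show ?thesis by (simp add: sum.reindex_bij_betw[OF e])
  qed
  have sumM: "(\<Sum>k<n. if k < M then g k else 0) = (\<Sum>k<M. g k)" for g :: "nat \<Rightarrow> 'b::comm_monoid_add"
    using n by (intro sum.mono_neutral_cong_right) auto
  define x' where "x' i k = (if i < card F \<and> k < M then x k (e i) else (\<lambda>v. 0))" for i k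
  define y' where "y' k j = (if j < card F \<and> k < M then y k (e j) else (\<lambda>v. 0))" for k j
  define \<zeta>' where "\<zeta>' i = (if i < card F then \<zeta> (e i) else 0)" for i
  define \<eta>' where "\<eta>' i = (if i < card F then \<eta> (e i) else 0)" for i
  have x'M: "x' \<in> Mn n X" using x eF opspace_zero[OF X] by (auto simp: Mn_def x'_def)
  have y'M: "y' \<in> Mn n Y" using y eF opspace_zero[OF Y] by (auto simp: Mn_def y'_def)
  have nsqF: "nsq {..<n} (\<lambda>i. if i < card F then g (e i) else 0) = nsq F g" for g :: "'i \<Rightarrow> 'b::chilbert"
    using sumF[of "\<lambda>r. (cnorm (g r))\<^sup>2"] by (simp add: nsq_def if_distrib[of cnorm] if_distrib[of "\<lambda>x. x\<^sup>2"] cong: if_cong)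
  have cx': "nsq {..<n} (\<lambda>i. \<Sum>j<n. x' i j (\<xi> j)) \<le> nsq {..<n} \<xi>" for \<xi>
  proof -
    have "(\<Sum>j<n. x' i j (\<xi> j)) = (if i < card F then (\<Sum>k<M. x k (e i) (\<xi> k)) else 0)" for i
      using sumM[of "\<lambda>k. x k (e i) (\<xi> k)"] by (auto simp: x'_def if_distribR cong: if_cong)
    then have "nsq {..<n} (\<lambda>i. \<Sum>j<n. x' i j (\<xi> j)) \<le> nsq {..<M} \<xi>"
      using nsqF[of "\<lambda>r. \<Sum>k<M. x k r (\<xi> k)"] cx[of \<xi>] by simp
    also have "\<dots> \<le> nsq {..<n} \<xi>" unfolding nsq_def using n by (intro sum_mono2) auto
    finally show ?thesis .
  qed
  have cy': "nsq {..<n} (\<lambda>i. \<Sum>j<n. y' i j (\<xi> j)) \<le> nsq {..<n} \<xi>" for \<xi>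
  proof -
    \<comment> \<open>The coordinates of \<xi> below \<open>card F\<close>, transported to F. The
      remaining ones meet only zero columns and are dropped, which costs an inequality at the
      end.\<close>
    define \<xi>' where "\<xi>' r = \<xi> (inv_into {..<card F} e r)" for r
    have \<xi>': "\<xi>' (e i) = \<xi> i" if "i < card F" for i
      using that e by (simp add: \<xi>'_def bij_betw_def)
    have "(\<Sum>j<n. y' i j (\<xi> j)) = (if i < M then (\<Sum>r\<in>F. y i r (\<xi>' r)) else 0)" for i
    proof -
      have "(\<Sum>j<n. y' i j (\<xi> j)) = (if i < M then (\<Sum>j<n. if j < card F then y i (e j) (\<xi>' (e j)) else 0) else 0)"
        using \<xi>' by (auto simp: y'_def if_distribR intro!: sum.cong)
      then show ?thesis using sumF[of "\<lambda>r. y i r (\<xi>' r)"] by simp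
    qed
    then have "nsq {..<n} (\<lambda>i. \<Sum>j<n. y' i j (\<xi> j)) = nsq {..<M} (\<lambda>i. \<Sum>r\<in>F. y i r (\<xi>' r))"
      using sumM[of "\<lambda>i. (cnorm (\<Sum>r\<in>F. y i r (\<xi>' r)))\<^sup>2"]
      by (simp add: nsq_def if_distrib[of cnorm] if_distrib[of "\<lambda>x. x\<^sup>2"] cong: if_cong)
    also have "\<dots> \<le> nsq F \<xi>'" by (rule cy)
    also have "\<dots> = nsq {..<n} (\<lambda>i. if i < card F then \<xi>' (e i) else 0)" by (simp add: nsqF)
    also have "\<dots> \<le> nsq {..<n} \<xi>" unfolding nsq_def by (intro sum_mono) (auto simp: \<xi>')
    finally show ?thesis .
  qed
  have "(\<Sum>i<n. \<Sum>j<n. \<Sum>k<n. cinner (\<phi> (x' i k) (y' k j) (\<zeta>' j)) (\<eta>' i))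
      = (\<Sum>i<n. if i < card F then \<Sum>j<n. if j < card F then \<Sum>k<n. if k < M then
          cinner (\<phi> (x k (e i)) (y k (e j)) (\<zeta> (e j))) (\<eta> (e i)) else 0 else 0 else 0)"
    by (intro sum.cong refl) (auto simp: \<zeta>'_def \<eta>'_def x'_def y'_def \<phi>_zero_left \<phi>_zero_right x y eF opspace_zero[OF X] opspace_zero[OF Y] intro!: sum.cong sum.neutral)
  also have "\<dots> = (\<Sum>r\<in>F. \<Sum>s\<in>F. \<Sum>m<M. cinner (\<phi> (x m r) (y m s) (\<zeta> s)) (\<eta> r))"
    by (simp only: sumM sumF[of "\<lambda>s. \<Sum>m<M. cinner (\<phi> (x m (e _)) (y m s) (\<zeta> s)) (\<eta> (e _))"]
        sumF[of "\<lambda>r. \<Sum>s\<in>F. \<Sum>m<M. cinner (\<phi> (x m r) (y m s) (\<zeta> s)) (\<eta> r)"])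
  finally have "(\<Sum>i<n. \<Sum>j<n. \<Sum>k<n. cinner (\<phi> (x' i k) (y' k j) (\<zeta>' j)) (\<eta>' i)) = \<dots>" .
  moreover have "nsq {..<n} \<zeta>' = nsq F \<zeta>" "nsq {..<n} \<eta>' = nsq F \<eta>"
    unfolding \<zeta>'_def \<eta>'_def by (rule nsqF)+
  ultimately show ?thesis
    using amp_square_bound[OF x'M y'M cx' cy', of \<zeta>' \<eta>'] by simp
qed

end

lemma sum_of_bool_mult:
  "finite I \<Longrightarrow> i \<in> I \<Longrightarrow> (\<Sum>j\<in>I. scaleC (of_bool (j = i)) (f j :: 'a::chilbert)) = f i"
  by (simp add: of_bool_def if_distrib[of "\<lambda>x. scaleC x _"] scaleC_one cong: if_cong)

section \<open>Operator matrices dominated by scalar matrices\<close>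

context cb_bilinear
begin

text \<open>The elements of F serve as matrix indices and as test vectors at once. If a = S S^* and
  b = T T^* with inverses R and U, then x' = R x and y' = y U^* are contractions, and their entries
  stay in X and Y because they are scalar combinations. Bilinearity moves the scalar factors through
  \<phi> onto the vectors, whose squared lengths become the forms of a and b.\<close>

lemma matrix_bound:
  fixes a b :: "'k \<Rightarrow> 'k \<Rightarrow> complex" and M :: nat
  assumes F: "finite F"
    and a: "\<And>\<xi> \<eta>. a \<eta> \<xi> = cnj (a \<xi> \<eta>)" and b: "\<And>\<xi> \<eta>. b \<eta> \<xi> = cnj (b \<xi> \<eta>)"
    and x: "\<And>m \<xi>. m < M \<Longrightarrow> \<xi> \<in> F \<Longrightarrow> x m \<xi> \<in> X" and y: "\<And>m \<xi>. m < M \<Longrightarrow> \<xi> \<in> F \<Longrightarrow> y m \<xi> \<in> Y"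
    and xa: "\<And>h. nsq {..<M} (\<lambda>m. \<Sum>\<xi>\<in>F. adjoint (x m \<xi>) (h \<xi>)) \<le> Re (\<Sum>\<xi>\<in>F. \<Sum>\<eta>\<in>F. a \<xi> \<eta> * cinner (h \<eta>) (h \<xi>))"
    and yb: "\<And>h. nsq {..<M} (\<lambda>m. \<Sum>\<xi>\<in>F. y m \<xi> (h \<xi>)) \<le> Re (\<Sum>\<xi>\<in>F. \<Sum>\<eta>\<in>F. b \<xi> \<eta> * cinner (h \<eta>) (h \<xi>))"
  shows "2 * Re (\<Sum>\<xi>\<in>F. \<Sum>\<eta>\<in>F. \<Sum>m<M. cinner (\<phi> (x m \<xi>) (y m \<eta>) \<eta>) \<xi>)
    \<le> c * (Re (\<Sum>\<xi>\<in>F. \<Sum>\<eta>\<in>F. a \<xi> \<eta> * cinner \<eta> \<xi>) + Re (\<Sum>\<xi>\<in>F. \<Sum>\<eta>\<in>F. b \<xi> \<eta> * cinner \<eta> \<xi>))"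
    (is "?lhs \<le> ?rhs")
proof -
  \<comment> \<open>The hypotheses make a and b only positive semidefinite. Adding e on the diagonal
    gives an invertible Cholesky factor, and e is sent to 0 in the end.\<close>
  define pert where "pert e a \<xi> \<eta> = a \<xi> \<eta> + of_bool (\<xi> = \<eta>) * complex_of_real e" for e and a :: "'k \<Rightarrow> 'k \<Rightarrow> complex" and \<xi> \<eta>
  have pert_form: "(\<Sum>\<xi>\<in>F. \<Sum>\<eta>\<in>F. pert e a \<xi> \<eta> * cinner (h \<eta>) (h \<xi>))
      = (\<Sum>\<xi>\<in>F. \<Sum>\<eta>\<in>F. a \<xi> \<eta> * cinner (h \<eta>) (h \<xi>)) + of_real (e * nsq F h)"
    for e a and h :: "'k \<Rightarrow> 'b::chilbert"
  proof -
    have "(\<Sum>\<xi>\<in>F. \<Sum>\<eta>\<in>F. of_bool (\<xi> = \<eta>) * complex_of_real e * cinner (h \<eta>) (h \<xi>)) = (\<Sum>\<xi>\<in>F. complex_of_real e * cinner (h \<xi>) (h \<xi>))"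
      using F by (intro sum.cong refl) (simp add: of_bool_def if_distrib[of "\<lambda>x. x * _"] cong: if_cong)
    then show ?thesis
      by (simp add: pert_def distrib_right sum.distrib nsq_def cinner_self sum_distrib_left)
  qed
  have chol: "\<exists>S R. (\<forall>i\<in>F. \<forall>j\<in>F. pert e a i j = (\<Sum>r\<in>F. S i r * cnj (S j r)))
    \<and> (\<forall>i\<in>F. \<forall>j\<in>F. (\<Sum>r\<in>F. S i r * R r j) = of_bool (i = j))
    \<and> (\<forall>i\<in>F. \<forall>j\<in>F. (\<Sum>r\<in>F. R i r * S r j) = of_bool (i = j))"
    if herm: "\<And>\<xi> \<eta>. a \<eta> \<xi> = cnj (a \<xi> \<eta>)" and e: "e > 0" and u: "u \<noteq> (0::'b::chilbert)"
      and pos: "\<And>h::'k \<Rightarrow> 'b. 0 \<le> Re (\<Sum>\<xi>\<in>F. \<Sum>\<eta>\<in>F. a \<xi> \<eta> * cinner (h \<eta>) (h \<xi>))" for e a u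
  proof (rule cholesky[OF F])
    show "pert e a j i = cnj (pert e a i j)" for i j
      using herm[of j i] by (auto simp: pert_def)
    show "0 < Re (\<Sum>i\<in>F. \<Sum>j\<in>F. pert e a i j * z j * cnj (z i))" if z: "\<exists>i\<in>F. z i \<noteq> 0" for z
    proof -
      \<comment> \<open>Vectors z i times a fixed nonzero u turn positivity of a \<otimes> 1 into
        positivity of the scalar matrix a.\<close>
      let ?h = "\<lambda>i. scaleC (z i) u"
      have nu: "(cnorm u)\<^sup>2 > 0" using u by simp
      have "0 < nsq F ?h"
        using z F u unfolding nsq_def by (auto simp: cnorm_scaleC intro!: sum_pos2)
      then have "0 < Re (\<Sum>\<xi>\<in>F. \<Sum>\<eta>\<in>F. pert e a \<xi> \<eta> * cinner (?h \<eta>) (?h \<xi>))"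
        unfolding pert_form using pos[of ?h] e by (simp add: add_nonneg_pos)
      also have "(\<Sum>\<xi>\<in>F. \<Sum>\<eta>\<in>F. pert e a \<xi> \<eta> * cinner (?h \<eta>) (?h \<xi>))
          = (\<Sum>i\<in>F. \<Sum>j\<in>F. pert e a i j * z j * cnj (z i)) * of_real ((cnorm u)\<^sup>2)"
        by (simp add: cinner_simps cinner_self sum_distrib_left sum_distrib_right mult_ac)
      finally show ?thesis using nu by (simp add: zero_less_mult_iff)
    qed
  qed
  have pa: "0 \<le> Re (\<Sum>\<xi>\<in>F. \<Sum>\<eta>\<in>F. a \<xi> \<eta> * cinner (h \<eta>) (h \<xi>))" for h :: "'k \<Rightarrow> 'h1"
    using xa[of h] by (rule order_trans[OF nsq_ge0])
  have pb: "0 \<le> Re (\<Sum>\<xi>\<in>F. \<Sum>\<eta>\<in>F. b \<xi> \<eta> * cinner (h \<eta>) (h \<xi>))" for h :: "'k \<Rightarrow> 'h2"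
    using yb[of h] by (rule order_trans[OF nsq_ge0])
  have eps: "?lhs \<le> ?rhs + e * (c * (2 * nsq F (\<lambda>\<xi>. \<xi>)))" if e: "e > 0" for e
  proof -
    obtain S R where S: "\<And>i j. i \<in> F \<Longrightarrow> j \<in> F \<Longrightarrow> pert e a i j = (\<Sum>r\<in>F. S i r * cnj (S j r))"
      and SR: "\<And>i j. i \<in> F \<Longrightarrow> j \<in> F \<Longrightarrow> (\<Sum>r\<in>F. S i r * R r j) = of_bool (i = j)"
      and RS: "\<And>i j. i \<in> F \<Longrightarrow> j \<in> F \<Longrightarrow> (\<Sum>r\<in>F. R i r * S r j) = of_bool (i = j)"
      using chol[OF a e u1 pa] by blast
    obtain T U where T: "\<And>i j. i \<in> F \<Longrightarrow> j \<in> F \<Longrightarrow> pert e b i j = (\<Sum>r\<in>F. T i r * cnj (T j r))"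
      and TU: "\<And>i j. i \<in> F \<Longrightarrow> j \<in> F \<Longrightarrow> (\<Sum>r\<in>F. T i r * U r j) = of_bool (i = j)"
      and UT: "\<And>i j. i \<in> F \<Longrightarrow> j \<in> F \<Longrightarrow> (\<Sum>r\<in>F. U i r * T r j) = of_bool (i = j)"
      using chol[OF b e u2 pb] by blast
    have inv: "(\<Sum>j\<in>F. scaleC (cnj (A j r)) (\<Sum>s\<in>F. scaleC (cnj (B s j)) (k s))) = k r"
      if r: "r \<in> F" and BA: "\<And>s. s \<in> F \<Longrightarrow> (\<Sum>j\<in>F. B s j * A j r) = of_bool (s = r)"
      for A B :: "'k \<Rightarrow> 'k \<Rightarrow> complex" and k :: "'k \<Rightarrow> 'b::chilbert" and r
    proof -
      have "(\<Sum>j\<in>F. scaleC (cnj (A j r)) (\<Sum>s\<in>F. scaleC (cnj (B s j)) (k s)))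
          = (\<Sum>s\<in>F. \<Sum>j\<in>F. scaleC (cnj (B s j * A j r)) (k s))"
        unfolding scaleC_sum_right scaleC_scaleC by (subst sum.swap) (simp add: mult.commute)
      also have "\<dots> = (\<Sum>s\<in>F. scaleC (cnj (\<Sum>j\<in>F. B s j * A j r)) (k s))"
        unfolding cnj_sum scaleC_sum_left ..
      also have "\<dots> = (\<Sum>s\<in>F. scaleC (of_bool (s = r)) (k s))"
        by (intro sum.cong refl) (simp add: BA)
      finally show ?thesis using F r by (simp add: sum_of_bool_mult)
    qed
    define x' where "x' m r = (\<lambda>v. \<Sum>\<xi>\<in>F. scaleC (R r \<xi>) (x m \<xi> v))" for m r
    define y' where "y' m s = (\<lambda>v. \<Sum>\<eta>\<in>F. scaleC (cnj (U s \<eta>)) (y m \<eta> v))" for m s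
    have x': "x' m r \<in> X" if "m < M" for m r
      unfolding x'_def using X x[OF that] by (rule opspace_lincomb)
    have y': "y' m r \<in> Y" if "m < M" for m r
      unfolding y'_def using Y y[OF that] by (rule opspace_lincomb)
    have adj_x': "nsq {..<M} (\<lambda>m. \<Sum>r\<in>F. adjoint (x' m r) (k r)) \<le> nsq F k" for k
    proof -
      define g where "g \<xi> = (\<Sum>r\<in>F. scaleC (cnj (R r \<xi>)) (k r))" for \<xi>
      have "(\<Sum>r\<in>F. adjoint (x' m r) (k r)) = (\<Sum>\<xi>\<in>F. adjoint (x m \<xi>) (g \<xi>))" if m: "m < M" for m
      proof -
        have xB: "x m \<xi> \<in> Bop" if "\<xi> \<in> F" for \<xi> using XB x[OF m that] .
        have "adjoint (x' m r) (k r) = (\<Sum>\<xi>\<in>F. scaleC (cnj (R r \<xi>)) (adjoint (x m \<xi>) (k r)))" for r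
          using adjoint_sum_op[of F "\<lambda>\<xi>. oscale (R r \<xi>) (x m \<xi>)"] xB
          by (simp add: x'_def Bop_oscale adjoint_oscale) (simp add: oscale_def adjoint_oscale[unfolded oscale_def] cong: sum.cong)
        then have "(\<Sum>r\<in>F. adjoint (x' m r) (k r)) = (\<Sum>\<xi>\<in>F. \<Sum>r\<in>F. scaleC (cnj (R r \<xi>)) (adjoint (x m \<xi>) (k r)))"
          by (simp only:) (rule sum.swap)
        then show ?thesis unfolding g_def
          by (simp add: Bop_sum[OF adjoint_Bop[OF xB]] Bop_scale[OF adjoint_Bop[OF xB]] cong: sum.cong)
      qed
      then have "nsq {..<M} (\<lambda>m. \<Sum>r\<in>F. adjoint (x' m r) (k r)) = nsq {..<M} (\<lambda>m. \<Sum>\<xi>\<in>F. adjoint (x m \<xi>) (g \<xi>))"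
        by (simp add: nsq_def)
      also have "\<dots> \<le> Re (\<Sum>\<xi>\<in>F. \<Sum>\<eta>\<in>F. a \<xi> \<eta> * cinner (g \<eta>) (g \<xi>)) + e * nsq F g"
        using xa[of g] e by (simp add: add_increasing2)
      also have "\<dots> = Re (\<Sum>\<xi>\<in>F. \<Sum>\<eta>\<in>F. pert e a \<xi> \<eta> * cinner (g \<eta>) (g \<xi>))"
        unfolding pert_form by simp
      also have "\<dots> = nsq F (\<lambda>r. \<Sum>j\<in>F. scaleC (cnj (S j r)) (g j))"
        using gram_square[of F "pert e a" S g, OF S] by simp
      also have "\<dots> = nsq F k"
        unfolding nsq_def g_def by (intro sum.cong refl) (simp add: inv RS)
      finally show ?thesis .
    qed
    \<comment> \<open>The hypothesis on x concerns adjoints, so contractivity was obtained for the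
      adjoint matrix; a second adjoint returns to x'.\<close>
    have cx': "nsq F (\<lambda>r. \<Sum>m<M. x' m r (\<xi> m)) \<le> nsq {..<M} \<xi>" for \<xi>
    proof -
      have "nsq F (\<lambda>r. \<Sum>m<M. adjoint (adjoint (x' m r)) (\<xi> m)) \<le> nsq {..<M} \<xi>"
        by (rule adjoint_contraction[OF _ adj_x']) (use x' XB in \<open>auto intro: adjoint_Bop\<close>)
      moreover have "adjoint (adjoint (x' m r)) = x' m r" if "m < M" for m r
        using adjoint_adjoint[OF XB[OF x'[OF that]]] .
      ultimately show ?thesis by (simp add: nsq_def)
    qed
    have cy': "nsq {..<M} (\<lambda>m. \<Sum>r\<in>F. y' m r (k r)) \<le> nsq F k" for k
    proof -
      define g where "g \<xi> = (\<Sum>r\<in>F. scaleC (cnj (U r \<xi>)) (k r))" for \<xi>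
      have "(\<Sum>r\<in>F. y' m r (k r)) = (\<Sum>\<xi>\<in>F. y m \<xi> (g \<xi>))" if m: "m < M" for m
      proof -
        have yB: "y m \<xi> \<in> Bop" if "\<xi> \<in> F" for \<xi> using YB y[OF m that] .
        have "(\<Sum>r\<in>F. y' m r (k r)) = (\<Sum>\<xi>\<in>F. \<Sum>r\<in>F. scaleC (cnj (U r \<xi>)) (y m \<xi> (k r)))"
          unfolding y'_def by (rule sum.swap)
        then show ?thesis unfolding g_def
          by (simp add: Bop_sum[OF yB] Bop_scale[OF yB] cong: sum.cong)
      qed
      then have "nsq {..<M} (\<lambda>m. \<Sum>r\<in>F. y' m r (k r)) = nsq {..<M} (\<lambda>m. \<Sum>\<xi>\<in>F. y m \<xi> (g \<xi>))"
        by (simp add: nsq_def)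
      also have "\<dots> \<le> Re (\<Sum>\<xi>\<in>F. \<Sum>\<eta>\<in>F. b \<xi> \<eta> * cinner (g \<eta>) (g \<xi>)) + e * nsq F g"
        using yb[of g] e by (simp add: add_increasing2)
      also have "\<dots> = Re (\<Sum>\<xi>\<in>F. \<Sum>\<eta>\<in>F. pert e b \<xi> \<eta> * cinner (g \<eta>) (g \<xi>))"
        unfolding pert_form by simp
      also have "\<dots> = nsq F (\<lambda>r. \<Sum>j\<in>F. scaleC (cnj (T j r)) (g j))"
        using gram_square[of F "pert e b" T g, OF T] by simp
      also have "\<dots> = nsq F k"
        unfolding nsq_def g_def by (intro sum.cong refl) (simp add: inv UT)
      finally show ?thesis .
    qed
    \<comment> \<open>S^* and T^* applied to the tuple of all elements of F. They cancel against the
      inverse factors inside x' and y', so the value of the form in \<phi> is unchanged.\<close>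
    define \<eta>' where "\<eta>' r = (\<Sum>i\<in>F. scaleC (cnj (S i r)) i)" for r
    define \<zeta>' where "\<zeta>' s = (\<Sum>j\<in>F. scaleC (cnj (T j s)) j)" for s
    have \<eta>'F: "(\<Sum>r\<in>F. scaleC (cnj (R r \<xi>)) (\<eta>' r)) = \<xi>" if "\<xi> \<in> F" for \<xi>
      unfolding \<eta>'_def using that SR by (intro inv) auto
    have \<zeta>'F: "(\<Sum>s\<in>F. scaleC (cnj (U s \<eta>)) (\<zeta>' s)) = \<eta>" if "\<eta> \<in> F" for \<eta>
      unfolding \<zeta>'_def using that TU by (intro inv) auto
    have val: "(\<Sum>r\<in>F. \<Sum>s\<in>F. cinner (\<phi> (x' m r) (y' m s) (\<zeta>' s)) (\<eta>' r))
        = (\<Sum>\<xi>\<in>F. \<Sum>\<eta>\<in>F. cinner (\<phi> (x m \<xi>) (y m \<eta>) \<eta>) \<xi>)" if m: "m < M" for m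
    proof -
      have "(\<Sum>r\<in>F. \<Sum>s\<in>F. cinner (\<phi> (x' m r) (y' m s) (\<zeta>' s)) (\<eta>' r))
        = (\<Sum>r\<in>F. \<Sum>s\<in>F. \<Sum>\<xi>\<in>F. \<Sum>\<eta>\<in>F. R r \<xi> * cnj (U s \<eta>) * cinner (\<phi> (x m \<xi>) (y m \<eta>) (\<zeta>' s)) (\<eta>' r))"
        unfolding x'_def y'_def
        by (simp add: \<phi>_lincomb x[OF m] y[OF m] cinner_sum_left cinner_scaleC_left)
      also have "\<dots> = (\<Sum>r\<in>F. \<Sum>\<xi>\<in>F. \<Sum>s\<in>F. \<Sum>\<eta>\<in>F. R r \<xi> * cnj (U s \<eta>) * cinner (\<phi> (x m \<xi>) (y m \<eta>) (\<zeta>' s)) (\<eta>' r))"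
        by (intro sum.cong refl sum.swap)
      also have "\<dots> = (\<Sum>\<xi>\<in>F. \<Sum>r\<in>F. \<Sum>s\<in>F. \<Sum>\<eta>\<in>F. R r \<xi> * cnj (U s \<eta>) * cinner (\<phi> (x m \<xi>) (y m \<eta>) (\<zeta>' s)) (\<eta>' r))"
        by (rule sum.swap)
      also have "\<dots> = (\<Sum>\<xi>\<in>F. \<Sum>r\<in>F. \<Sum>\<eta>\<in>F. \<Sum>s\<in>F. R r \<xi> * cnj (U s \<eta>) * cinner (\<phi> (x m \<xi>) (y m \<eta>) (\<zeta>' s)) (\<eta>' r))"
        by (intro sum.cong refl sum.swap)
      also have "\<dots> = (\<Sum>\<xi>\<in>F. \<Sum>\<eta>\<in>F. \<Sum>r\<in>F. \<Sum>s\<in>F. R r \<xi> * cnj (U s \<eta>) * cinner (\<phi> (x m \<xi>) (y m \<eta>) (\<zeta>' s)) (\<eta>' r))"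
        by (intro sum.cong refl sum.swap)
      also have "\<dots> = (\<Sum>\<xi>\<in>F. \<Sum>\<eta>\<in>F. cinner (\<phi> (x m \<xi>) (y m \<eta>) (\<Sum>s\<in>F. scaleC (cnj (U s \<eta>)) (\<zeta>' s))) (\<Sum>r\<in>F. scaleC (cnj (R r \<xi>)) (\<eta>' r)))"
      proof (intro sum.cong refl)
        fix \<xi> \<eta> assume "\<xi> \<in> F" "\<eta> \<in> F"
        then have B: "\<phi> (x m \<xi>) (y m \<eta>) \<in> Bop" using m x y by (intro \<phi>B) auto
        show "(\<Sum>r\<in>F. \<Sum>s\<in>F. R r \<xi> * cnj (U s \<eta>) * cinner (\<phi> (x m \<xi>) (y m \<eta>) (\<zeta>' s)) (\<eta>' r))
          = cinner (\<phi> (x m \<xi>) (y m \<eta>) (\<Sum>s\<in>F. scaleC (cnj (U s \<eta>)) (\<zeta>' s))) (\<Sum>r\<in>F. scaleC (cnj (R r \<xi>)) (\<eta>' r))"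
          unfolding Bop_sum[OF B] Bop_scale[OF B] cinner_sum_right unfolding cinner_sum_left cinner_scaleC_left cinner_scaleC_right
          by (simp add: sum_distrib_left mult.assoc)
      qed
      also have "\<dots> = (\<Sum>\<xi>\<in>F. \<Sum>\<eta>\<in>F. cinner (\<phi> (x m \<xi>) (y m \<eta>) \<eta>) \<xi>)"
        by (intro sum.cong refl) (simp add: \<zeta>'F \<eta>'F)
      finally show ?thesis .
    qed
    have swap: "(\<Sum>r\<in>F. \<Sum>s\<in>F. \<Sum>m<M. f r s m) = (\<Sum>m<M. \<Sum>r\<in>F. \<Sum>s\<in>F. f r s m)" for f :: "'k \<Rightarrow> 'k \<Rightarrow> nat \<Rightarrow> complex"
    proof -
      have "(\<Sum>r\<in>F. \<Sum>s\<in>F. \<Sum>m<M. f r s m) = (\<Sum>r\<in>F. \<Sum>m<M. \<Sum>s\<in>F. f r s m)"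
        by (intro sum.cong refl sum.swap)
      also have "\<dots> = (\<Sum>m<M. \<Sum>r\<in>F. \<Sum>s\<in>F. f r s m)" by (rule sum.swap)
      finally show ?thesis .
    qed
    have "(\<Sum>r\<in>F. \<Sum>s\<in>F. \<Sum>m<M. cinner (\<phi> (x' m r) (y' m s) (\<zeta>' s)) (\<eta>' r))
        = (\<Sum>\<xi>\<in>F. \<Sum>\<eta>\<in>F. \<Sum>m<M. cinner (\<phi> (x m \<xi>) (y m \<eta>) \<eta>) \<xi>)"
      unfolding swap by (intro sum.cong refl val) simp
    then have "?lhs \<le> c * (nsq F \<eta>' + nsq F \<zeta>')"
      using amp_rect_bound[OF F, of M x' y' \<zeta>' \<eta>', OF x' y' cx' cy'] by simp
    also have "nsq F \<eta>' = Re (\<Sum>\<xi>\<in>F. \<Sum>\<eta>\<in>F. pert e a \<xi> \<eta> * cinner \<eta> \<xi>)"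
      unfolding \<eta>'_def using gram_square[of F "pert e a" S "\<lambda>\<xi>. \<xi>", OF S] by simp
    also have "nsq F \<zeta>' = Re (\<Sum>\<xi>\<in>F. \<Sum>\<eta>\<in>F. pert e b \<xi> \<eta> * cinner \<eta> \<xi>)"
      unfolding \<zeta>'_def using gram_square[of F "pert e b" T "\<lambda>\<xi>. \<xi>", OF T] by simp
    also have "(\<Sum>\<xi>\<in>F. \<Sum>\<eta>\<in>F. pert e a \<xi> \<eta> * cinner \<eta> \<xi>)
        = (\<Sum>\<xi>\<in>F. \<Sum>\<eta>\<in>F. a \<xi> \<eta> * cinner \<eta> \<xi>) + of_real (e * nsq F (\<lambda>\<xi>. \<xi>))"
      by (rule pert_form)
    also have "(\<Sum>\<xi>\<in>F. \<Sum>\<eta>\<in>F. pert e b \<xi> \<eta> * cinner \<eta> \<xi>)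
        = (\<Sum>\<xi>\<in>F. \<Sum>\<eta>\<in>F. b \<xi> \<eta> * cinner \<eta> \<xi>) + of_real (e * nsq F (\<lambda>\<xi>. \<xi>))"
      by (rule pert_form)
    finally show ?thesis by (simp add: algebra_simps)
  qed
  show ?thesis
  proof (rule field_le_epsilon)
    fix d :: real assume d: "d > 0"
    \<comment> \<open>The summand 1 makes K positive also when all vectors of F vanish, so that the
      perturbation may be chosen as d / K.\<close>
    define K where "K = c * (2 * nsq F (\<lambda>\<xi>. \<xi>)) + 1"
    have K: "K > 0" "c * (2 * nsq F (\<lambda>\<xi>. \<xi>)) \<le> K" using c by (simp_all add: K_def add_nonneg_pos)
    have "?lhs \<le> ?rhs + d / K * (c * (2 * nsq F (\<lambda>\<xi>. \<xi>)))" using d K(1) by (intro eps) simp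
    also have "d / K * (c * (2 * nsq F (\<lambda>\<xi>. \<xi>))) \<le> d / K * K" using d K by (intro mult_left_mono) auto
    finally show "?lhs \<le> ?rhs + d" using K(1) by simp
  qed
qed

end

subsection \<open>Averages of quadratic forms\<close>

text \<open>The form of a scalar matrix at h, written as a weighted sum of squares; the weights r
  may be negative. A list fixes no index set, so adding forms is concatenation, and one list can be
  evaluated at maps into H1, at maps into H2 and at the identity of K.\<close>

definition qf :: "(real \<times> nat \<times> (nat \<Rightarrow> complex) \<times> (nat \<Rightarrow> 'k)) list \<Rightarrow> ('k \<Rightarrow> 'b::chilbert) \<Rightarrow> real" where
  "qf T h = (\<Sum>(r, n, w, z)\<leftarrow>T. r * (cnorm (\<Sum>i<n. scaleC (w i) (h (z i))))\<^sup>2)"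

text \<open>The matrix behind \<open>qf\<close>, indexed by vectors. Positions with the same vector
  z i are merged, because h has one value there.\<close>

definition qmat :: "(real \<times> nat \<times> (nat \<Rightarrow> complex) \<times> (nat \<Rightarrow> 'k)) list \<Rightarrow> 'k \<Rightarrow> 'k \<Rightarrow> complex" where
  "qmat T \<xi> \<eta> = (\<Sum>(r, n, w, z)\<leftarrow>T. complex_of_real r *
     ((\<Sum>i\<in>{i\<in>{..<n}. z i = \<eta>}. w i) * cnj (\<Sum>i\<in>{i\<in>{..<n}. z i = \<xi>}. w i)))"

lemma qf_Nil [simp]: "qf [] h = 0"
  by (simp add: qf_def)

lemma qf_append: "qf (T @ T') h = qf T h + qf T' h"
  by (simp add: qf_def)

lemma qf_single: "qf [(r, n, w, z)] h = r * (cnorm (\<Sum>i<n. scaleC (w i) (h (z i))))\<^sup>2"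
  by (simp add: qf_def)

lemma qf_zero [simp]: "qf T (\<lambda>_. 0) = 0"
  by (induction T) (auto simp: qf_def)

lemma qf_scale: "qf (map (\<lambda>(r, n, w, z). (d * r, n, w, z)) T) h = d * qf T h"
  by (induction T) (auto simp: qf_def algebra_simps)

lemma sum_regroup:
  fixes n :: nat
  assumes "finite F" "z ` {..<n} \<subseteq> F"
  shows "(\<Sum>i<n. g i) = (\<Sum>\<xi>\<in>F. \<Sum>i\<in>{i\<in>{..<n}. z i = \<xi>}. g i)"
  using sum.group[of "{..<n}" F z g] assms by simp

lemma qmat_hermitian: "qmat T \<eta> \<xi> = cnj (qmat T \<xi> \<eta>)"
  by (induction T) (auto simp: qmat_def mult.commute)

lemma qf_qmat:
  assumes F: "finite F" "\<And>r n w z. (r, n, w, z) \<in> set T \<Longrightarrow> z ` {..<n} \<subseteq> F"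
  shows "(\<Sum>\<xi>\<in>F. \<Sum>\<eta>\<in>F. qmat T \<xi> \<eta> * cinner (h \<eta>) (h \<xi>)) = of_real (qf T h)"
  using F(2)
proof (induction T)
  case Nil
  then show ?case by (simp add: qmat_def)
next
  case (Cons t T)
  obtain r n w z where t: "t = (r, n, w, z)" by (cases t)
  define W where "W \<xi> = (\<Sum>i\<in>{i\<in>{..<n}. z i = \<xi>}. w i)" for \<xi>
  have qm: "qmat [t] \<xi> \<eta> = of_real r * (W \<eta> * cnj (W \<xi>))" for \<xi> \<eta>
    by (simp add: qmat_def t W_def)
  have z: "z ` {..<n} \<subseteq> F" using Cons.prems[of r n w z] t by simp
  have "(\<Sum>i<n. scaleC (w i) (h (z i))) = (\<Sum>\<xi>\<in>F. \<Sum>i\<in>{i\<in>{..<n}. z i = \<xi>}. scaleC (w i) (h (z i)))"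
    by (rule sum_regroup[OF F(1) z])
  also have "\<dots> = (\<Sum>\<xi>\<in>F. scaleC (W \<xi>) (h \<xi>))"
    unfolding W_def scaleC_sum_left by (intro sum.cong refl) auto
  finally have "of_real (qf [t] h) = of_real r * cinner (\<Sum>\<eta>\<in>F. scaleC (W \<eta>) (h \<eta>)) (\<Sum>\<xi>\<in>F. scaleC (W \<xi>) (h \<xi>))"
    by (simp add: t qf_single cinner_self)
  also have "\<dots> = (\<Sum>\<xi>\<in>F. \<Sum>\<eta>\<in>F. qmat [t] \<xi> \<eta> * cinner (h \<eta>) (h \<xi>))"
    unfolding cinner_sum_right unfolding cinner_sum_left cinner_scaleC_left cinner_scaleC_right
    by (simp add: sum_distrib_left qm mult_ac)
  finally have 1: "of_real (qf [t] h) = (\<Sum>\<xi>\<in>F. \<Sum>\<eta>\<in>F. qmat [t] \<xi> \<eta> * cinner (h \<eta>) (h \<xi>))" .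
  have 2: "qmat (t # T) \<xi> \<eta> = qmat [t] \<xi> \<eta> + qmat T \<xi> \<eta>" for \<xi> \<eta> by (simp add: qmat_def)
  have "(\<Sum>\<xi>\<in>F. \<Sum>\<eta>\<in>F. qmat T \<xi> \<eta> * cinner (h \<eta>) (h \<xi>)) = of_real (qf T h)"
    by (rule Cons.IH, rule Cons.prems) (rule list.set_intros(2))
  then show ?case
    using 1 qf_append[of "[t]" T h] by (simp add: 2 distrib_right sum.distrib)
qed

text \<open>The forms of x x^* here and of y^* y in \<open>gY\<close>. A list entry carries a column
  of operators x i and a row of operators y i; since h need not be linear, the vectors z i act as
  mere labels.\<close>

definition gX :: "(nat \<times> (nat \<Rightarrow> ('h1::chilbert \<Rightarrow> 'h1)) \<times> (nat \<Rightarrow> ('h2::chilbert \<Rightarrow> 'h2)) \<times> (nat \<Rightarrow> 'k)) list \<Rightarrow> ('k \<Rightarrow> 'h1) \<Rightarrow> real" where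
  "gX L h = (\<Sum>(n, x, y, z)\<leftarrow>L. (cnorm (\<Sum>i<n. adjoint (x i) (h (z i))))\<^sup>2)"

definition gY :: "(nat \<times> (nat \<Rightarrow> ('h1::chilbert \<Rightarrow> 'h1)) \<times> (nat \<Rightarrow> ('h2::chilbert \<Rightarrow> 'h2)) \<times> (nat \<Rightarrow> 'k)) list \<Rightarrow> ('k \<Rightarrow> 'h2) \<Rightarrow> real" where
  "gY L h = (\<Sum>(n, x, y, z)\<leftarrow>L. (cnorm (\<Sum>i<n. y i (h (z i))))\<^sup>2)"

lemma gX_ge0: "0 \<le> gX L h"
  by (auto simp: gX_def intro!: sum_list_nonneg)

lemma gY_ge0: "0 \<le> gY L h"
  by (auto simp: gY_def intro!: sum_list_nonneg)

text \<open>The domain of the average: functions squeezed between forms whose means are prescribed,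
  so that a finite upper bound is available for every one of them.\<close>

definition dominated :: "(('k \<Rightarrow> 'h1::chilbert) \<times> ('k \<Rightarrow> 'h2::chilbert) \<Rightarrow> real) set" where
  "dominated = {g. \<exists>T1 T2. \<forall>h. \<bar>g h\<bar> \<le> qf T1 (fst h) + qf T2 (snd h)}"

lemma dominated_bound:
  fixes n :: nat
  assumes "\<And>h. \<bar>g h\<bar> \<le> C * (\<Sum>i<n. (cnorm (fst h (z i)))\<^sup>2 + (cnorm (snd h (z i)))\<^sup>2)"
  shows "g \<in> dominated"
proof -
  define T :: "(real \<times> nat \<times> (nat \<Rightarrow> complex) \<times> (nat \<Rightarrow> 'a)) list"
    where "T = map (\<lambda>i. (C, 1, \<lambda>_. 1, \<lambda>_. z i)) [0..<n]"
  have T: "qf T h = C * (\<Sum>i<n. (cnorm (h (z i)))\<^sup>2)" for h :: "'a \<Rightarrow> 'e::chilbert"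
    by (simp add: T_def qf_def o_def scaleC_one interv_sum_list_conv_sum_set_nat atLeast0LessThan sum_distrib_left)
  show ?thesis
    unfolding dominated_def
    by (intro CollectI exI[of _ T] allI) (use assms in \<open>simp add: T sum.distrib distrib_left\<close>)
qed

lemma dominated_add: "f \<in> dominated \<Longrightarrow> g \<in> dominated \<Longrightarrow> (\<lambda>h. f h + g h) \<in> dominated"
proof -
  assume "f \<in> dominated" "g \<in> dominated"
  then obtain T1 T2 T1' T2' where T: "\<And>h. \<bar>f h\<bar> \<le> qf T1 (fst h) + qf T2 (snd h)"
    "\<And>h. \<bar>g h\<bar> \<le> qf T1' (fst h) + qf T2' (snd h)" unfolding dominated_def by blast
  have "\<bar>f h + g h\<bar> \<le> qf (T1 @ T1') (fst h) + qf (T2 @ T2') (snd h)" for h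
    using T(1)[of h] T(2)[of h] abs_triangle_ineq[of "f h" "g h"] by (simp add: qf_append)
  then show ?thesis unfolding dominated_def by blast
qed

lemma dominated_scale: "f \<in> dominated \<Longrightarrow> (\<lambda>h. d * f h) \<in> dominated"
proof -
  assume "f \<in> dominated"
  then obtain T1 T2 where T: "\<And>h. \<bar>f h\<bar> \<le> qf T1 (fst h) + qf T2 (snd h)" unfolding dominated_def by blast
  let ?T = "\<lambda>T. map (\<lambda>(r, n, w, z). (\<bar>d\<bar> * r, n, w, z)) T"
  have "\<bar>d * f h\<bar> \<le> qf (?T T1) (fst h) + qf (?T T2) (snd h)" for h
    unfolding qf_scale using mult_left_mono[OF T[of h] abs_ge_zero[of d]] by (simp add: abs_mult distrib_left)
  then show ?thesis unfolding dominated_def by blast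
qed

lemma cnorm_sum_power2_le:
  fixes n :: nat
  shows "(cnorm (\<Sum>i<n. v i))\<^sup>2 \<le> real n * (\<Sum>i<n. (cnorm (v i :: 'a::chilbert))\<^sup>2)"
proof -
  have "(cnorm (\<Sum>i<n. v i))\<^sup>2 \<le> (\<Sum>i<n. cnorm (v i))\<^sup>2"
    by (intro power_mono cnorm_sum_le) simp
  also have "\<dots> \<le> (\<Sum>i<n. (cnorm (v i))\<^sup>2) * card {..<n}"
    by (rule sum_squared_le_sum_of_squares)
  finally show ?thesis by (simp add: mult.commute)
qed

lemma cnorm_sum_op_bound:
  fixes n :: nat
  assumes "\<And>i. T i \<in> Bop"
  shows "\<exists>C\<ge>0. \<forall>v. (cnorm (\<Sum>i<n. T i (v i)))\<^sup>2 \<le> C * (\<Sum>i<n. (cnorm (v i))\<^sup>2)"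
proof -
  obtain D where D: "\<And>i. D i > 0" "\<And>i x. cnorm (T i x) \<le> D i * cnorm x" using Bop_bound[OF assms] by metis
  define E where "E = (\<Sum>i<n. (D i)\<^sup>2)"
  have E: "0 \<le> E" by (simp add: E_def sum_nonneg)
  have DE: "(D i)\<^sup>2 \<le> E" if "i < n" for i unfolding E_def using that by (intro member_le_sum) auto
  have "(cnorm (\<Sum>i<n. T i (v i)))\<^sup>2 \<le> (real n * E) * (\<Sum>i<n. (cnorm (v i))\<^sup>2)" for v
  proof -
    have "(\<Sum>i<n. (cnorm (T i (v i)))\<^sup>2) \<le> (\<Sum>i<n. E * (cnorm (v i))\<^sup>2)"
    proof (intro sum_mono)
      fix i assume "i \<in> {..<n}"
      have "(cnorm (T i (v i)))\<^sup>2 \<le> (D i * cnorm (v i))\<^sup>2" using D by (intro power_mono) auto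
      also have "\<dots> \<le> E * (cnorm (v i))\<^sup>2"
        unfolding power_mult_distrib using DE \<open>i \<in> {..<n}\<close> by (intro mult_right_mono) auto
      finally show "(cnorm (T i (v i)))\<^sup>2 \<le> E * (cnorm (v i))\<^sup>2" .
    qed
    then have "real n * (\<Sum>i<n. (cnorm (T i (v i)))\<^sup>2) \<le> real n * (E * (\<Sum>i<n. (cnorm (v i))\<^sup>2))"
      by (intro mult_left_mono) (auto simp: sum_distrib_left)
    then show ?thesis using cnorm_sum_power2_le[of "\<lambda>i. T i (v i)" n] by (simp add: mult.assoc)
  qed
  then show ?thesis using E by (intro exI[of _ "real n * E"]) auto
qed

text \<open>The evaluation \<open>ev\<close> is a parameter because the construction serves both
  coordinates of a pair of maps. The geometry of K is tied to the average by \<open>s_ev\<close>,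
  and \<open>V_ev\<close> ensures that every function controlled by finitely many squared values can
  be averaged.\<close>

locale averaging =
  fixes V :: "('z \<Rightarrow> real) set" and s :: "('z \<Rightarrow> real) \<Rightarrow> real"
    and ev :: "'z \<Rightarrow> 'k::chilbert \<Rightarrow> 'b::chilbert" and c :: real
  assumes V_add: "\<And>f g. f \<in> V \<Longrightarrow> g \<in> V \<Longrightarrow> (\<lambda>h. f h + g h) \<in> V"
    and V_scale: "\<And>d f. f \<in> V \<Longrightarrow> (\<lambda>h. d * f h) \<in> V"
    and s_add: "\<And>f g. f \<in> V \<Longrightarrow> g \<in> V \<Longrightarrow> s (\<lambda>h. f h + g h) = s f + s g"
    and s_scale: "\<And>d f. f \<in> V \<Longrightarrow> s (\<lambda>h. d * f h) = d * s f"
    and s_pos: "\<And>f. f \<in> V \<Longrightarrow> (\<And>h. 0 \<le> f h) \<Longrightarrow> 0 \<le> s f"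
    and V_ev: "\<And>(n::nat) z g C. (\<And>h. \<bar>g h\<bar> \<le> C * (\<Sum>i<n. (cnorm (ev h (z i)))\<^sup>2)) \<Longrightarrow> g \<in> V"
    and s_ev: "\<And>(n::nat) w z. s (\<lambda>h. (cnorm (\<Sum>i<n. scaleC (w i) (ev h (z i))))\<^sup>2) = c * (cnorm (\<Sum>i<n. scaleC (w i) (z i)))\<^sup>2"
    and c_ge0: "0 \<le> c"
begin

lemma V_minus: "f \<in> V \<Longrightarrow> (\<lambda>h. - f h) \<in> V"
  using V_scale[of f "-1"] by simp

lemma s_minus: "f \<in> V \<Longrightarrow> s (\<lambda>h. - f h) = - s f"
  using s_scale[of f "-1"] by simp

lemma V_diff: "f \<in> V \<Longrightarrow> g \<in> V \<Longrightarrow> (\<lambda>h. f h - g h) \<in> V"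
  using V_add[OF _ V_minus, of f g] by simp

lemma s_diff: "f \<in> V \<Longrightarrow> g \<in> V \<Longrightarrow> s (\<lambda>h. f h - g h) = s f - s g"
  using s_add[OF _ V_minus, of f g] by (simp add: s_minus)

lemma s_mono: "f \<in> V \<Longrightarrow> g \<in> V \<Longrightarrow> (\<And>h. f h \<le> g h) \<Longrightarrow> s f \<le> s g"
  using s_pos[OF V_diff, of g f] by (simp add: s_diff)

lemma s_abs_le:
  assumes "f \<in> V" "g \<in> V" "\<And>h. \<bar>f h\<bar> \<le> g h"
  shows "\<bar>s f\<bar> \<le> s g"
proof -
  have "f h \<le> g h" "- f h \<le> g h" for h using assms(3)[of h] by linarith+
  then show ?thesis using s_mono[OF assms(1,2)] s_mono[OF V_minus[OF assms(1)] assms(2)] s_minus[OF assms(1)] by fastforce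
qed

lemma V_zero: "(\<lambda>h. 0) \<in> V"
  by (rule V_ev[where C = 0]) simp

lemma s_zero: "s (\<lambda>h. 0) = 0"
  using s_scale[OF V_zero, of 0] by simp

lemma V_sum: "(\<And>i. i \<in> I \<Longrightarrow> f i \<in> V) \<Longrightarrow> (\<lambda>h. \<Sum>i\<in>I. f i h) \<in> V"
  by (induction I rule: infinite_finite_induct) (auto intro: V_zero V_add)

lemma s_sum: "(\<And>i. i \<in> I \<Longrightarrow> f i \<in> V) \<Longrightarrow> s (\<lambda>h. \<Sum>i\<in>I. f i h) = (\<Sum>i\<in>I. s (f i))"
  by (induction I rule: infinite_finite_induct) (auto simp: s_zero s_add V_sum)

lemma ev_sq: "(\<lambda>h. (cnorm (ev h \<xi>))\<^sup>2) \<in> V" "s (\<lambda>h. (cnorm (ev h \<xi>))\<^sup>2) = c * (cnorm \<xi>)\<^sup>2"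
proof -
  show "(\<lambda>h. (cnorm (ev h \<xi>))\<^sup>2) \<in> V"
    by (rule V_ev[where C = 1 and n = 1 and z = "\<lambda>_. \<xi>"]) simp
  show "s (\<lambda>h. (cnorm (ev h \<xi>))\<^sup>2) = c * (cnorm \<xi>)\<^sup>2"
    using s_ev[where n = 1 and w = "\<lambda>_. 1" and z = "\<lambda>_. \<xi>"] by (simp add: scaleC_one)
qed

lemma V_sum_op:
  fixes n :: nat
  assumes "\<And>i. i < n \<Longrightarrow> S i \<in> Bop"
  shows "(\<lambda>h. (cnorm (\<Sum>i<n. S i (ev h (z i))))\<^sup>2) \<in> V"
proof -
  define S' where "S' i = (if i < n then S i else (\<lambda>v. 0))" for i
  have "S' i \<in> Bop" for i using assms by (simp add: S'_def Bop_0)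
  from cnorm_sum_op_bound[of S', OF this, of n] obtain C
    where C: "C \<ge> 0" "\<And>v. (cnorm (\<Sum>i<n. S' i (v i)))\<^sup>2 \<le> C * (\<Sum>i<n. (cnorm (v i))\<^sup>2)"
    by blast
  have "(\<Sum>i<n. S' i (v i)) = (\<Sum>i<n. S i (v i))" for v by (simp add: S'_def)
  then show ?thesis using C(2) by (intro V_ev[where C = C and n = n and z = z]) simp
qed

definition sC :: "('z \<Rightarrow> complex) \<Rightarrow> complex" where
  "sC f = Complex (s (\<lambda>h. Re (f h))) (s (\<lambda>h. Im (f h)))"

definition VC :: "('z \<Rightarrow> complex) set" where
  "VC = {f. (\<lambda>h. Re (f h)) \<in> V \<and> (\<lambda>h. Im (f h)) \<in> V}"

lemma sC_add: "f \<in> VC \<Longrightarrow> g \<in> VC \<Longrightarrow> sC (\<lambda>h. f h + g h) = sC f + sC g"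
  by (simp add: sC_def VC_def s_add complex_eq_iff)

lemma VC_add: "f \<in> VC \<Longrightarrow> g \<in> VC \<Longrightarrow> (\<lambda>h. f h + g h) \<in> VC"
  by (simp add: VC_def V_add)

lemma VC_scale: "f \<in> VC \<Longrightarrow> (\<lambda>h. a * f h) \<in> VC"
  by (simp add: VC_def V_add V_diff V_scale)

lemma sC_scale: "f \<in> VC \<Longrightarrow> sC (\<lambda>h. a * f h) = a * sC f"
  by (simp add: sC_def VC_def s_add s_diff s_scale V_scale complex_eq_iff)

lemma VC_zero: "(\<lambda>h. 0) \<in> VC"
  by (simp add: VC_def V_zero)

lemma sC_zero: "sC (\<lambda>h. 0) = 0"
  by (simp add: sC_def s_zero complex_eq_iff)

lemma VC_sum: "(\<And>i. i \<in> I \<Longrightarrow> f i \<in> VC) \<Longrightarrow> (\<lambda>h. \<Sum>i\<in>I. f i h) \<in> VC"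
  by (induction I rule: infinite_finite_induct) (auto intro: VC_zero VC_add)

lemma sC_sum: "(\<And>i. i \<in> I \<Longrightarrow> f i \<in> VC) \<Longrightarrow> sC (\<lambda>h. \<Sum>i\<in>I. f i h) = (\<Sum>i\<in>I. sC (f i))"
  by (induction I rule: infinite_finite_induct) (auto simp: sC_zero sC_add VC_sum)

lemma sC_cnj: "f \<in> VC \<Longrightarrow> sC (\<lambda>h. cnj (f h)) = cnj (sC f)"
  by (simp add: sC_def VC_def s_minus complex_eq_iff)

lemma sC_of_real: "sC (\<lambda>h. of_real (f h)) = of_real (s f)"
  by (simp add: sC_def s_zero complex_eq_iff)

text \<open>Real and imaginary part are estimated separately. The factor 2 is harmless, since the
  lemma serves to prove boundedness and vanishing, not sharp norms.\<close>

lemma norm_sC_le: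
  assumes "f \<in> VC" "g \<in> V" "\<And>h. norm (f h) \<le> g h"
  shows "norm (sC f) \<le> 2 * s g"
proof -
  have "\<bar>Re (f h)\<bar> \<le> g h" "\<bar>Im (f h)\<bar> \<le> g h" for h
    using assms(3)[of h] abs_Re_le_cmod[of "f h"] abs_Im_le_cmod[of "f h"] by linarith+
  then have "\<bar>Re (sC f)\<bar> \<le> s g" "\<bar>Im (sC f)\<bar> \<le> s g"
    using assms(1,2) by (auto simp: sC_def VC_def intro!: s_abs_le)
  then show ?thesis using cmod_le[of "sC f"] by linarith
qed

text \<open>The matrix coefficient of h^* S^* T h at \<xi> and \<eta>, if h were linear; its mean is
  the coefficient of \<open>avg S T\<close>. Keeping S and T apart makes the adjoint a swap of the
  two and the positivity for S = T visible.\<close>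

definition form :: "('b \<Rightarrow> 'b) \<Rightarrow> ('b \<Rightarrow> 'b) \<Rightarrow> 'k \<Rightarrow> 'k \<Rightarrow> 'z \<Rightarrow> complex" where
  "form S T \<xi> \<eta> h = cinner (T (ev h \<xi>)) (S (ev h \<eta>))"

lemma form_bound:
  assumes "S \<in> Bop" "T \<in> Bop"
  shows "\<exists>C\<ge>0. \<forall>h \<xi> \<eta>. norm (form S T \<xi> \<eta> h) \<le> C * ((cnorm (ev h \<xi>))\<^sup>2 + (cnorm (ev h \<eta>))\<^sup>2)"
proof -
  obtain C D where C: "C > 0" "\<And>x. cnorm (S x) \<le> C * cnorm x" and D: "D > 0" "\<And>x. cnorm (T x) \<le> D * cnorm x"
    using Bop_bound[OF assms(1)] Bop_bound[OF assms(2)] by blast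
  have "norm (form S T \<xi> \<eta> h) \<le> (C\<^sup>2 + D\<^sup>2) * ((cnorm (ev h \<xi>))\<^sup>2 + (cnorm (ev h \<eta>))\<^sup>2)" for h \<xi> \<eta>
  proof -
    have "2 * norm (form S T \<xi> \<eta> h) \<le> (cnorm (T (ev h \<xi>)))\<^sup>2 + (cnorm (S (ev h \<eta>)))\<^sup>2"
      unfolding form_def by (rule two_norm_cinner_le)
    also have "\<dots> \<le> (D * cnorm (ev h \<xi>))\<^sup>2 + (C * cnorm (ev h \<eta>))\<^sup>2"
      using C D by (intro add_mono power_mono) auto
    finally have "norm (form S T \<xi> \<eta> h) \<le> (D * cnorm (ev h \<xi>))\<^sup>2 + (C * cnorm (ev h \<eta>))\<^sup>2"
      using norm_ge_zero[of "form S T \<xi> \<eta> h"] by linarith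
    also have "\<dots> \<le> (C\<^sup>2 + D\<^sup>2) * ((cnorm (ev h \<xi>))\<^sup>2 + (cnorm (ev h \<eta>))\<^sup>2)"
      by (simp add: power_mult_distrib algebra_simps)
    finally show ?thesis .
  qed
  then show ?thesis by (intro exI[of _ "C\<^sup>2 + D\<^sup>2"]) auto
qed

lemma ev_sq2: "(\<lambda>h. C * ((cnorm (ev h \<xi>))\<^sup>2 + (cnorm (ev h \<eta>))\<^sup>2)) \<in> V"
  "s (\<lambda>h. C * ((cnorm (ev h \<xi>))\<^sup>2 + (cnorm (ev h \<eta>))\<^sup>2)) = C * (c * (cnorm \<xi>)\<^sup>2 + c * (cnorm \<eta>)\<^sup>2)"
  by (simp_all add: V_scale V_add ev_sq s_scale s_add)

lemma form_VC:
  assumes "S \<in> Bop" "T \<in> Bop"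
  shows "form S T \<xi> \<eta> \<in> VC"
proof -
  obtain C where C: "\<And>h \<xi> \<eta>. norm (form S T \<xi> \<eta> h) \<le> C * ((cnorm (ev h \<xi>))\<^sup>2 + (cnorm (ev h \<eta>))\<^sup>2)"
    using form_bound[OF assms] by blast
  let ?z = "\<lambda>i::nat. if i = 0 then \<xi> else \<eta>"
  have *: "\<bar>Re (form S T \<xi> \<eta> h)\<bar> \<le> C * (\<Sum>i<2. (cnorm (ev h (?z i)))\<^sup>2)"
    "\<bar>Im (form S T \<xi> \<eta> h)\<bar> \<le> C * (\<Sum>i<2. (cnorm (ev h (?z i)))\<^sup>2)" for h
    using C[of \<xi> \<eta> h] abs_Re_le_cmod[of "form S T \<xi> \<eta> h"] abs_Im_le_cmod[of "form S T \<xi> \<eta> h"]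
    by (simp_all add: numeral_2_eq_2)
  show ?thesis using V_ev[OF *(1)] V_ev[OF *(2)] by (simp add: VC_def)
qed

text \<open>The maps \<open>ev h\<close> are not linear, but their linearity defects vanish in the mean.\<close>
lemma sC_form_null:
  fixes n :: nat
  assumes S: "S \<in> Bop" and T: "T \<in> Bop" and null: "(\<Sum>i<n. scaleC (w i) (z i)) = 0"
  shows "(\<Sum>i<n. w i * sC (form S T (z i) \<eta>)) = 0"
proof -
  obtain C D where C: "C > 0" "\<And>x. cnorm (S x) \<le> C * cnorm x" and D: "D > 0" "\<And>x. cnorm (T x) \<le> D * cnorm x"
    using Bop_bound[OF S] Bop_bound[OF T] by blast
  define u where "u h = (\<Sum>i<n. scaleC (w i) (ev h (z i)))" for h
  define f where "f h = (\<Sum>i<n. w i * form S T (z i) \<eta> h)" for h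
  have f_eq: "f h = cinner (T (u h)) (S (ev h \<eta>))" for h
    by (simp add: f_def u_def form_def Bop_sum[OF T] Bop_scale[OF T] cinner_sum_left cinner_scaleC_left)
  have fV: "f \<in> VC" unfolding f_def by (intro VC_sum VC_scale form_VC S T)
  have uV: "(\<lambda>h. (cnorm (u h))\<^sup>2) \<in> V"
    using V_sum_op[of n "\<lambda>i. oscale (w i) (\<lambda>v. v)" z] by (simp add: u_def Bop_oscale Bop_id) (simp add: oscale_def)
  have su: "s (\<lambda>h. (cnorm (u h))\<^sup>2) = 0" unfolding u_def using s_ev null by simp
  define B where "B = 2 * (D * C * (c * (cnorm \<eta>)\<^sup>2))"
  have B: "B \<ge> 0" using C D c_ge0 by (simp add: B_def)
  \<comment> \<open>Cauchy-Schwarz with weight t: the summand with t has mean zero, because the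
    combination of the z i vanishes, and the other summand is of order 1 / t.\<close>
  have small: "norm (sC f) \<le> B / t" if t: "t > 0" for t
  proof -
    let ?g = "\<lambda>h. (D * C) * (t * (cnorm (u h))\<^sup>2 + (1 / t) * (cnorm (ev h \<eta>))\<^sup>2)"
    have "norm (f h) \<le> ?g h" for h
    proof -
      have "norm (f h) \<le> cnorm (T (u h)) * cnorm (S (ev h \<eta>))" unfolding f_eq by (rule cauchy_schwarz)
      also have "\<dots> \<le> (D * cnorm (u h)) * (C * cnorm (ev h \<eta>))" using C D by (intro mult_mono) auto
      also have "\<dots> = (D * C) * (cnorm (u h) * cnorm (ev h \<eta>))" by simp
      also have "cnorm (u h) * cnorm (ev h \<eta>) \<le> t * (cnorm (u h))\<^sup>2 + (1 / t) * (cnorm (ev h \<eta>))\<^sup>2"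
      proof -
        have "0 \<le> (t * cnorm (u h) - cnorm (ev h \<eta>))\<^sup>2" by simp
        then have "2 * t * (cnorm (u h) * cnorm (ev h \<eta>)) \<le> t\<^sup>2 * (cnorm (u h))\<^sup>2 + (cnorm (ev h \<eta>))\<^sup>2"
          by (simp add: power2_diff power_mult_distrib)
        moreover have "t * (cnorm (u h) * cnorm (ev h \<eta>)) \<le> 2 * t * (cnorm (u h) * cnorm (ev h \<eta>))"
          using t by simp
        ultimately have "t * (cnorm (u h) * cnorm (ev h \<eta>)) \<le> t\<^sup>2 * (cnorm (u h))\<^sup>2 + (cnorm (ev h \<eta>))\<^sup>2"
          by linarith
        then show ?thesis using t by (simp add: field_simps power2_eq_square)
      qed
      finally show ?thesis using C D by (simp add: mult_left_mono)
    qed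
    then have "norm (sC f) \<le> 2 * s ?g"
      by (intro norm_sC_le fV V_scale V_add uV ev_sq(1))
    also have "s ?g = (D * C) * (t * 0 + (1 / t) * (c * (cnorm \<eta>)\<^sup>2))"
      by (subst s_scale, intro V_add V_scale uV ev_sq(1), subst s_add, intro V_scale uV, intro V_scale ev_sq(1))
        (simp only: s_scale[OF uV] s_scale[OF ev_sq(1)] su ev_sq(2))
    finally show ?thesis by (simp add: B_def)
  qed
  have "sC f = 0"
  proof (rule ccontr)
    assume "sC f \<noteq> 0"
    then have n: "norm (sC f) > 0" by simp
    have "norm (sC f) \<le> B / ((B + 1) / norm (sC f))" using B n by (intro small) simp
    also have "\<dots> = norm (sC f) * (B / (B + 1))" by simp
    also have "\<dots> < norm (sC f) * 1" using B n by (intro mult_strict_left_mono) auto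
    finally show False by simp
  qed
  moreover have "sC f = (\<Sum>i<n. w i * sC (form S T (z i) \<eta>))"
    unfolding f_def by (simp add: sC_sum VC_scale form_VC S T sC_scale)
  ultimately show ?thesis by simp
qed

lemma sC_form_swap: "S \<in> Bop \<Longrightarrow> T \<in> Bop \<Longrightarrow> sC (form S T \<xi> \<eta>) = cnj (sC (form T S \<eta> \<xi>))"
proof -
  assume "S \<in> Bop" "T \<in> Bop"
  have "form S T \<xi> \<eta> = (\<lambda>h. cnj (form T S \<eta> \<xi> h))"
    unfolding form_def by (intro ext) (rule cinner_commute)
  then show ?thesis using sC_cnj[OF form_VC[OF \<open>T \<in> Bop\<close> \<open>S \<in> Bop\<close>]] by simp
qed

text \<open>Linearity in \<xi> is the vanishing of means for the trivial relations among \<xi> +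
  \<xi>', \<xi>, \<xi>' and among a vector and its multiple. Conjugate linearity in \<eta> follows
  by exchanging S and T.\<close>

lemma avg_ex:
  assumes S: "S \<in> Bop" and T: "T \<in> Bop"
  shows "\<exists>A\<in>Bop. \<forall>\<xi> \<eta>. cinner (A \<xi>) \<eta> = sC (form S T \<xi> \<eta>)"
proof -
  obtain C where C: "\<And>h \<xi> \<eta>. norm (form S T \<xi> \<eta> h) \<le> C * ((cnorm (ev h \<xi>))\<^sup>2 + (cnorm (ev h \<eta>))\<^sup>2)"
    using form_bound[OF S T] by blast
  have add: "sC (form S T (\<xi> + \<xi>') \<eta>) = sC (form S T \<xi> \<eta>) + sC (form S T \<xi>' \<eta>)"
    if "S \<in> Bop" "T \<in> Bop" for S T \<xi> \<xi>' \<eta>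
    using sC_form_null[OF that, where n = 3 and w = "\<lambda>i. if i = 0 then 1 else -1"
        and z = "\<lambda>i. if i = 0 then \<xi> + \<xi>' else if i = 1 then \<xi> else \<xi>'" and \<eta> = \<eta>]
    by (simp add: numeral_3_eq_3 scaleC_one scaleC_minus_left algebra_simps)
  have scale: "sC (form S T (scaleC d \<xi>) \<eta>) = d * sC (form S T \<xi> \<eta>)"
    if "S \<in> Bop" "T \<in> Bop" for S T d \<xi> \<eta>
    using sC_form_null[OF that, where n = 2 and w = "\<lambda>i. if i = 0 then 1 else - d"
        and z = "\<lambda>i. if i = 0 then scaleC d \<xi> else \<xi>" and \<eta> = \<eta>]
    by (simp add: numeral_2_eq_2 scaleC_one scaleC_minus_left)
  show ?thesis
  proof (rule sesquilinear_operator[where C = "2 * C * c"])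
    show "sC (form S T (x + y) z) = sC (form S T x z) + sC (form S T y z)" for x y z
      by (rule add[OF S T])
    show "sC (form S T (scaleC d x) z) = d * sC (form S T x z)" for d x z
      by (rule scale[OF S T])
    show "sC (form S T x (y + z)) = sC (form S T x y) + sC (form S T x z)" for x y z
      by (simp add: sC_form_swap[OF S T] add[OF T S])
    show "sC (form S T x (scaleC d z)) = cnj d * sC (form S T x z)" for d x z
      by (simp add: sC_form_swap[OF S T] scale[OF T S])
    show "norm (sC (form S T x y)) \<le> 2 * C * c * ((cnorm x)\<^sup>2 + (cnorm y)\<^sup>2)" for x y
      using norm_sC_le[OF form_VC[OF S T] ev_sq2(1) C] unfolding ev_sq2(2) by (simp add: algebra_simps)
  qed
qed

definition avg :: "('b \<Rightarrow> 'b) \<Rightarrow> ('b \<Rightarrow> 'b) \<Rightarrow> ('k \<Rightarrow> 'k)" where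
  "avg S T = (SOME A. A \<in> Bop \<and> (\<forall>\<xi> \<eta>. cinner (A \<xi>) \<eta> = sC (form S T \<xi> \<eta>)))"

lemma
  assumes "S \<in> Bop" "T \<in> Bop"
  shows avg_Bop: "avg S T \<in> Bop" and cinner_avg: "cinner (avg S T \<xi>) \<eta> = sC (form S T \<xi> \<eta>)"
proof -
  have "\<exists>A. A \<in> Bop \<and> (\<forall>\<xi> \<eta>. cinner (A \<xi>) \<eta> = sC (form S T \<xi> \<eta>))" using avg_ex[OF assms] by blast
  from someI_ex[OF this] show "avg S T \<in> Bop" "cinner (avg S T \<xi>) \<eta> = sC (form S T \<xi> \<eta>)"
    unfolding avg_def by blast+
qed

lemma avg_oadd_right: "S \<in> Bop \<Longrightarrow> T \<in> Bop \<Longrightarrow> T' \<in> Bop \<Longrightarrow> avg S (oadd T T') = oadd (avg S T) (avg S T')"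
proof (rule Bop_eqI)
  fix \<xi> \<eta> assume B: "S \<in> Bop" "T \<in> Bop" "T' \<in> Bop"
  have "form S (oadd T T') \<xi> \<eta> = (\<lambda>h. form S T \<xi> \<eta> h + form S T' \<xi> \<eta> h)"
    by (auto simp: form_def oadd_def cinner_simps)
  then show "cinner (avg S (oadd T T') \<xi>) \<eta> = cinner (oadd (avg S T) (avg S T') \<xi>) \<eta>"
    using B by (simp add: cinner_avg Bop_oadd sC_add form_VC) (simp add: oadd_def cinner_simps cinner_avg B)
qed

lemma avg_oscale_right: "S \<in> Bop \<Longrightarrow> T \<in> Bop \<Longrightarrow> avg S (oscale d T) = oscale d (avg S T)"
proof (rule Bop_eqI)
  fix \<xi> \<eta> assume B: "S \<in> Bop" "T \<in> Bop"
  have "form S (oscale d T) \<xi> \<eta> = (\<lambda>h. d * form S T \<xi> \<eta> h)"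
    by (auto simp: form_def oscale_def cinner_simps)
  then show "cinner (avg S (oscale d T) \<xi>) \<eta> = cinner (oscale d (avg S T) \<xi>) \<eta>"
    using B by (simp add: cinner_avg Bop_oscale sC_scale form_VC) (simp add: oscale_def cinner_simps cinner_avg B)
qed

lemma adjoint_avg: "S \<in> Bop \<Longrightarrow> T \<in> Bop \<Longrightarrow> adjoint (avg S T) = avg T S"
  by (rule adjoint_eqI[OF avg_Bop])
    (simp_all add: cinner_avg sC_form_swap[of S T] cinner_commute[of _ "avg T S _"])

lemma avg_oadd_left: "S \<in> Bop \<Longrightarrow> S' \<in> Bop \<Longrightarrow> T \<in> Bop \<Longrightarrow> avg (oadd S S') T = oadd (avg S T) (avg S' T)"
  using arg_cong[OF avg_oadd_right[of T S S'], of adjoint]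
  by (simp add: adjoint_avg adjoint_oadd avg_Bop Bop_oadd)

lemma avg_oscale_left: "S \<in> Bop \<Longrightarrow> T \<in> Bop \<Longrightarrow> avg (oscale d S) T = oscale (cnj d) (avg S T)"
  using arg_cong[OF avg_oscale_right[of T S d], of adjoint]
  by (simp add: adjoint_avg adjoint_oscale avg_Bop Bop_oscale)

lemma avg_zero_left: "T \<in> Bop \<Longrightarrow> avg (\<lambda>v. 0) T = (\<lambda>v. 0)"
  using avg_oscale_left[OF Bop_0, of T 0] by (simp add: oscale_def)

lemma avg_zero_right: "S \<in> Bop \<Longrightarrow> avg S (\<lambda>v. 0) = (\<lambda>v. 0)"
  using avg_oscale_right[OF _ Bop_0, of S 0] by (simp add: oscale_def)

text \<open>For every single h the double sum is the square of a norm. Hence \<open>avg\<close> is a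
  positive definite kernel on bounded operators.\<close>

lemma avg_form:
  fixes n :: nat
  assumes S: "\<And>i. i < n \<Longrightarrow> S i \<in> Bop"
  shows "(\<Sum>i<n. \<Sum>j<n. cinner (avg (S i) (S j) (z j)) (z i)) = of_real (s (\<lambda>h. (cnorm (\<Sum>i<n. S i (ev h (z i))))\<^sup>2))"
proof -
  have "(\<Sum>i<n. \<Sum>j<n. cinner (avg (S i) (S j) (z j)) (z i)) = sC (\<lambda>h. \<Sum>i<n. \<Sum>j<n. form (S i) (S j) (z j) (z i) h)"
  proof -
    have "sC (\<lambda>h. \<Sum>i<n. \<Sum>j<n. form (S i) (S j) (z j) (z i) h) = (\<Sum>i<n. sC (\<lambda>h. \<Sum>j<n. form (S i) (S j) (z j) (z i) h))"
      using S by (intro sC_sum VC_sum form_VC) auto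
    also have "\<dots> = (\<Sum>i<n. \<Sum>j<n. sC (form (S i) (S j) (z j) (z i)))"
      using S by (intro sum.cong refl sC_sum form_VC) auto
    finally show ?thesis using S by (simp add: cinner_avg)
  qed
  also have "(\<lambda>h. \<Sum>i<n. \<Sum>j<n. form (S i) (S j) (z j) (z i) h) = (\<lambda>h. of_real ((cnorm (\<Sum>i<n. S i (ev h (z i))))\<^sup>2))"
    unfolding cinner_self[symmetric] cinner_sum_right unfolding cinner_sum_left form_def ..
  finally show ?thesis by (simp only: sC_of_real)
qed

text \<open>The contraction inequality is applied to the vectors \<open>ev h (z i)\<close> for each
  h and then averaged. That the value is real is recorded as well, because \<open>mpositive\<close>
  asks for it.\<close>

lemma avg_contraction:
  fixes n m :: nat
  assumes S: "\<And>k i. k < m \<Longrightarrow> i < n \<Longrightarrow> S k i \<in> Bop"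
    and contr: "\<And>\<xi>. nsq {..<m} (\<lambda>k. \<Sum>i<n. S k i (\<xi> i)) \<le> nsq {..<n} \<xi>"
  shows "\<exists>r. (\<Sum>k<m. \<Sum>i<n. \<Sum>j<n. cinner (avg (S k i) (S k j) (z j)) (z i)) = complex_of_real r \<and> r \<le> c * nsq {..<n} z"
proof (intro exI conjI)
  let ?f = "\<lambda>k h. (cnorm (\<Sum>i<n. S k i (ev h (z i))))\<^sup>2"
  have f: "?f k \<in> V" if "k < m" for k using S that by (intro V_sum_op) auto
  show "(\<Sum>k<m. \<Sum>i<n. \<Sum>j<n. cinner (avg (S k i) (S k j) (z j)) (z i)) = complex_of_real (\<Sum>k<m. s (?f k))"
    unfolding of_real_sum using S by (intro sum.cong refl avg_form) auto
  have "(\<Sum>k<m. s (?f k)) = s (\<lambda>h. \<Sum>k<m. ?f k h)" using f by (subst s_sum) auto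
  also have "\<dots> \<le> s (\<lambda>h. \<Sum>i<n. (cnorm (ev h (z i)))\<^sup>2)"
    using f contr by (intro s_mono V_sum ev_sq) (auto simp: nsq_def)
  also have "\<dots> = c * nsq {..<n} z"
    by (simp add: s_sum ev_sq nsq_def sum_distrib_left)
  finally show "(\<Sum>k<m. s (?f k)) \<le> c * nsq {..<n} z" .
qed

end

lemma averaging_coordinate:
  fixes ev :: "('k::chilbert \<Rightarrow> 'h1::chilbert) \<times> ('k \<Rightarrow> 'h2::chilbert) \<Rightarrow> 'k \<Rightarrow> 'e::chilbert" and c :: real
  assumes "0 \<le> c" and "\<And>f g. f \<in> dominated \<Longrightarrow> g \<in> dominated \<Longrightarrow> s (\<lambda>h. f h + g h) = s f + s g"
    and "\<And>d f. f \<in> dominated \<Longrightarrow> s (\<lambda>h. d * f h) = d * s f"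
    and "\<And>f. f \<in> dominated \<Longrightarrow> (\<And>h. 0 \<le> f h) \<Longrightarrow> 0 \<le> s f"
    and ev: "\<And>h \<xi>. (cnorm (ev h \<xi>))\<^sup>2 \<le> (cnorm (fst h \<xi>))\<^sup>2 + (cnorm (snd h \<xi>))\<^sup>2"
    and "\<And>(n::nat) w z. s (\<lambda>h. (cnorm (\<Sum>i<n. scaleC (w i) (ev h (z i))))\<^sup>2) = c * (cnorm (\<Sum>i<n. scaleC (w i) (z i)))\<^sup>2"
  shows "averaging dominated s ev c"
proof (unfold_locales)
  show "g \<in> dominated" if g: "\<And>h. \<bar>g h\<bar> \<le> C * (\<Sum>i<n. (cnorm (ev h (z i)))\<^sup>2)" for n :: nat and z g C
  proof (rule dominated_bound)
    fix h
    have "\<bar>g h\<bar> \<le> \<bar>C\<bar> * (\<Sum>i<n. (cnorm (ev h (z i)))\<^sup>2)"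
      using g[of h] by (rule order_trans) (intro mult_right_mono sum_nonneg, auto)
    also have "\<dots> \<le> \<bar>C\<bar> * (\<Sum>i<n. (cnorm (fst h (z i)))\<^sup>2 + (cnorm (snd h (z i)))\<^sup>2)"
      by (intro mult_left_mono sum_mono ev) simp
    finally show "\<bar>g h\<bar> \<le> \<bar>C\<bar> * (\<Sum>i<n. (cnorm (fst h (z i)))\<^sup>2 + (cnorm (snd h (z i)))\<^sup>2)" .
  qed
qed (use assms dominated_add dominated_scale in auto)

section \<open>Separation for a completely bounded bilinear map\<close>

context cb_bilinear
begin

definition vL :: "(nat \<times> (nat \<Rightarrow> ('h1 \<Rightarrow> 'h1)) \<times> (nat \<Rightarrow> ('h2 \<Rightarrow> 'h2)) \<times> (nat \<Rightarrow> 'k)) list \<Rightarrow> real" where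
  "vL L = (\<Sum>(n, x, y, z)\<leftarrow>L. Re (\<Sum>i<n. \<Sum>j<n. cinner (\<phi> (x i) (y j) (z j)) (z i)))"

definition okL where
  "okL L \<longleftrightarrow> (\<forall>(n, x, y, z)\<in>set L. \<forall>i::nat. x i \<in> X \<and> y i \<in> Y)"

text \<open>This is the consistency condition for the separation. Lists are converted into matrices
  indexed by the finitely many vectors that occur: operators of one entry placed at the same vector
  are added, which respects \<phi> by bilinearity.\<close>

lemma list_bound:
  assumes ok: "okL L" and le: "\<And>h1 h2. gX L h1 + gY L h2 \<le> qf T1 h1 + qf T2 h2"
  shows "2 * vL L \<le> c * (qf T1 (\<lambda>\<xi>. \<xi>) + qf T2 (\<lambda>\<xi>. \<xi>))"
proof -
  define M where "M = length L"
  define nn where "nn m = fst (L ! m)" for m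
  define xx where "xx m = fst (snd (L ! m))" for m
  define yy where "yy m = fst (snd (snd (L ! m)))" for m
  define zz where "zz m = snd (snd (snd (L ! m)))" for m
  have Lm: "L ! m = (nn m, xx m, yy m, zz m)" for m by (simp add: nn_def xx_def yy_def zz_def)
  have sumL: "(\<Sum>t\<leftarrow>L. f t) = (\<Sum>m<M. f (nn m, xx m, yy m, zz m))" for f :: "_ \<Rightarrow> real"
    unfolding Lm[symmetric] M_def by (simp add: sum_list_sum_nth atLeast0LessThan)
  have xX: "xx m i \<in> X" and yY: "yy m i \<in> Y" if "m < M" for m i
  proof -
    have "(nn m, xx m, yy m, zz m) \<in> set L" using that Lm[of m] nth_mem[of m L] by (simp add: M_def)
    then show "xx m i \<in> X" "yy m i \<in> Y" using ok by (auto simp: okL_def)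
  qed
  define F where "F = (\<Union>(r, n, w, z)\<in>set T1. z ` {..<n}) \<union> (\<Union>(r, n, w, z)\<in>set T2. z ` {..<n})
    \<union> (\<Union>m<M. zz m ` {..<nn m})"
  have F: "finite F" by (auto simp: F_def)
  have zF: "zz m ` {..<nn m} \<subseteq> F" if "m < M" for m using that by (auto simp: F_def)
  have q1: "(\<Sum>\<xi>\<in>F. \<Sum>\<eta>\<in>F. qmat T1 \<xi> \<eta> * cinner (h \<eta>) (h \<xi>)) = of_real (qf T1 h)" for h :: "'k \<Rightarrow> 'b::chilbert"
    by (rule qf_qmat[OF F]) (force simp: F_def)
  have q2: "(\<Sum>\<xi>\<in>F. \<Sum>\<eta>\<in>F. qmat T2 \<xi> \<eta> * cinner (h \<eta>) (h \<xi>)) = of_real (qf T2 h)" for h :: "'k \<Rightarrow> 'b::chilbert"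
    by (rule qf_qmat[OF F]) (force simp: F_def)
  define I where "I m \<xi> = {i\<in>{..<nn m}. zz m i = \<xi>}" for m \<xi>
  define x where "x m \<xi> = (\<lambda>v. \<Sum>i\<in>I m \<xi>. xx m i v)" for m \<xi>
  define y where "y m \<xi> = (\<lambda>v. \<Sum>i\<in>I m \<xi>. yy m i v)" for m \<xi>
  have x: "x m \<xi> \<in> X" and y: "y m \<xi> \<in> Y" if "m < M" for m \<xi>
    unfolding x_def y_def using xX[OF that] yY[OF that] by (auto intro: opspace_sum X Y)
  have regroup: "(\<Sum>i<nn m. g i) = (\<Sum>\<xi>\<in>F. \<Sum>i\<in>I m \<xi>. g i)" if "m < M" for m and g :: "nat \<Rightarrow> 'b::comm_monoid_add"
    unfolding I_def by (rule sum_regroup[OF F zF[OF that]])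
  have gx: "nsq {..<M} (\<lambda>m. \<Sum>\<xi>\<in>F. adjoint (x m \<xi>) (h \<xi>)) = gX L h" for h
  proof -
    have "(\<Sum>i<nn m. adjoint (xx m i) (h (zz m i))) = (\<Sum>\<xi>\<in>F. adjoint (x m \<xi>) (h \<xi>))" if "m < M" for m
    proof -
      have "adjoint (x m \<xi>) = (\<lambda>v. \<Sum>i\<in>I m \<xi>. adjoint (xx m i) v)" for \<xi>
        unfolding x_def using XB[OF xX[OF that]] by (intro adjoint_sum_op)
      then show ?thesis unfolding regroup[OF that] by (auto simp: I_def intro!: sum.cong)
    qed
    then show ?thesis by (simp add: gX_def sumL nsq_def)
  qed
  have gy: "nsq {..<M} (\<lambda>m. \<Sum>\<xi>\<in>F. y m \<xi> (h \<xi>)) = gY L h" for h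
  proof -
    have "(\<Sum>i<nn m. yy m i (h (zz m i))) = (\<Sum>\<xi>\<in>F. y m \<xi> (h \<xi>))" if "m < M" for m
      unfolding regroup[OF that] by (auto simp: I_def y_def intro!: sum.cong)
    then show ?thesis by (simp add: gY_def sumL nsq_def)
  qed
  have v: "(\<Sum>m<M. \<Sum>\<xi>\<in>F. \<Sum>\<eta>\<in>F. cinner (\<phi> (x m \<xi>) (y m \<eta>) \<eta>) \<xi>) =
    (\<Sum>m<M. \<Sum>i<nn m. \<Sum>j<nn m. cinner (\<phi> (xx m i) (yy m j) (zz m j)) (zz m i))"
  proof (intro sum.cong refl)
    fix m assume "m \<in> {..<M}"
    then have m: "m < M" by simp
    have "(\<Sum>i<nn m. \<Sum>j<nn m. cinner (\<phi> (xx m i) (yy m j) (zz m j)) (zz m i))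
      = (\<Sum>\<xi>\<in>F. \<Sum>i\<in>I m \<xi>. \<Sum>\<eta>\<in>F. \<Sum>j\<in>I m \<eta>. cinner (\<phi> (xx m i) (yy m j) \<eta>) \<xi>)"
      unfolding regroup[OF m] by (auto simp: I_def intro!: sum.cong)
    also have "\<dots> = (\<Sum>\<xi>\<in>F. \<Sum>\<eta>\<in>F. \<Sum>i\<in>I m \<xi>. \<Sum>j\<in>I m \<eta>. cinner (\<phi> (xx m i) (yy m j) \<eta>) \<xi>)"
      by (intro sum.cong refl sum.swap)
    also have "\<dots> = (\<Sum>\<xi>\<in>F. \<Sum>\<eta>\<in>F. cinner (\<phi> (x m \<xi>) (y m \<eta>) \<eta>) \<xi>)"
      unfolding x_def y_def using xX[OF m] yY[OF m] by (simp add: \<phi>_sum cinner_sum_left)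
    finally show "(\<Sum>\<xi>\<in>F. \<Sum>\<eta>\<in>F. cinner (\<phi> (x m \<xi>) (y m \<eta>) \<eta>) \<xi>) =
      (\<Sum>i<nn m. \<Sum>j<nn m. cinner (\<phi> (xx m i) (yy m j) (zz m j)) (zz m i))" ..
  qed
  have swap: "(\<Sum>\<xi>\<in>F. \<Sum>\<eta>\<in>F. \<Sum>m<M. f \<xi> \<eta> m) = (\<Sum>m<M. \<Sum>\<xi>\<in>F. \<Sum>\<eta>\<in>F. f \<xi> \<eta> m)" for f :: "'k \<Rightarrow> 'k \<Rightarrow> nat \<Rightarrow> complex"
  proof -
    have "(\<Sum>\<xi>\<in>F. \<Sum>\<eta>\<in>F. \<Sum>m<M. f \<xi> \<eta> m) = (\<Sum>\<xi>\<in>F. \<Sum>m<M. \<Sum>\<eta>\<in>F. f \<xi> \<eta> m)"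
      by (intro sum.cong refl sum.swap)
    also have "\<dots> = (\<Sum>m<M. \<Sum>\<xi>\<in>F. \<Sum>\<eta>\<in>F. f \<xi> \<eta> m)" by (rule sum.swap)
    finally show ?thesis .
  qed
  have "vL L = Re (\<Sum>m<M. \<Sum>i<nn m. \<Sum>j<nn m. cinner (\<phi> (xx m i) (yy m j) (zz m j)) (zz m i))"
    by (simp add: vL_def sumL)
  also have "\<dots> = Re (\<Sum>\<xi>\<in>F. \<Sum>\<eta>\<in>F. \<Sum>m<M. cinner (\<phi> (x m \<xi>) (y m \<eta>) \<eta>) \<xi>)"
    unfolding swap v ..
  also have "2 * \<dots> \<le> c * (Re (\<Sum>\<xi>\<in>F. \<Sum>\<eta>\<in>F. qmat T1 \<xi> \<eta> * cinner \<eta> \<xi>) + Re (\<Sum>\<xi>\<in>F. \<Sum>\<eta>\<in>F. qmat T2 \<xi> \<eta> * cinner \<eta> \<xi>))"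
  proof (rule matrix_bound[OF F qmat_hermitian qmat_hermitian x y])
    \<comment> \<open>Setting the other coordinate of the pair to 0 separates the joint inequality
      into one for x and one for y.\<close>
    show "nsq {..<M} (\<lambda>m. \<Sum>\<xi>\<in>F. adjoint (x m \<xi>) (h \<xi>)) \<le> Re (\<Sum>\<xi>\<in>F. \<Sum>\<eta>\<in>F. qmat T1 \<xi> \<eta> * cinner (h \<eta>) (h \<xi>))" for h
      unfolding q1 gx using le[of h "\<lambda>_. 0"] gY_ge0[of L "\<lambda>_. 0"] by simp
    show "nsq {..<M} (\<lambda>m. \<Sum>\<xi>\<in>F. y m \<xi> (h \<xi>)) \<le> Re (\<Sum>\<xi>\<in>F. \<Sum>\<eta>\<in>F. qmat T2 \<xi> \<eta> * cinner (h \<eta>) (h \<xi>))" for h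
      unfolding q2 gy using le[of "\<lambda>_. 0" h] gX_ge0[of L "\<lambda>_. 0"] by simp
  qed
  also have "(\<Sum>\<xi>\<in>F. \<Sum>\<eta>\<in>F. qmat T1 \<xi> \<eta> * cinner \<eta> \<xi>) = of_real (qf T1 (\<lambda>\<xi>. \<xi>))" by (rule q1)
  also have "(\<Sum>\<xi>\<in>F. \<Sum>\<eta>\<in>F. qmat T2 \<xi> \<eta> * cinner \<eta> \<xi>) = of_real (qf T2 (\<lambda>\<xi>. \<xi>))" by (rule q2)
  finally show ?thesis by simp
qed

text \<open>The functional \<open>s\<close> is a finitely additive average over all pairs of maps \<open>h\<^sub>1: K \<rightarrow> H\<^sub>1\<close>,
  \<open>h\<^sub>2: K \<rightarrow> H\<^sub>2\<close>, which on average are linear and \<open>\<surd>c\<close> times an isometry. The last property says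
  that \<open>\<phi>\<close> is dominated by this average in the sense of Christensen and Sinclair.\<close>
theorem averaging_functional:
  "\<exists>s. averaging dominated s (fst :: ('k \<Rightarrow> 'h1) \<times> ('k \<Rightarrow> 'h2) \<Rightarrow> _) c \<and> averaging dominated s snd c
    \<and> (\<forall>(n::nat) x y z. (\<forall>i. x i \<in> X) \<longrightarrow> (\<forall>i. y i \<in> Y) \<longrightarrow>
      2 * Re (\<Sum>i<n. \<Sum>j<n. cinner (\<phi> (x i) (y j) (z j)) (z i))
      \<le> s (\<lambda>h. (cnorm (\<Sum>i<n. adjoint (x i) (fst h (z i))))\<^sup>2 + (cnorm (\<Sum>i<n. y i (snd h (z i))))\<^sup>2))"
proof -
  \<comment> \<open>The upper bounds forced on the functional: if g + gX + gY stays below the forms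
    T1 and T2, then s g can be at most the prescribed mean of the forms minus 2 vL, the required
    lower bound for the mean of gX + gY.\<close>
  define R0 :: "((('k \<Rightarrow> 'h1) \<times> ('k \<Rightarrow> 'h2) \<Rightarrow> real) \<times> real) set"
    where "R0 = {(g, t). g \<in> dominated \<and> (\<exists>T1 T2 L. okL L
      \<and> (\<forall>h. g h + gX L (fst h) + gY L (snd h) \<le> qf T1 (fst h) + qf T2 (snd h))
      \<and> c * (qf T1 (\<lambda>\<xi>. \<xi>) + qf T2 (\<lambda>\<xi>. \<xi>)) - 2 * vL L \<le> t)}"
  have R0I: "(g, t) \<in> R0" if "g \<in> dominated" "okL L"
    "\<And>h. g h + gX L (fst h) + gY L (snd h) \<le> qf U (fst h) + qf V (snd h)"
    "c * (qf U (\<lambda>\<xi>. \<xi>) + qf V (\<lambda>\<xi>. \<xi>)) - 2 * vL L \<le> t" for g t U V L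
    using that unfolding R0_def by blast
  have ok0: "okL []" and g0: "gX [] h1 = 0" "gY [] h2 = 0" and v0: "vL [] = 0"
    for h1 :: "'k \<Rightarrow> 'h1" and h2 :: "'k \<Rightarrow> 'h2"
    by (simp_all add: okL_def gX_def gY_def vL_def)
  have dom0: "(\<lambda>h. 0) \<in> dominated" by (rule dominated_bound[where C = 0]) simp
  obtain s where s_add: "\<And>f g. f \<in> dominated \<Longrightarrow> g \<in> dominated \<Longrightarrow> s (\<lambda>h. f h + g h) = s f + s g"
    and s_scale: "\<And>d f. f \<in> dominated \<Longrightarrow> s (\<lambda>h. d * f h) = d * s f"
    and s_le: "\<And>f t. (f, t) \<in> R0 \<Longrightarrow> s f \<le> t"
  proof (rule hahn_banach_cone[of dominated R0])
    show "\<exists>t. (f, t) \<in> R0" if "f \<in> dominated" for f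
    proof -
      obtain T1 T2 where "\<And>h. \<bar>f h\<bar> \<le> qf T1 (fst h) + qf T2 (snd h)" using \<open>f \<in> dominated\<close> unfolding dominated_def by blast
      then have "\<And>h. f h + gX [] (fst h) + gY [] (snd h) \<le> qf T1 (fst h) + qf T2 (snd h)"
        unfolding g0 by (metis abs_le_D1 add.right_neutral)
      from R0I[OF that ok0 this] show ?thesis by blast
    qed
    show "((\<lambda>z. 0), 0) \<in> R0"
      by (rule R0I[OF dom0 ok0, of "[]" "[]"]) (simp_all add: g0 v0)
    show "((\<lambda>z. f z + g z), t + u) \<in> R0" if f: "(f, t) \<in> R0" and g: "(g, u) \<in> R0" for f g t u
    proof -
      obtain T1 T2 L where 1: "f \<in> dominated" "okL L" "\<And>h. f h + gX L (fst h) + gY L (snd h) \<le> qf T1 (fst h) + qf T2 (snd h)"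
        "c * (qf T1 (\<lambda>\<xi>. \<xi>) + qf T2 (\<lambda>\<xi>. \<xi>)) - 2 * vL L \<le> t" using f unfolding R0_def by blast
      obtain T1' T2' L' where 2: "g \<in> dominated" "okL L'" "\<And>h. g h + gX L' (fst h) + gY L' (snd h) \<le> qf T1' (fst h) + qf T2' (snd h)"
        "c * (qf T1' (\<lambda>\<xi>. \<xi>) + qf T2' (\<lambda>\<xi>. \<xi>)) - 2 * vL L' \<le> u" using g unfolding R0_def by blast
      show ?thesis
      proof (rule R0I[of _ "L @ L'" "T1 @ T1'" "T2 @ T2'"])
        show "okL (L @ L')" using 1(2) 2(2) by (auto simp: okL_def)
        show "(\<lambda>z. f z + g z) \<in> dominated" using 1(1) 2(1) by (rule dominated_add)
        show "f h + g h + gX (L @ L') (fst h) + gY (L @ L') (snd h) \<le> qf (T1 @ T1') (fst h) + qf (T2 @ T2') (snd h)" for h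
          using 1(3)[of h] 2(3)[of h] by (simp add: qf_append) (simp add: gX_def gY_def)
        show "c * (qf (T1 @ T1') (\<lambda>\<xi>. \<xi>) + qf (T2 @ T2') (\<lambda>\<xi>. \<xi>)) - 2 * vL (L @ L') \<le> t + u"
          using 1(4) 2(4) by (simp add: qf_append vL_def distrib_left)
      qed
    qed
    show "((\<lambda>z. d * f z), d * t) \<in> R0" if d: "d > 0" and f: "(f, t) \<in> R0" for d f t
    proof -
      obtain T1 T2 L where 1: "f \<in> dominated" "okL L" "\<And>h. f h + gX L (fst h) + gY L (snd h) \<le> qf T1 (fst h) + qf T2 (snd h)"
        "c * (qf T1 (\<lambda>\<xi>. \<xi>) + qf T2 (\<lambda>\<xi>. \<xi>)) - 2 * vL L \<le> t" using f unfolding R0_def by blast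
      \<comment> \<open>gX and gY are quadratic in x and y respectively, and vL is bilinear in them.
        Multiplying all operators by the root of d hence multiplies each of the three by d, and
        lists need no weights.\<close>
      define e where "e = sqrt d"
      have e: "e > 0" "e\<^sup>2 = d" using d by (simp_all add: e_def)
      let ?T = "\<lambda>T. map (\<lambda>(r, n, w, z). (d * r, n, w, z)) T"
      define sL where "sL L = map (\<lambda>(n, x, y, z). (n, \<lambda>i. oscale (of_real e) (x i), \<lambda>i. oscale (of_real e) (y i), z)) L"
        for L :: "(nat \<times> (nat \<Rightarrow> ('h1 \<Rightarrow> 'h1)) \<times> (nat \<Rightarrow> ('h2 \<Rightarrow> 'h2)) \<times> (nat \<Rightarrow> 'k)) list"
      have okCons: "okL (l # L) \<longleftrightarrow> okL [l] \<and> okL L" for l L by (auto simp: okL_def)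
      have sc: "cnorm (\<Sum>i<n. scaleC (complex_of_real e) (v i)) = e * cnorm (\<Sum>i<n. v i)" for n :: nat and v :: "nat \<Rightarrow> 'b::chilbert"
        using e by (simp add: cnorm_scaleC flip: scaleC_sum_right)
      have sX: "gX (sL L) h = d * gX L h" if "okL L" for L h
        using that
      proof (induction L)
        case Nil
        then show ?case by (simp add: sL_def gX_def)
      next
        case (Cons l L)
        obtain n x y z where l: "l = (n, x, y, z)" by (cases l)
        have x: "x i \<in> X" for i using Cons.prems l by (simp add: okL_def)
        have "gX (sL L) h = d * gX L h" using Cons okCons by blast
        then show ?case
          by (simp add: sL_def gX_def l adjoint_oscale[OF XB[OF x]] distrib_left)
            (simp add: oscale_def sc power_mult_distrib e)
      qed
      have sY: "gY (sL L) h = d * gY L h" for L h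
        by (induction L) (auto simp: sL_def gY_def oscale_def sc power_mult_distrib e distrib_left)
      have sv: "vL (sL L) = d * vL L" if "okL L" for L
        using that
      proof (induction L)
        case Nil
        then show ?case by (simp add: sL_def vL_def)
      next
        case (Cons l L)
        obtain n x y z where l: "l = (n, x, y, z)" by (cases l)
        have xy: "x i \<in> X" "y i \<in> Y" for i using Cons.prems l by (simp_all add: okL_def)
        have "\<phi> (oscale (of_real e) (x i)) (oscale (of_real e) (y j)) = oscale (of_real d) (\<phi> (x i) (y j))" for i j
          using \<phi>_lincomb[of "{()}" "\<lambda>_. x i" "{()}" "\<lambda>_. y j" "\<lambda>_. of_real e" "\<lambda>_. of_real e"] xy e
          by (simp add: oscale_def power2_eq_square flip: of_real_mult)
        then have "Re (\<Sum>i<n. \<Sum>j<n. cinner (\<phi> (oscale (of_real e) (x i)) (oscale (of_real e) (y j)) (z j)) (z i)) =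
          d * Re (\<Sum>i<n. \<Sum>j<n. cinner (\<phi> (x i) (y j) (z j)) (z i))"
          by (simp add: oscale_def cinner_scaleC_left sum_distrib_left)
        moreover have "vL (sL L) = d * vL L" using Cons okCons by blast
        ultimately show ?case by (simp add: sL_def vL_def l distrib_left)
      qed
      show ?thesis
      proof (rule R0I[of _ "sL L" "?T T1" "?T T2"])
        show "(\<lambda>z. d * f z) \<in> dominated" using 1(1) by (rule dominated_scale)
        show "okL (sL L)" using 1(2) opspace_oscale[OF X] opspace_oscale[OF Y] by (auto simp: okL_def sL_def)
        show "d * f h + gX (sL L) (fst h) + gY (sL L) (snd h) \<le> qf (?T T1) (fst h) + qf (?T T2) (snd h)" for h
          using mult_left_mono[OF 1(3)[of h], of d] d unfolding qf_scale sX[OF 1(2)] sY by (simp add: distrib_left)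
        show "c * (qf (?T T1) (\<lambda>\<xi>. \<xi>) + qf (?T T2) (\<lambda>\<xi>. \<xi>)) - 2 * vL (sL L) \<le> d * t"
          using mult_left_mono[OF 1(4), of d] d unfolding qf_scale sv[OF 1(2)] by (simp add: algebra_simps)
      qed
    qed
    show "0 \<le> t" if t: "((\<lambda>z. 0), t) \<in> R0" for t
    proof -
      obtain T1 T2 L where 1: "okL L" "\<And>h :: ('k \<Rightarrow> 'h1) \<times> ('k \<Rightarrow> 'h2). 0 + gX L (fst h) + gY L (snd h) \<le> qf T1 (fst h) + qf T2 (snd h)"
        "c * (qf T1 (\<lambda>\<xi>. \<xi>) + qf T2 (\<lambda>\<xi>. \<xi>)) - 2 * vL L \<le> t" using t unfolding R0_def by blast
      have "2 * vL L \<le> c * (qf T1 (\<lambda>\<xi>. \<xi>) + qf T2 (\<lambda>\<xi>. \<xi>))"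
        using 1(1) by (rule list_bound) (use 1(2) in force)
      then show ?thesis using 1(3) by simp
    qed
    show "f \<in> dominated" if "(f, t) \<in> R0" for f t using that by (simp add: R0_def)
  qed (use dominated_add dominated_scale in blast)+
  have s_minus: "s (\<lambda>h. - f h) = - s f" if "f \<in> dominated" for f
    using s_scale[OF that, of "-1"] by simp
  have dom_minus: "(\<lambda>h. - f h) \<in> dominated" if "f \<in> dominated" for f
    using dominated_scale[OF that, of "-1"] by simp
  have s_pos: "0 \<le> s f" if f: "f \<in> dominated" and pos: "\<And>h. 0 \<le> f h" for f
  proof -
    have "((\<lambda>h. - f h), 0) \<in> R0"
      by (rule R0I[OF dom_minus[OF f] ok0, of "[]" "[]"]) (simp_all add: g0 v0 pos)
    from s_le[OF this] show ?thesis by (simp add: s_minus[OF f])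
  qed
  \<comment> \<open>The constraint for a form and the one for its negative, which is again a list
    because weights are signed, determine its mean exactly.\<close>
  have s_qf: "s (\<lambda>h. qf T1 (fst h) + qf T2 (snd h)) = c * (qf T1 (\<lambda>\<xi>. \<xi>) + qf T2 (\<lambda>\<xi>. \<xi>))" (is "s ?f = ?r")
    if "\<And>(h1 :: 'k \<Rightarrow> 'h1) (h2 :: 'k \<Rightarrow> 'h2). 0 \<le> qf T1 h1 + qf T2 h2" for T1 T2
  proof (rule antisym)
    have f: "?f \<in> dominated"
      unfolding dominated_def by (rule CollectI, rule exI[of _ T1], rule exI[of _ T2]) (use that in simp)
    have "(?f, ?r) \<in> R0"
      by (rule R0I[OF f ok0, of T1 T2]) (simp_all add: g0 v0)
    then show "s ?f \<le> ?r" by (rule s_le)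
    let ?T = "\<lambda>T. map (\<lambda>(r, n, w, z). (-1 * r, n, w, z)) T"
    have "((\<lambda>h. - ?f h), - ?r) \<in> R0"
      by (rule R0I[OF dom_minus[OF f] ok0, of "?T T1" "?T T2"], unfold qf_scale) (simp_all add: g0 v0 algebra_simps)
    from s_le[OF this] show "?r \<le> s ?f" unfolding s_minus[OF f] by simp
  qed
  have "2 * Re (\<Sum>i<n. \<Sum>j<n. cinner (\<phi> (x i) (y j) (z j)) (z i))
      \<le> s (\<lambda>h. (cnorm (\<Sum>i<n. adjoint (x i) (fst h (z i))))\<^sup>2 + (cnorm (\<Sum>i<n. y i (snd h (z i))))\<^sup>2)"
    if x: "\<And>i. x i \<in> X" and y: "\<And>i. y i \<in> Y" for n :: nat and x y z
  proof -
    let ?f = "\<lambda>h :: ('k \<Rightarrow> 'h1) \<times> ('k \<Rightarrow> 'h2). (cnorm (\<Sum>i<n. adjoint (x i) (fst h (z i))))\<^sup>2 + (cnorm (\<Sum>i<n. y i (snd h (z i))))\<^sup>2"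
    have f: "?f \<in> dominated"
    proof -
      obtain C where C: "C \<ge> 0" "\<And>v. (cnorm (\<Sum>i<n. adjoint (x i) (v i)))\<^sup>2 \<le> C * (\<Sum>i<n. (cnorm (v i))\<^sup>2)"
        using cnorm_sum_op_bound[of "\<lambda>i. adjoint (x i)" n] adjoint_Bop[OF XB[OF x]] by blast
      obtain D where D: "D \<ge> 0" "\<And>v. (cnorm (\<Sum>i<n. y i (v i)))\<^sup>2 \<le> D * (\<Sum>i<n. (cnorm (v i))\<^sup>2)"
        using cnorm_sum_op_bound[of y n] YB[OF y] by blast
      show ?thesis
      proof (rule dominated_bound[where C = "C + D" and n = n and z = z])
        fix h :: "('k \<Rightarrow> 'h1) \<times> ('k \<Rightarrow> 'h2)"
        have "0 \<le> C * (\<Sum>i<n. (cnorm (snd h (z i)))\<^sup>2)" "0 \<le> D * (\<Sum>i<n. (cnorm (fst h (z i)))\<^sup>2)"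
          using C(1) D(1) by (simp_all add: sum_nonneg)
        then show "\<bar>?f h\<bar> \<le> (C + D) * (\<Sum>i<n. (cnorm (fst h (z i)))\<^sup>2 + (cnorm (snd h (z i)))\<^sup>2)"
          using C(2)[of "\<lambda>i. fst h (z i)"] D(2)[of "\<lambda>i. snd h (z i)"]
          by (simp add: sum.distrib distrib_left distrib_right)
      qed
    qed
    \<comment> \<open>With one list entry and no forms, the constraint is precisely the asserted
      domination of \<phi>.\<close>
    have "((\<lambda>h. - ?f h), - (2 * Re (\<Sum>i<n. \<Sum>j<n. cinner (\<phi> (x i) (y j) (z j)) (z i)))) \<in> R0"
    proof (rule R0I[OF dom_minus[OF f], of "[(n, x, y, z)]" "[]" "[]"])
      show "okL [(n, x, y, z)]" using x y by (simp add: okL_def)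
    qed (simp_all add: gX_def gY_def vL_def)
    from s_le[OF this] show "2 * Re (\<Sum>i<n. \<Sum>j<n. cinner (\<phi> (x i) (y j) (z j)) (z i)) \<le> s ?f"
      by (simp only: s_minus[OF f] neg_le_iff_le)
  qed
  moreover have "averaging dominated s fst c"
  proof (rule averaging_coordinate[OF less_imp_le[OF c] s_add s_scale s_pos])
    show "s (\<lambda>h. (cnorm (\<Sum>i<n. scaleC (w i) (fst h (z i))))\<^sup>2) = c * (cnorm (\<Sum>i<n. scaleC (w i) (z i)))\<^sup>2"
      for n :: nat and w z
      using s_qf[of "[(1, n, w, z)]" "[]"] by (simp add: qf_single)
  qed auto
  moreover have "averaging dominated s snd c"
  proof (rule averaging_coordinate[OF less_imp_le[OF c] s_add s_scale s_pos])
    show "s (\<lambda>h. (cnorm (\<Sum>i<n. scaleC (w i) (snd h (z i))))\<^sup>2) = c * (cnorm (\<Sum>i<n. scaleC (w i) (z i)))\<^sup>2"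
      for n :: nat and w z
      using s_qf[of "[]" "[(1, n, w, z)]"] by (simp add: qf_single)
  qed auto
  ultimately show ?thesis by blast
qed

end

subsection \<open>Kernels dominating a bilinear map\<close>

lemma adjoint_zero [simp]: "adjoint (\<lambda>v. 0) = (\<lambda>v. 0)"
  by (rule adjoint_eqI[OF Bop_0]) simp

lemma mnorm_null:
  assumes "\<And>i j v. i < n \<Longrightarrow> j < n \<Longrightarrow> A i j v = 0"
  shows "mnorm n A = 0"
proof (rule antisym)
  show "mnorm n A \<le> 0" using assms by (intro mnorm_le) (auto simp: nsq_def)
  have "A i j = (\<lambda>v. 0)" if "i < n" "j < n" for i j using assms that by auto
  then show "0 \<le> mnorm n A" by (intro mnorm_ge0) (simp add: Mn_def Bop_0)
qed

lemma mnorm_zero [simp]: "mnorm n (\<lambda>_ _ v. 0) = 0"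
  by (rule mnorm_null) simp

lemma sum_lessThan_split: "(\<Sum>i<n + m. g i) = (\<Sum>i<n. g i) + (\<Sum>i<m. g (n + i :: nat))"
  by (induction m) (auto simp: add.assoc)

text \<open>Cauchy-Schwarz for the kernel in additive form: positivity at the 2n points t and u,
  carrying the vectors \<eta> and -\<xi>.\<close>

lemma pd_cross_le:
  assumes pd: "pd \<kappa>" and B: "\<And>s t. \<kappa> s t \<in> Bop"
  shows "2 * Re (\<Sum>i<n. \<Sum>j<n. cinner (\<kappa> (t i) (u j) (\<xi> j)) (\<eta> i)) \<le> Re (kform \<kappa> n t \<eta>) + Re (kform \<kappa> n u \<xi>)"
proof -
  define P where "P = (\<Sum>i<n. \<Sum>j<n. cinner (\<kappa> (t i) (u j) (\<xi> j)) (\<eta> i))"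
  let ?t = "\<lambda>i. if i < n then t i else u (i - n)" and ?z = "\<lambda>i. if i < n then \<eta> i else - \<xi> (i - n)"
  have "(\<Sum>i<n. \<Sum>j<n. cinner (\<kappa> (u i) (t j) (\<eta> j)) (\<xi> i)) = (\<Sum>i<n. \<Sum>j<n. cnj (cinner (\<kappa> (t j) (u i) (\<xi> i)) (\<eta> j)))"
    by (intro sum.cong refl) (simp add: pd_hermitian[OF pd B] flip: cinner_commute)
  also have "\<dots> = cnj P" unfolding P_def cnj_sum by (rule sum.swap)
  finally have 1: "(\<Sum>i<n. \<Sum>j<n. cinner (\<kappa> (u i) (t j) (\<eta> j)) (\<xi> i)) = cnj P" .
  have "kform \<kappa> (n + n) ?t ?z = kform \<kappa> n t \<eta> - P - cnj P + kform \<kappa> n u \<xi>"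
    unfolding kform_def sum_lessThan_split using 1
    by (simp add: sum.distrib cinner_simps Bop_minus[OF B] sum_negf sum_subtractf P_def[symmetric])
  moreover have "0 \<le> Re (kform \<kappa> (n + n) ?t ?z)" using pd by (rule pd_Re)
  ultimately show ?thesis unfolding P_def by simp
qed

lemma Re_sum_cinner_le:
  assumes "finite I" and le: "nsq I w \<le> a\<^sup>2 * nsq I \<eta>" and a: "0 \<le> a"
  shows "Re (\<Sum>i\<in>I. cinner (w i) (\<eta> i)) \<le> a * nsq I \<eta>"
proof (cases "a = 0")
  case True
  then have "nsq I w = 0" using le nsq_ge0[of I w] by simp
  then have "w i = 0" if "i \<in> I" for i
    using that assms(1) by (auto simp: nsq_def sum_nonneg_eq_0_iff)
  then show ?thesis using True by simp
next
  case False
  then have a: "a > 0" using a by simp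
  have "2 * Re (\<Sum>i\<in>I. cinner (w i) (\<eta> i)) \<le> nsq I w / a + a * nsq I \<eta>"
    using a by (rule two_Re_sum_le_weighted)
  also have "nsq I w / a \<le> a\<^sup>2 * nsq I \<eta> / a" using le a by (intro divide_right_mono) auto
  finally show ?thesis using a by (simp add: power2_eq_square)
qed

text \<open>The kernel \<open>\<kappa>\<close> on the disjoint union of \<open>X\<close> and \<open>Y\<close> is the matrix with diagonal entries \<open>\<Psi>\<close>, \<open>\<Theta>\<close>
  and corner \<open>\<phi>\<close>.\<close>
locale dominating_kernel =
  fixes X :: "('h1::chilbert \<Rightarrow> 'h1) set" and Y :: "('h2::chilbert \<Rightarrow> 'h2) set"
    and N :: "('k::chilbert \<Rightarrow> 'k) set"
    and \<phi> :: "('h1 \<Rightarrow> 'h1) \<Rightarrow> ('h2 \<Rightarrow> 'h2) \<Rightarrow> ('k \<Rightarrow> 'k)" and c :: real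
    and \<kappa> :: "('h1 \<Rightarrow> 'h1) + ('h2 \<Rightarrow> 'h2) \<Rightarrow> ('h1 \<Rightarrow> 'h1) + ('h2 \<Rightarrow> 'h2) \<Rightarrow> ('k \<Rightarrow> 'k)"
  assumes X: "opspace X" and Y: "opspace Y" and N: "vN_algebra N" and c: "c > 0"
    and \<kappa>N: "\<And>s t. \<kappa> s t \<in> N" and pd: "pd \<kappa>"
    and corner: "\<And>x y. x \<in> X \<Longrightarrow> y \<in> Y \<Longrightarrow> \<kappa> (Inl x) (Inr y) = \<phi> x y"
    and X_oadd: "\<And>a b x. a \<in> X \<Longrightarrow> b \<in> X \<Longrightarrow> x \<in> X \<Longrightarrow> \<kappa> (Inl (oadd a b)) (Inl x) = oadd (\<kappa> (Inl a) (Inl x)) (\<kappa> (Inl b) (Inl x))"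
    and X_oscale: "\<And>a d x. a \<in> X \<Longrightarrow> x \<in> X \<Longrightarrow> \<kappa> (Inl (oscale d a)) (Inl x) = oscale d (\<kappa> (Inl a) (Inl x))"
    and Y_oadd: "\<And>a b y. a \<in> Y \<Longrightarrow> b \<in> Y \<Longrightarrow> y \<in> Y \<Longrightarrow> \<kappa> (Inr y) (Inr (oadd a b)) = oadd (\<kappa> (Inr y) (Inr a)) (\<kappa> (Inr y) (Inr b))"
    and Y_oscale: "\<And>a d y. a \<in> Y \<Longrightarrow> y \<in> Y \<Longrightarrow> \<kappa> (Inr y) (Inr (oscale d a)) = oscale d (\<kappa> (Inr y) (Inr a))"
    and X_bound: "\<And>n x z. x \<in> Mn n X \<Longrightarrow> (\<And>\<xi>. nsq {..<n} (\<lambda>k. \<Sum>i<n. adjoint (x i k) (\<xi> i)) \<le> nsq {..<n} \<xi>) \<Longrightarrow>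
      (\<Sum>k<n. Re (kform \<kappa> n (\<lambda>i. Inl (x i k)) z)) \<le> c * nsq {..<n} z"
    and Y_bound: "\<And>n y z. y \<in> Mn n Y \<Longrightarrow> (\<And>\<xi>. nsq {..<n} (\<lambda>k. \<Sum>i<n. y k i (\<xi> i)) \<le> nsq {..<n} \<xi>) \<Longrightarrow>
      (\<Sum>k<n. Re (kform \<kappa> n (\<lambda>i. Inr (y k i)) z)) \<le> c * nsq {..<n} z"
begin

lemmas XB = opspace_Bop[OF X] and YB = opspace_Bop[OF Y]

lemma \<kappa>B: "\<kappa> s t \<in> Bop"
  using N \<kappa>N by (rule vN_BopD)

lemma \<kappa>_adjoint: "adjoint (\<kappa> s t) = \<kappa> t s"
  by (rule adjoint_eqI[OF \<kappa>B pd_hermitian[OF pd \<kappa>B]])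

lemma X_closed: "a \<in> X \<Longrightarrow> b \<in> X \<Longrightarrow> oadd a b \<in> X" "a \<in> X \<Longrightarrow> oscale d a \<in> X"
  using X by (auto simp: opspace_def)

lemma Y_closed: "a \<in> Y \<Longrightarrow> b \<in> Y \<Longrightarrow> oadd a b \<in> Y" "a \<in> Y \<Longrightarrow> oscale d a \<in> Y"
  using Y by (auto simp: opspace_def)

lemma X_oadd': "a \<in> X \<Longrightarrow> b \<in> X \<Longrightarrow> x \<in> X \<Longrightarrow> \<kappa> (Inl x) (Inl (oadd a b)) = oadd (\<kappa> (Inl x) (Inl a)) (\<kappa> (Inl x) (Inl b))"
  using arg_cong[OF X_oadd[of a b x], of adjoint] by (simp add: \<kappa>_adjoint adjoint_oadd \<kappa>B)

lemma X_oscale': "a \<in> X \<Longrightarrow> x \<in> X \<Longrightarrow> \<kappa> (Inl x) (Inl (oscale d a)) = oscale (cnj d) (\<kappa> (Inl x) (Inl a))"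
  using arg_cong[OF X_oscale[of a x d], of adjoint] by (simp add: \<kappa>_adjoint adjoint_oscale \<kappa>B)

lemma Y_oadd': "a \<in> Y \<Longrightarrow> b \<in> Y \<Longrightarrow> y \<in> Y \<Longrightarrow> \<kappa> (Inr (oadd a b)) (Inr y) = oadd (\<kappa> (Inr a) (Inr y)) (\<kappa> (Inr b) (Inr y))"
  using arg_cong[OF Y_oadd[of a b y], of adjoint] by (simp add: \<kappa>_adjoint adjoint_oadd \<kappa>B)

lemma Y_oscale': "a \<in> Y \<Longrightarrow> y \<in> Y \<Longrightarrow> \<kappa> (Inr (oscale d a)) (Inr y) = oscale (cnj d) (\<kappa> (Inr a) (Inr y))"
  using arg_cong[OF Y_oscale[of a y d], of adjoint] by (simp add: \<kappa>_adjoint adjoint_oscale \<kappa>B)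

text \<open>On X the kernel is conjugate linear in its second argument, and the adjoint makes it
  bilinear on X and the adjoint space. On Y it is the first argument that is conjugate linear, since
  there v(y) is the adjoint of \<theta>(y).\<close>

definition \<Psi> :: "('h1 \<Rightarrow> 'h1) \<Rightarrow> ('h1 \<Rightarrow> 'h1) \<Rightarrow> ('k \<Rightarrow> 'k)" where
  "\<Psi> x z = \<kappa> (Inl x) (Inl (adjoint z))"

definition \<Theta> :: "('h2 \<Rightarrow> 'h2) \<Rightarrow> ('h2 \<Rightarrow> 'h2) \<Rightarrow> ('k \<Rightarrow> 'k)" where
  "\<Theta> z y = \<kappa> (Inr (adjoint z)) (Inr y)"

lemma adj_setD: "opspace W \<Longrightarrow> z \<in> adj_set W \<Longrightarrow> adjoint z \<in> W \<and> z \<in> Bop"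
  by (auto simp: adj_set_def adjoint_adjoint adjoint_Bop opspace_Bop)

lemma bilinear_\<Psi>: "bilinear_on X (adj_set X) \<Psi>"
  unfolding bilinear_on_def linear_on_def
  using adj_setD[OF X] by (auto simp: \<Psi>_def X_oadd X_oscale X_oadd' X_oscale' adjoint_oadd adjoint_oscale)

lemma bilinear_\<Theta>: "bilinear_on (adj_set Y) Y \<Theta>"
  unfolding bilinear_on_def linear_on_def
  using adj_setD[OF Y] by (auto simp: \<Theta>_def Y_oadd Y_oscale Y_oadd' Y_oscale' adjoint_oadd adjoint_oscale)

lemma X_contraction:
  assumes "x \<in> Mn n X" "mnorm n x \<le> 1"
  shows "nsq {..<n} (\<lambda>k. \<Sum>i<n. adjoint (x i k) (\<xi> i)) \<le> nsq {..<n} \<xi>"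
proof (rule adjoint_contraction)
  have "x \<in> Mn n Bop" using assms(1) XB by (auto simp: Mn_def)
  then show "nsq {..<n} (\<lambda>i. \<Sum>j<n. x i j (\<xi> j)) \<le> nsq {..<n} \<xi>" for \<xi>
    using assms(2) by (rule mnorm_contraction)
qed (use assms XB in \<open>auto simp: Mn_def\<close>)

lemma Y_contraction:
  assumes "y \<in> Mn n Y" "mnorm n y \<le> 1"
  shows "nsq {..<n} (\<lambda>k. \<Sum>i<n. y k i (\<xi> i)) \<le> nsq {..<n} \<xi>"
proof -
  have "y \<in> Mn n Bop" using assms(1) YB by (auto simp: Mn_def)
  then show ?thesis using assms(2) by (rule mnorm_contraction)
qed

text \<open>The cross inequality, summed over the inner index k, is additive in a and b; optimising
  the scale gives the product of roots. With a = b = c it bounds \<Psi> and \<Theta>, and with their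
  own cb norms as a and b it bounds \<phi>.\<close>

lemma amp_cross_le:
  assumes A: "\<And>i j v. i < n \<Longrightarrow> j < n \<Longrightarrow> A i j v = (\<Sum>k<n. \<kappa> (t i k) (u k j) v)"
    and t: "\<And>z. (\<Sum>k<n. Re (kform \<kappa> n (\<lambda>i. t i k) z)) \<le> a * nsq {..<n} z"
    and u: "\<And>z. (\<Sum>k<n. Re (kform \<kappa> n (\<lambda>i. u k i) z)) \<le> b * nsq {..<n} z"
    and ab: "0 \<le> a" "0 \<le> b"
  shows "mnorm n A \<le> sqrt a * sqrt b"
proof (rule mnorm_le)
  fix \<xi>
  have "nsq {..<n} (\<lambda>i. \<Sum>j<n. A i j (\<xi> j)) \<le> (b * nsq {..<n} \<xi>) * a"
  proof (rule nsq_le_of_dual[OF _ ab(1)])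
    fix \<eta>
    have "(\<Sum>i<n. cinner (\<Sum>j<n. A i j (\<xi> j)) (\<eta> i)) = (\<Sum>i<n. \<Sum>j<n. \<Sum>k<n. cinner (\<kappa> (t i k) (u k j) (\<xi> j)) (\<eta> i))"
      by (simp add: A cinner_sum_left)
    also have "\<dots> = (\<Sum>i<n. \<Sum>k<n. \<Sum>j<n. cinner (\<kappa> (t i k) (u k j) (\<xi> j)) (\<eta> i))"
      by (intro sum.cong refl sum.swap)
    also have "\<dots> = (\<Sum>k<n. \<Sum>i<n. \<Sum>j<n. cinner (\<kappa> (t i k) (u k j) (\<xi> j)) (\<eta> i))"
      by (rule sum.swap)
    finally have "2 * Re (\<Sum>i<n. cinner (\<Sum>j<n. A i j (\<xi> j)) (\<eta> i))
      = (\<Sum>k<n. 2 * Re (\<Sum>i<n. \<Sum>j<n. cinner (\<kappa> (t i k) (u k j) (\<xi> j)) (\<eta> i)))"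
      by (simp add: sum_distrib_left)
    also have "\<dots> \<le> (\<Sum>k<n. Re (kform \<kappa> n (\<lambda>i. t i k) \<eta>) + Re (kform \<kappa> n (\<lambda>i. u k i) \<xi>))"
      by (intro sum_mono pd_cross_le pd \<kappa>B)
    also have "\<dots> \<le> a * nsq {..<n} \<eta> + b * nsq {..<n} \<xi>"
      unfolding sum.distrib by (intro add_mono t u)
    finally show "2 * Re (\<Sum>i<n. cinner (\<Sum>j<n. A i j (\<xi> j)) (\<eta> i)) \<le> b * nsq {..<n} \<xi> + a * nsq {..<n} \<eta>"
      by simp
  qed
  then show "nsq {..<n} (\<lambda>i. \<Sum>j<n. A i j (\<xi> j)) \<le> (sqrt a * sqrt b)\<^sup>2 * nsq {..<n} \<xi>"
    using ab by (simp add: power_mult_distrib mult_ac)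
qed (use ab in simp)

lemma adj_matrix:
  assumes W: "opspace W" and z: "z \<in> Mn n (adj_set W)"
  shows "(\<lambda>i k. adjoint (z k i)) \<in> Mn n W" "z \<in> Mn n Bop"
  using adj_setD[OF W] z by (auto simp: Mn_def)

lemma \<Psi>_val_le:
  assumes "r \<in> cb_vals_bil X (adj_set X) \<Psi>"
  shows "r \<le> c"
proof -
  obtain n x z where r: "r = mnorm n (amp2 n \<Psi> x z)" and x: "x \<in> Mn n X" "mnorm n x \<le> 1"
    and z: "z \<in> Mn n (adj_set X)" "mnorm n z \<le> 1"
    using assms unfolding cb_vals_bil_def by blast
  have "mnorm n (amp2 n \<Psi> x z) \<le> sqrt c * sqrt c"
  proof (rule amp_cross_le[where t = "\<lambda>i k. Inl (x i k)" and u = "\<lambda>k j. Inl (adjoint (z k j))"])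
    show "(\<Sum>k<n. Re (kform \<kappa> n (\<lambda>i. Inl (x i k)) w)) \<le> c * nsq {..<n} w" for w
      using x(1) X_contraction[OF x] by (rule X_bound)
    show "(\<Sum>k<n. Re (kform \<kappa> n (\<lambda>i. Inl (adjoint (z k i))) w)) \<le> c * nsq {..<n} w" for w
    proof (rule X_bound[OF adj_matrix(1)[OF X z(1)]])
      fix \<xi>
      have "nsq {..<n} (\<lambda>k. \<Sum>i<n. adjoint (adjoint (z k i)) (\<xi> i)) = nsq {..<n} (\<lambda>k. \<Sum>i<n. z k i (\<xi> i))"
        unfolding nsq_def using adjoint_adjoint[OF MnD[OF adj_matrix(2)[OF X z(1)]]]
        by (intro sum.cong refl arg_cong[where f = "\<lambda>x. (cnorm x)\<^sup>2"]) auto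
      then show "nsq {..<n} (\<lambda>k. \<Sum>i<n. adjoint (adjoint (z k i)) (\<xi> i)) \<le> nsq {..<n} \<xi>"
        using mnorm_contraction[OF adj_matrix(2)[OF X z(1)] z(2)] by simp
    qed
  qed (use c in \<open>auto simp: amp2_def \<Psi>_def\<close>)
  then show ?thesis using c r by simp
qed

lemma \<Theta>_val_le:
  assumes "r \<in> cb_vals_bil (adj_set Y) Y \<Theta>"
  shows "r \<le> c"
proof -
  obtain n z y where r: "r = mnorm n (amp2 n \<Theta> z y)" and y: "y \<in> Mn n Y" "mnorm n y \<le> 1"
    and z: "z \<in> Mn n (adj_set Y)" "mnorm n z \<le> 1"
    using assms unfolding cb_vals_bil_def by blast
  have "mnorm n (amp2 n \<Theta> z y) \<le> sqrt c * sqrt c"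
  proof (rule amp_cross_le[where t = "\<lambda>i k. Inr (adjoint (z i k))" and u = "\<lambda>k j. Inr (y k j)"])
    show "(\<Sum>k<n. Re (kform \<kappa> n (\<lambda>i. Inr (y k i)) w)) \<le> c * nsq {..<n} w" for w
      using y(1) Y_contraction[OF y] by (rule Y_bound)
    show "(\<Sum>k<n. Re (kform \<kappa> n (\<lambda>i. Inr (adjoint (z i k))) w)) \<le> c * nsq {..<n} w" for w
    proof (rule Y_bound[OF adj_matrix(1)[OF Y z(1)]])
      show "nsq {..<n} (\<lambda>k. \<Sum>i<n. adjoint (z i k) (\<xi> i)) \<le> nsq {..<n} \<xi>" for \<xi>
        by (rule adjoint_contraction[OF _ mnorm_contraction[OF adj_matrix(2)[OF Y z(1)] z(2)]])
          (use MnD[OF adj_matrix(2)[OF Y z(1)]] in auto)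
    qed
  qed (use c in \<open>auto simp: amp2_def \<Theta>_def\<close>)
  then show ?thesis using c r by simp
qed

lemma cb_\<Psi>: "cb_bil X (adj_set X) \<Psi>"
  using \<Psi>_val_le unfolding cb_bil_def bdd_above_def by blast

lemma cb_\<Theta>: "cb_bil (adj_set Y) Y \<Theta>"
  using \<Theta>_val_le unfolding cb_bil_def bdd_above_def by blast

lemma cb_vals_nonempty:
  assumes "(\<lambda>v. 0) \<in> V" "(\<lambda>v. 0) \<in> W" "f (\<lambda>v. 0) (\<lambda>v. 0) \<in> Bop"
  shows "\<exists>r\<ge>0. r \<in> cb_vals_bil V W f"
proof -
  let ?o = "\<lambda>_ _ v. 0"
  have "mnorm 1 (amp2 1 f ?o ?o) \<in> cb_vals_bil V W f"
    unfolding cb_vals_bil_def using assms(1,2) by (intro CollectI exI[of _ 1] exI[of _ ?o]) (auto simp: Mn_def)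
  moreover have "0 \<le> mnorm 1 (amp2 1 f ?o ?o)"
    by (rule mnorm_ge0) (use assms(3) in \<open>simp add: Mn_def amp2_def\<close>)
  ultimately show ?thesis by blast
qed

lemma cbnorm_bounds:
  assumes "(\<lambda>v. 0) \<in> V" "(\<lambda>v. 0) \<in> W" "f (\<lambda>v. 0) (\<lambda>v. 0) \<in> Bop"
    and le: "\<And>r. r \<in> cb_vals_bil V W f \<Longrightarrow> r \<le> c"
  shows "0 \<le> cbnorm_bil V W f \<and> cbnorm_bil V W f \<le> c"
proof -
  obtain r where r: "r \<ge> 0" "r \<in> cb_vals_bil V W f" using cb_vals_nonempty[of V W f, OF assms(1-3)] by blast
  then have "r \<le> cbnorm_bil V W f"
    unfolding cbnorm_bil_def using le by (intro cSup_upper bdd_aboveI) auto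
  then show ?thesis unfolding cbnorm_bil_def using r le by (auto intro!: cSup_least)
qed

lemma cbnorm_\<Psi>: "0 \<le> cbnorm_bil X (adj_set X) \<Psi> \<and> cbnorm_bil X (adj_set X) \<Psi> \<le> c"
  by (rule cbnorm_bounds[OF _ _ _ \<Psi>_val_le])
    (use opspace_zero[OF X] \<kappa>B in \<open>auto simp: adj_set_def \<Psi>_def intro: image_eqI[of _ _ "\<lambda>v. 0"]\<close>)

lemma cbnorm_\<Theta>: "0 \<le> cbnorm_bil (adj_set Y) Y \<Theta> \<and> cbnorm_bil (adj_set Y) Y \<Theta> \<le> c"
  by (rule cbnorm_bounds[OF _ _ _ \<Theta>_val_le])
    (use opspace_zero[OF Y] \<kappa>B in \<open>auto simp: adj_set_def \<Theta>_def intro: image_eqI[of _ _ "\<lambda>v. 0"]\<close>)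

text \<open>The way back from the norm of an amplification to the forms of the kernel. It provides
  the bounds on forms with the actual cb norms of \<Psi> and \<Theta> in place of c.\<close>

lemma kform_amp:
  assumes B: "A \<in> Mn n Bop" and m: "mnorm n A \<le> a"
    and A: "\<And>i j v. i < n \<Longrightarrow> j < n \<Longrightarrow> A i j v = (\<Sum>k<n. \<kappa> (t i k) (t j k) v)"
  shows "(\<Sum>k<n. Re (kform \<kappa> n (\<lambda>i. t i k) z)) \<le> a * nsq {..<n} z"
proof -
  have "(\<Sum>k<n. kform \<kappa> n (\<lambda>i. t i k) z) = (\<Sum>i<n. \<Sum>k<n. \<Sum>j<n. cinner (\<kappa> (t i k) (t j k) (z j)) (z i))"
    unfolding kform_def by (rule sum.swap)
  also have "\<dots> = (\<Sum>i<n. \<Sum>j<n. \<Sum>k<n. cinner (\<kappa> (t i k) (t j k) (z j)) (z i))"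
    by (intro sum.cong refl sum.swap)
  also have "\<dots> = (\<Sum>i<n. cinner (\<Sum>j<n. A i j (z j)) (z i))"
    by (simp add: A cinner_sum_left)
  finally have "(\<Sum>k<n. Re (kform \<kappa> n (\<lambda>i. t i k) z)) = Re (\<Sum>i<n. cinner (\<Sum>j<n. A i j (z j)) (z i))"
    by (metis Re_sum)
  also have "\<dots> \<le> a * nsq {..<n} z"
  proof (rule Re_sum_cinner_le)
    have "(mnorm n A)\<^sup>2 \<le> a\<^sup>2" using m mnorm_ge0[OF B] by (intro power_mono) auto
    then have "(mnorm n A)\<^sup>2 * nsq {..<n} z \<le> a\<^sup>2 * nsq {..<n} z" by (intro mult_right_mono) auto
    then show "nsq {..<n} (\<lambda>i. \<Sum>j<n. A i j (z j)) \<le> a\<^sup>2 * nsq {..<n} z"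
      using mnorm_bound(1)[OF B, of z] by linarith
  qed (use m mnorm_ge0[OF B] in auto)
  finally show ?thesis .
qed

lemma adjoint_matrix_norm:
  assumes "x \<in> Mn n Bop" "mnorm n x \<le> 1"
  shows "mnorm n (\<lambda>i j. adjoint (x j i)) \<le> 1"
proof (rule mnorm_le)
  show "nsq {..<n} (\<lambda>i. \<Sum>j<n. adjoint (x j i) (\<xi> j)) \<le> 1\<^sup>2 * nsq {..<n} \<xi>" for \<xi>
    using adjoint_contraction[OF _ mnorm_contraction[OF assms], of \<xi>] MnD[OF assms(1)] by simp
qed simp

lemma \<phi>_val_le:
  assumes "r \<in> cb_vals_bil X Y \<phi>"
  shows "r \<le> sqrt (cbnorm_bil X (adj_set X) \<Psi>) * sqrt (cbnorm_bil (adj_set Y) Y \<Theta>)"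
proof -
  obtain n x y where r: "r = mnorm n (amp2 n \<phi> x y)" and n: "n \<ge> 1" and x: "x \<in> Mn n X" "mnorm n x \<le> 1"
    and y: "y \<in> Mn n Y" "mnorm n y \<le> 1"
    using assms unfolding cb_vals_bil_def by blast
  have xB: "x \<in> Mn n Bop" and yB: "y \<in> Mn n Bop" using x y XB YB by (auto simp: Mn_def)
  show ?thesis
    unfolding r
  proof (rule amp_cross_le[where t = "\<lambda>i k. Inl (x i k)" and u = "\<lambda>k j. Inr (y k j)"])
    show "amp2 n \<phi> x y i j v = (\<Sum>k<n. \<kappa> (Inl (x i k)) (Inr (y k j)) v)" if "i < n" "j < n" for i j v
      using that x(1) y(1) by (simp add: amp2_def corner Mn_def)
    \<comment> \<open>Adjoint matrices: the amplification of \<Psi> at x and \<open>?x\<close> has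
      as entry (i, j) the sum over k of \<kappa> at x i k and x j k, which is a form of the
      kernel.\<close>
    let ?x = "\<lambda>i j. adjoint (x j i)" and ?y = "\<lambda>i j. adjoint (y j i)"
    show "(\<Sum>k<n. Re (kform \<kappa> n (\<lambda>i. Inl (x i k)) z)) \<le> cbnorm_bil X (adj_set X) \<Psi> * nsq {..<n} z" for z
    proof (rule kform_amp[where A = "amp2 n \<Psi> x ?x"])
      show "amp2 n \<Psi> x ?x \<in> Mn n Bop" by (auto simp: Mn_def amp2_def \<Psi>_def intro!: Bop_sum_op \<kappa>B)
      have "mnorm n (amp2 n \<Psi> x ?x) \<in> cb_vals_bil X (adj_set X) \<Psi>"
        unfolding cb_vals_bil_def using n x adjoint_matrix_norm[OF xB x(2)]
        by (intro CollectI exI[of _ n] exI[of _ x] exI[of _ ?x]) (auto simp: Mn_def adj_set_def)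
      then show "mnorm n (amp2 n \<Psi> x ?x) \<le> cbnorm_bil X (adj_set X) \<Psi>"
        unfolding cbnorm_bil_def using cb_\<Psi> by (intro cSup_upper) (auto simp: cb_bil_def)
      show "amp2 n \<Psi> x ?x i j v = (\<Sum>k<n. \<kappa> (Inl (x i k)) (Inl (x j k)) v)" if "i < n" "j < n" for i j v
        using that by (simp add: amp2_def \<Psi>_def adjoint_adjoint MnD[OF xB])
    qed
    show "(\<Sum>k<n. Re (kform \<kappa> n (\<lambda>i. Inr (y k i)) z)) \<le> cbnorm_bil (adj_set Y) Y \<Theta> * nsq {..<n} z" for z
    proof (rule kform_amp[where A = "amp2 n \<Theta> ?y y" and t = "\<lambda>i k. Inr (y k i)"])
      show "amp2 n \<Theta> ?y y \<in> Mn n Bop" by (auto simp: Mn_def amp2_def \<Theta>_def intro!: Bop_sum_op \<kappa>B)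
      have "mnorm n (amp2 n \<Theta> ?y y) \<in> cb_vals_bil (adj_set Y) Y \<Theta>"
        unfolding cb_vals_bil_def using n y adjoint_matrix_norm[OF yB y(2)]
        by (intro CollectI exI[of _ n] exI[of _ ?y] exI[of _ y]) (auto simp: Mn_def adj_set_def)
      then show "mnorm n (amp2 n \<Theta> ?y y) \<le> cbnorm_bil (adj_set Y) Y \<Theta>"
        unfolding cbnorm_bil_def using cb_\<Theta> by (intro cSup_upper) (auto simp: cb_bil_def)
      show "amp2 n \<Theta> ?y y i j v = (\<Sum>k<n. \<kappa> (Inr (y k i)) (Inr (y k j)) v)" if "i < n" "j < n" for i j v
        using that by (simp add: amp2_def \<Theta>_def adjoint_adjoint MnD[OF yB])
    qed
  qed (use cbnorm_\<Psi> cbnorm_\<Theta> in auto)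
qed

text \<open>Both roots are at most the root of c, and their product dominates every value of \<phi>.
  As c is the norm of \<phi>, equality is forced.\<close>

lemma norm_identity:
  assumes "c = cbnorm_bil X Y \<phi>"
  shows "cbnorm_bil X Y \<phi> = sqrt (cbnorm_bil X (adj_set X) \<Psi>) * sqrt (cbnorm_bil (adj_set Y) Y \<Theta>)"
proof (rule antisym)
  have "\<phi> (\<lambda>v. 0) (\<lambda>v. 0) \<in> Bop"
    using corner[OF opspace_zero[OF X] opspace_zero[OF Y]] \<kappa>B by metis
  then have "cb_vals_bil X Y \<phi> \<noteq> {}"
    using cb_vals_nonempty[OF opspace_zero[OF X] opspace_zero[OF Y]] by blast
  then show "cbnorm_bil X Y \<phi> \<le> sqrt (cbnorm_bil X (adj_set X) \<Psi>) * sqrt (cbnorm_bil (adj_set Y) Y \<Theta>)"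
    unfolding cbnorm_bil_def[of X Y] using \<phi>_val_le by (intro cSup_least) auto
  have "sqrt (cbnorm_bil X (adj_set X) \<Psi>) * sqrt (cbnorm_bil (adj_set Y) Y \<Theta>) \<le> sqrt c * sqrt c"
    using cbnorm_\<Psi> cbnorm_\<Theta> c by (intro mult_mono real_sqrt_le_mono) auto
  then show "sqrt (cbnorm_bil X (adj_set X) \<Psi>) * sqrt (cbnorm_bil (adj_set Y) Y \<Theta>) \<le> cbnorm_bil X Y \<phi>"
    using c assms by simp
qed

text \<open>A linear relation in X or Y makes the form of \<kappa> vanish at suitable vectors, and
  the domination then annihilates the same combination of adjoints of v. Linearity is thus obtained
  for the adjoints, with conjugate scalars on X.\<close>

lemma component_properties:
  fixes v :: "('h1 \<Rightarrow> 'h1) + ('h2 \<Rightarrow> 'h2) \<Rightarrow> ('k \<Rightarrow> 'k)"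
  assumes vN: "\<And>s. v s \<in> N"
    and dom: "\<And>n t \<xi>. (cnorm (\<Sum>i<n. adjoint (v (t i)) (\<xi> i)))\<^sup>2 \<le> Re (kform \<kappa> n t \<xi>)"
  shows "linear_on X (\<lambda>x. v (Inl x))" "cb_lin X (\<lambda>x. v (Inl x))"
    and "linear_on Y (\<lambda>y. adjoint (v (Inr y)))" "cb_lin Y (\<lambda>y. adjoint (v (Inr y)))"
proof -
  have vB: "v s \<in> Bop" for s using N vN by (rule vN_BopD)
  have null: "(\<Sum>i<n. adjoint (v (t i)) (\<xi> i)) = 0" if "kform \<kappa> n t \<xi> = 0" for n t \<xi>
    using dom[where n = n and t = t and \<xi> = \<xi>] that by simp
  have sum3: "adjoint (v t0) \<zeta> = adjoint (v t1) \<zeta> + adjoint (v t2) \<zeta>"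
    if "kform \<kappa> 3 (\<lambda>i. if i = 0 then t0 else if i = 1 then t1 else t2) (\<lambda>i. if i = 0 then \<zeta> else - \<zeta>) = 0" for t0 t1 t2 \<zeta>
    using null[OF that] by (simp add: numeral_3_eq_3 Bop_minus[OF adjoint_Bop[OF vB]] algebra_simps)
  have sum2: "adjoint (v t0) \<zeta> = scaleC d (adjoint (v t1) \<zeta>)"
    if "kform \<kappa> 2 (\<lambda>i. if i = 0 then t0 else t1) (\<lambda>i. if i = 0 then \<zeta> else - scaleC d \<zeta>) = 0" for t0 t1 \<zeta> d
    using null[OF that] by (simp add: numeral_2_eq_2 Bop_minus[OF adjoint_Bop[OF vB]] Bop_scale[OF adjoint_Bop[OF vB]])
  show "linear_on X (\<lambda>x. v (Inl x))"
    unfolding linear_on_def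
  proof (intro conjI ballI allI)
    fix a b assume ab: "a \<in> X" "b \<in> X"
    have "adjoint (v (Inl (oadd a b))) \<zeta> = adjoint (v (Inl a)) \<zeta> + adjoint (v (Inl b)) \<zeta>" for \<zeta>
      by (rule sum3) (use ab X_closed in \<open>simp add: kform_def numeral_3_eq_3 X_oadd X_oadd', simp add: oadd_def cinner_simps Bop_minus[OF \<kappa>B]\<close>)
    then have "adjoint (v (Inl (oadd a b))) = oadd (adjoint (v (Inl a))) (adjoint (v (Inl b)))"
      by (auto simp: oadd_def)
    then have "adjoint (adjoint (v (Inl (oadd a b)))) = adjoint (oadd (adjoint (v (Inl a))) (adjoint (v (Inl b))))" by simp
    then show "v (Inl (oadd a b)) = oadd (v (Inl a)) (v (Inl b))"
      by (simp add: adjoint_oadd adjoint_adjoint adjoint_Bop vB)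
  next
    fix d a assume a: "a \<in> X"
    have "adjoint (v (Inl (oscale d a))) \<zeta> = scaleC (cnj d) (adjoint (v (Inl a)) \<zeta>)" for \<zeta>
      by (rule sum2) (use a X_closed in \<open>simp add: kform_def numeral_2_eq_2 X_oscale X_oscale', simp add: oscale_def cinner_simps Bop_minus[OF \<kappa>B] Bop_scale[OF \<kappa>B]\<close>)
    then have "adjoint (v (Inl (oscale d a))) = oscale (cnj d) (adjoint (v (Inl a)))"
      by (auto simp: oscale_def)
    then have "adjoint (adjoint (v (Inl (oscale d a)))) = adjoint (oscale (cnj d) (adjoint (v (Inl a))))" by simp
    then show "v (Inl (oscale d a)) = oscale d (v (Inl a))"
      by (simp add: adjoint_oscale adjoint_adjoint adjoint_Bop vB)
  qed
  show "linear_on Y (\<lambda>y. adjoint (v (Inr y)))"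
    unfolding linear_on_def
  proof (intro conjI ballI allI)
    fix a b assume ab: "a \<in> Y" "b \<in> Y"
    have "adjoint (v (Inr (oadd a b))) \<zeta> = adjoint (v (Inr a)) \<zeta> + adjoint (v (Inr b)) \<zeta>" for \<zeta>
      by (rule sum3) (use ab Y_closed in \<open>simp add: kform_def numeral_3_eq_3 Y_oadd Y_oadd', simp add: oadd_def cinner_simps Bop_minus[OF \<kappa>B]\<close>)
    then show "adjoint (v (Inr (oadd a b))) = oadd (adjoint (v (Inr a))) (adjoint (v (Inr b)))"
      by (auto simp: oadd_def)
  next
    fix d a assume a: "a \<in> Y"
    have "adjoint (v (Inr (oscale d a))) \<zeta> = scaleC d (adjoint (v (Inr a)) \<zeta>)" for \<zeta>
      by (rule sum2) (use a Y_closed in \<open>simp add: kform_def numeral_2_eq_2 Y_oscale Y_oscale', simp add: oscale_def cinner_simps Bop_minus[OF \<kappa>B] Bop_scale[OF \<kappa>B]\<close>)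
    then show "adjoint (v (Inr (oscale d a))) = oscale d (adjoint (v (Inr a)))"
      by (auto simp: oscale_def)
  qed
  show "cb_lin X (\<lambda>x. v (Inl x))"
    unfolding cb_lin_def bdd_above_def
  proof (intro exI[of _ "sqrt c"] ballI)
    fix r assume "r \<in> cb_vals_lin X (\<lambda>x. v (Inl x))"
    then obtain n x where r: "r = mnorm n (\<lambda>i j. v (Inl (x i j)))" and x: "x \<in> Mn n X" "mnorm n x \<le> 1"
      unfolding cb_vals_lin_def by blast
    have adj: "nsq {..<n} (\<lambda>j. \<Sum>i<n. adjoint (v (Inl (x i j))) (\<eta> i)) \<le> c * nsq {..<n} \<eta>" for \<eta>
    proof -
      have "nsq {..<n} (\<lambda>j. \<Sum>i<n. adjoint (v (Inl (x i j))) (\<eta> i)) \<le> (\<Sum>k<n. Re (kform \<kappa> n (\<lambda>i. Inl (x i k)) \<eta>))"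
        unfolding nsq_def by (intro sum_mono dom)
      also have "\<dots> \<le> c * nsq {..<n} \<eta>" using x(1) X_contraction[OF x] by (rule X_bound)
      finally show ?thesis .
    qed
    show "r \<le> sqrt c"
      unfolding r
    proof (rule mnorm_le)
      fix \<xi>
      \<comment> \<open>The domination controls the matrix of adjoints; passing to the adjoint
        matrix returns to v with the same constant c.\<close>
      show "nsq {..<n} (\<lambda>i. \<Sum>j<n. v (Inl (x i j)) (\<xi> j)) \<le> (sqrt c)\<^sup>2 * nsq {..<n} \<xi>"
        using adjoint_bound[of "{..<n}" "{..<n}" "\<lambda>j i. adjoint (v (Inl (x i j)))" c \<xi>, OF adjoint_Bop[OF vB] adj c] c
        by (simp add: adjoint_adjoint vB)
    qed (use c in simp)
  qed
  show "cb_lin Y (\<lambda>y. adjoint (v (Inr y)))"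
    unfolding cb_lin_def bdd_above_def
  proof (intro exI[of _ "sqrt c"] ballI)
    fix r assume "r \<in> cb_vals_lin Y (\<lambda>y. adjoint (v (Inr y)))"
    then obtain n y where r: "r = mnorm n (\<lambda>i j. adjoint (v (Inr (y i j))))" and y: "y \<in> Mn n Y" "mnorm n y \<le> 1"
      unfolding cb_vals_lin_def by blast
    show "r \<le> sqrt c"
      unfolding r
    proof (rule mnorm_le)
      fix \<xi>
      have "nsq {..<n} (\<lambda>i. \<Sum>j<n. adjoint (v (Inr (y i j))) (\<xi> j)) \<le> (\<Sum>k<n. Re (kform \<kappa> n (\<lambda>i. Inr (y k i)) \<xi>))"
        unfolding nsq_def by (intro sum_mono dom)
      also have "\<dots> \<le> c * nsq {..<n} \<xi>" using y(1) Y_contraction[OF y] by (rule Y_bound)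
      finally show "nsq {..<n} (\<lambda>i. \<Sum>j<n. adjoint (v (Inr (y i j))) (\<xi> j)) \<le> (sqrt c)\<^sup>2 * nsq {..<n} \<xi>"
        using c by simp
    qed (use c in simp)
  qed
qed

theorem factorization:
  obtains \<Lambda> :: "((('h1 \<Rightarrow> 'h1) \<Rightarrow> ('k \<Rightarrow> 'k)) \<times> (('h2 \<Rightarrow> 'h2) \<Rightarrow> ('k \<Rightarrow> 'k))) set"
  where "\<And>p. p \<in> \<Lambda> \<Longrightarrow> linear_on X (fst p) \<and> cb_lin X (fst p) \<and> fst p ` X \<subseteq> N
            \<and> linear_on Y (snd p) \<and> cb_lin Y (snd p) \<and> snd p ` Y \<subseteq> N"
    and "\<And>x y. x \<in> X \<Longrightarrow> y \<in> Y \<Longrightarrow> wsum \<Lambda> (\<lambda>p. fst p x \<circ> snd p y) (\<phi> x y)"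
    and "\<And>x1 x2. x1 \<in> X \<Longrightarrow> x2 \<in> X \<Longrightarrow> wsum \<Lambda> (\<lambda>p. fst p x1 \<circ> adjoint (fst p x2)) (\<Psi> x1 (adjoint x2))"
    and "\<And>y1 y2. y1 \<in> Y \<Longrightarrow> y2 \<in> Y \<Longrightarrow> wsum \<Lambda> (\<lambda>p. adjoint (snd p y1) \<circ> snd p y2) (\<Theta> (adjoint y1) y2)"
proof -
  obtain F :: "(('h1 \<Rightarrow> 'h1) + ('h2 \<Rightarrow> 'h2) \<Rightarrow> 'k \<Rightarrow> 'k) set"
    where FN: "\<And>v s. v \<in> F \<Longrightarrow> v s \<in> N"
    and dom: "\<And>v n t \<xi>. v \<in> F \<Longrightarrow> (cnorm (\<Sum>i<n. adjoint (v (t i)) (\<xi> i)))\<^sup>2 \<le> Re (kform \<kappa> n t \<xi>)"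
    and F: "\<And>s t. wsum F (\<lambda>v. v s \<circ> adjoint (v t)) (\<kappa> s t)"
    using kernel_decomposition[OF N \<kappa>N pd] by blast
  have FB: "v s \<in> Bop" if "v \<in> F" for v s using N FN[OF that] by (rule vN_BopD)
  define G where "G v = (\<lambda>x. v (Inl x), \<lambda>y. adjoint (v (Inr y)))"
    for v :: "('h1 \<Rightarrow> 'h1) + ('h2 \<Rightarrow> 'h2) \<Rightarrow> 'k \<Rightarrow> 'k"
  \<comment> \<open>\<Lambda> is a set of pairs, so distinct v have to give distinct pairs for the
    sums over F to be reindexed. The second component loses nothing because taking adjoints is
    injective on \<open>Bop\<close>.\<close>
  have inj: "inj_on G F"
  proof (rule inj_onI)
    fix v w assume vw: "v \<in> F" "w \<in> F" "G v = G w"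
    have "v s = w s" for s
    proof (cases s)
      case (Inl x)
      then show ?thesis using vw(3) by (auto simp: G_def dest: fun_cong)
    next
      case (Inr y)
      have "adjoint (v (Inr y)) = adjoint (w (Inr y))" using vw(3) by (auto simp: G_def dest: fun_cong)
      then have "adjoint (adjoint (v (Inr y))) = adjoint (adjoint (w (Inr y)))" by simp
      then show ?thesis using Inr vw FB by (simp add: adjoint_adjoint)
    qed
    then show "v = w" by auto
  qed
  have reindex: "wsum (G ` F) f T" if "wsum F g T" "\<And>v. v \<in> F \<Longrightarrow> f (G v) = g v" for f g T
    unfolding wsum_def
  proof (intro allI)
    fix \<xi> \<eta>
    have "((\<lambda>v. cinner (g v \<xi>) \<eta>) has_sum cinner (T \<xi>) \<eta>) F" using that(1) by (simp add: wsum_def)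
    then have "((\<lambda>v. cinner (f (G v) \<xi>) \<eta>) has_sum cinner (T \<xi>) \<eta>) F"
      using that(2) has_sum_cong[of F "\<lambda>v. cinner (f (G v) \<xi>) \<eta>" "\<lambda>v. cinner (g v \<xi>) \<eta>"] by simp
    then show "((\<lambda>p. cinner (f p \<xi>) \<eta>) has_sum cinner (T \<xi>) \<eta>) (G ` F)"
      by (simp add: has_sum_reindex[OF inj] o_def)
  qed
  show ?thesis
  proof (rule that[of "G ` F"])
    fix p assume "p \<in> G ` F"
    then obtain v where v: "v \<in> F" and p: "p = G v" by blast
    note props = component_properties[OF FN[OF v] dom[OF v]]
    show "linear_on X (fst p) \<and> cb_lin X (fst p) \<and> fst p ` X \<subseteq> N \<and> linear_on Y (snd p) \<and> cb_lin Y (snd p) \<and> snd p ` Y \<subseteq> N"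
      using props FN[OF v] vN_adjoint[OF N FN[OF v]] by (auto simp: p G_def)
  next
    show "wsum (G ` F) (\<lambda>p. fst p x \<circ> snd p y) (\<phi> x y)" if "x \<in> X" "y \<in> Y" for x y
      using F[of "Inl x" "Inr y"] unfolding corner[OF that] by (rule reindex) (simp add: G_def)
    show "wsum (G ` F) (\<lambda>p. fst p x1 \<circ> adjoint (fst p x2)) (\<Psi> x1 (adjoint x2))" if "x1 \<in> X" "x2 \<in> X" for x1 x2
      unfolding \<Psi>_def adjoint_adjoint[OF XB[OF that(2)]]
      using F[of "Inl x1" "Inl x2"] by (rule reindex) (simp add: G_def)
    show "wsum (G ` F) (\<lambda>p. adjoint (snd p y1) \<circ> snd p y2) (\<Theta> (adjoint y1) y2)" if "y1 \<in> Y" "y2 \<in> Y" for y1 y2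
      unfolding \<Theta>_def adjoint_adjoint[OF YB[OF that(1)]]
      using F[of "Inr y1" "Inr y2"] by (rule reindex) (simp add: G_def adjoint_adjoint FB)
  qed
qed

end

section \<open>Projecting the averaged kernel into the algebra\<close>

lemma opspace_Bop_whole: "opspace Bop"
  by (auto simp: opspace_def Bop_0 Bop_oadd Bop_oscale)

text \<open>The matrix c 1 - B is positive, E preserves this, and linearity with E 1 = 1 turns it
  into positivity of c 1 - E(B).\<close>

lemma cp_unital_form_bound:
  fixes E :: "('k::chilbert \<Rightarrow> 'k) \<Rightarrow> ('k \<Rightarrow> 'k)" and n :: nat
  assumes lin: "linear_on Bop E" and cp: "cp_on Bop E" and unit: "E (\<lambda>v. v) = (\<lambda>v. v)"
    and B: "\<And>i j. i < n \<Longrightarrow> j < n \<Longrightarrow> B i j \<in> Bop"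
    and bd: "\<And>z. \<exists>r. (\<Sum>i<n. \<Sum>j<n. cinner (B i j (z j)) (z i)) = complex_of_real r \<and> r \<le> c * nsq {..<n} z"
  shows "Re (\<Sum>i<n. \<Sum>j<n. cinner (E (B i j) (z j)) (z i)) \<le> c * nsq {..<n} z"
proof -
  define A where "A i j = oadd (oscale (of_bool (i = j) * of_real c) (\<lambda>v. v)) (oscale (-1) (B i j))" for i j
  have A: "A \<in> Mn n Bop" unfolding Mn_def A_def by (auto intro!: Bop_oadd Bop_oscale Bop_id B)
  have diag: "(\<Sum>i<n. \<Sum>j<n. cinner (scaleC (of_bool (i = j) * of_real c) (z j)) (z i)) = of_real (c * nsq {..<n} z)" for z :: "nat \<Rightarrow> 'k"
  proof -
    have "(\<Sum>j<n. cinner (scaleC (of_bool (i = j) * of_real c) (z j)) (z i)) = of_real c * cinner (z i) (z i)" if "i < n" for i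
      using that by (simp add: cinner_scaleC_left of_bool_def if_distrib[of "\<lambda>x. x * _"] cong: if_cong)
    then show ?thesis by (simp add: nsq_def cinner_self sum_distrib_left)
  qed
  have "mpositive n A"
    unfolding mpositive_def Let_def
  proof (intro allI)
    fix z
    obtain r where r: "(\<Sum>i<n. \<Sum>j<n. cinner (B i j (z j)) (z i)) = complex_of_real r" "r \<le> c * nsq {..<n} z"
      using bd by blast
    have "(\<Sum>i<n. \<Sum>j<n. cinner (A i j (z j)) (z i)) = of_real (c * nsq {..<n} z) - of_real r"
      unfolding r(1)[symmetric] diag[symmetric] sum_subtractf[symmetric]
      by (simp add: A_def oadd_def oscale_def cinner_simps)
    then show "Im (\<Sum>i<n. \<Sum>j<n. cinner (A i j (z j)) (z i)) = 0 \<and> 0 \<le> Re (\<Sum>i<n. \<Sum>j<n. cinner (A i j (z j)) (z i))"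
      using r(2) by simp
  qed
  then have "mpositive n (\<lambda>i j. E (A i j))" using cp A by (simp add: cp_on_def)
  then have "0 \<le> Re (\<Sum>i<n. \<Sum>j<n. cinner (E (A i j) (z j)) (z i))" by (simp add: mpositive_def Let_def)
  also have "(\<Sum>i<n. \<Sum>j<n. cinner (E (A i j) (z j)) (z i))
      = of_real (c * nsq {..<n} z) - (\<Sum>i<n. \<Sum>j<n. cinner (E (B i j) (z j)) (z i))"
    unfolding diag[symmetric] sum_subtractf[symmetric]
  proof (intro sum.cong refl)
    fix i j assume "i \<in> {..<n}" "j \<in> {..<n}"
    then have Bij: "B i j \<in> Bop" by (intro B) auto
    have "E (A i j) = oadd (oscale (of_bool (i = j) * of_real c) (E (\<lambda>v. v))) (oscale (-1) (E (B i j)))"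
      unfolding A_def using lin Bop_oscale[OF Bop_id] Bop_oscale[OF Bij] Bop_id Bij unfolding linear_on_def by metis
    then show "cinner (E (A i j) (z j)) (z i)
      = cinner (scaleC (of_bool (i = j) * of_real c) (z j)) (z i) - cinner (E (B i j) (z j)) (z i)"
      by (simp add: unit oadd_def oscale_def cinner_simps)
  qed
  finally show ?thesis by simp
qed

text \<open>Positivity of the block kernel is the domination inequality of the average, and the
  bounds of the diagonal blocks are averaged contraction inequalities. Complete positivity,
  linearity and unitality of E carry these properties over to N.\<close>

lemma (in cb_bilinear) dominating_kernel_exists:
  assumes N: "injective_vN N" and \<phi>N: "\<And>x y. x \<in> X \<Longrightarrow> y \<in> Y \<Longrightarrow> \<phi> x y \<in> N"
  shows "\<exists>\<kappa>. dominating_kernel X Y N \<phi> c \<kappa>"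
proof -
  have vN: "vN_algebra N" using N by (simp add: injective_vN_def)
  then have "vN_algebra Bop \<and> N \<subseteq> Bop" using vN_Bop by (auto simp: vN_algebra_def)
  then obtain E where lin: "linear_on Bop E" and cp: "cp_on Bop E" and EN: "\<And>T. T \<in> Bop \<Longrightarrow> E T \<in> N"
    and E_id: "\<And>T. T \<in> N \<Longrightarrow> E T = T"
    using N unfolding injective_vN_def by blast
  obtain s :: "(('k \<Rightarrow> 'h1) \<times> ('k \<Rightarrow> 'h2) \<Rightarrow> real) \<Rightarrow> real"
    where avg: "averaging dominated s fst c" "averaging dominated s snd c"
    and s\<phi>: "\<And>(n::nat) x y z. (\<And>i. x i \<in> X) \<Longrightarrow> (\<And>i. y i \<in> Y) \<Longrightarrow>
      2 * Re (\<Sum>i<n. \<Sum>j<n. cinner (\<phi> (x i) (y j) (z j)) (z i))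
      \<le> s (\<lambda>h. (cnorm (\<Sum>i<n. adjoint (x i) (fst h (z i))))\<^sup>2 + (cnorm (\<Sum>i<n. y i (snd h (z i))))\<^sup>2)"
    using averaging_functional by auto
  interpret A1: averaging dominated s fst c by (rule avg)
  interpret A2: averaging dominated s snd c by (rule avg)
  \<comment> \<open>P a b is the mean of h^* a b^* h over the first coordinate, hence linear in a; Q
    a b is the mean of h^* a^* b h over the second, hence linear in b.\<close>
  define P where "P a b = A1.avg (adjoint a) (adjoint b)" for a b
  define Q where "Q a b = A2.avg a b" for a b
  have PB: "P a b \<in> Bop" if "a \<in> X" "b \<in> X" for a b
    unfolding P_def using that by (intro A1.avg_Bop adjoint_Bop XB)
  have QB: "Q a b \<in> Bop" if "a \<in> Y" "b \<in> Y" for a b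
    unfolding Q_def using that by (intro A2.avg_Bop YB)
  have Plin: "linear_on X (\<lambda>x. P x a)" if "a \<in> X" for a
    unfolding linear_on_def P_def
    using adjoint_Bop[OF XB] adjoint_Bop[OF XB[OF that]]
    by (auto simp: adjoint_oadd adjoint_oscale XB A1.avg_oadd_left A1.avg_oscale_left)
  have P0: "P a (\<lambda>v. 0) = (\<lambda>v. 0)" if "a \<in> X" for a
    unfolding P_def using adjoint_Bop[OF XB[OF that]] by (simp add: A1.avg_zero_right)
  have Qlin: "linear_on Y (Q a)" if "a \<in> Y" for a
    unfolding linear_on_def Q_def using YB that by (auto simp: A2.avg_oadd_right A2.avg_oscale_right)
  have Q0: "Q (\<lambda>v. 0) a = (\<lambda>v. 0)" if "a \<in> Y" for a
    unfolding Q_def using YB[OF that] by (simp add: A2.avg_zero_left)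
  have pos: "mpositive n (\<lambda>i j v. P (x i) (x j) v + \<phi> (x i) (y j) v + adjoint (\<phi> (x j) (y i)) v + Q (y i) (y j) v)"
    if x: "\<And>i. x i \<in> X" and y: "\<And>i. y i \<in> Y" for n :: nat and x y
  proof -
    have "let w = (\<Sum>i<n. \<Sum>j<n. cinner (P (x i) (x j) (z j) + \<phi> (x i) (y j) (z j) + adjoint (\<phi> (x j) (y i)) (z j) + Q (y i) (y j) (z j)) (z i))
      in Im w = 0 \<and> 0 \<le> Re w" for z
    proof -
      let ?f = "\<lambda>h :: ('k \<Rightarrow> 'h1) \<times> ('k \<Rightarrow> 'h2). (cnorm (\<Sum>i<n. adjoint (x i) (fst h (z i))))\<^sup>2"
      let ?g = "\<lambda>h :: ('k \<Rightarrow> 'h1) \<times> ('k \<Rightarrow> 'h2). (cnorm (\<Sum>i<n. y i (snd h (z i))))\<^sup>2"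
      define R where "R = (\<Sum>i<n. \<Sum>j<n. cinner (\<phi> (x i) (y j) (z j)) (z i))"
      have f: "?f \<in> dominated" using adjoint_Bop[OF XB[OF x]] by (rule A1.V_sum_op)
      have g: "?g \<in> dominated" using YB[OF y] by (rule A2.V_sum_op)
      have "(\<Sum>i<n. \<Sum>j<n. cinner (adjoint (\<phi> (x j) (y i)) (z j)) (z i)) = (\<Sum>i<n. \<Sum>j<n. cnj (cinner (\<phi> (x j) (y i) (z i)) (z j)))"
        by (intro sum.cong refl) (simp add: cinner_adjoint'[OF \<phi>B[OF x y]] flip: cinner_commute)
      also have "\<dots> = cnj R" unfolding R_def cnj_sum by (rule sum.swap)
      finally have R': "(\<Sum>i<n. \<Sum>j<n. cinner (adjoint (\<phi> (x j) (y i)) (z j)) (z i)) = cnj R" .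
      have "(\<Sum>i<n. \<Sum>j<n. cinner (P (x i) (x j) (z j)) (z i)) = of_real (s ?f)"
        unfolding P_def using adjoint_Bop[OF XB[OF x]] by (rule A1.avg_form)
      moreover have "(\<Sum>i<n. \<Sum>j<n. cinner (Q (y i) (y j) (z j)) (z i)) = of_real (s ?g)"
        unfolding Q_def using YB[OF y] by (rule A2.avg_form)
      ultimately have w: "(\<Sum>i<n. \<Sum>j<n. cinner (P (x i) (x j) (z j) + \<phi> (x i) (y j) (z j) + adjoint (\<phi> (x j) (y i)) (z j) + Q (y i) (y j) (z j)) (z i))
          = of_real (s ?f) + R + cnj R + of_real (s ?g)"
        using R' by (simp add: cinner_add_left sum.distrib R_def[symmetric])
      \<comment> \<open>Replacing y by -y turns the upper bound for 2 Re R into the lower bound that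
        positivity requires.\<close>
      have "2 * Re (\<Sum>i<n. \<Sum>j<n. cinner (\<phi> (x i) (oscale (-1) (y j)) (z j)) (z i))
        \<le> s (\<lambda>h. ?f h + (cnorm (\<Sum>i<n. oscale (-1) (y i) (snd h (z i))))\<^sup>2)"
        by (rule s\<phi>) (use x y opspace_oscale[OF Y] in auto)
      also have "(\<Sum>i<n. \<Sum>j<n. cinner (\<phi> (x i) (oscale (-1) (y j)) (z j)) (z i)) = - R"
      proof -
        have "\<phi> (x i) (oscale (-1) (y j)) = oscale (-1) (\<phi> (x i) (y j))" for i j
          using bil x y unfolding bilinear_on_def linear_on_def by blast
        then show ?thesis by (simp add: oscale_def cinner_scaleC_left sum_negf R_def)
      qed
      also have "(\<lambda>h. ?f h + (cnorm (\<Sum>i<n. oscale (-1) (y i) (snd h (z i))))\<^sup>2) = (\<lambda>h. ?f h + ?g h)"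
        by (simp add: oscale_def scaleC_minus_left scaleC_one sum_negf)
      also have "s \<dots> = s ?f + s ?g" using f g by (rule A1.s_add)
      finally show ?thesis unfolding w Let_def by simp
    qed
    then show ?thesis unfolding mpositive_def by blast
  qed
  \<comment> \<open>The kernel must be defined and positive on the whole sum type. Operators outside
    X or Y are replaced by 0, and every point receives components in both spaces, at least one of
    them 0, so that one formula yields all four blocks.\<close>
  define xi where "xi t = (case t of Inl x \<Rightarrow> if x \<in> X then x else (\<lambda>v. 0) | Inr y \<Rightarrow> (\<lambda>v. 0))"
    for t :: "('h1 \<Rightarrow> 'h1) + ('h2 \<Rightarrow> 'h2)"
  define yi where "yi t = (case t of Inl x \<Rightarrow> (\<lambda>v. 0) | Inr y \<Rightarrow> if y \<in> Y then y else (\<lambda>v. 0))"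
    for t :: "('h1 \<Rightarrow> 'h1) + ('h2 \<Rightarrow> 'h2)"
  note X0 = opspace_zero[OF X] and Y0 = opspace_zero[OF Y]
  have xi: "xi t \<in> X" and yi: "yi t \<in> Y" for t
    using X0 Y0 by (auto simp: xi_def yi_def split: sum.split)
  define K where "K s t = (\<lambda>v. P (xi s) (xi t) v + \<phi> (xi s) (yi t) v + adjoint (\<phi> (xi t) (yi s)) v + Q (yi s) (yi t) v)" for s t
  have KB: "K s t \<in> Bop" for s t
  proof -
    have "K s t = oadd (oadd (oadd (P (xi s) (xi t)) (\<phi> (xi s) (yi t))) (adjoint (\<phi> (xi t) (yi s)))) (Q (yi s) (yi t))"
      by (simp add: K_def oadd_def)
    then show ?thesis using xi yi PB QB \<phi>B by (simp add: Bop_oadd adjoint_Bop)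
  qed
  have P0': "P (\<lambda>v. 0) a = (\<lambda>v. 0)" if "a \<in> X" for a using linear_on_zero[OF X Plin[OF that]] .
  have Q0': "Q a (\<lambda>v. 0) = (\<lambda>v. 0)" if "a \<in> Y" for a using linear_on_zero[OF Y Qlin[OF that]] .
  note zeros = P0 Q0 P0' Q0' \<phi>_zero_left \<phi>_zero_right X0 Y0
  have K_XX: "K (Inl a) (Inl b) = P a b" if "a \<in> X" "b \<in> X" for a b
    using that by (simp add: K_def xi_def yi_def zeros)
  have K_XY: "K (Inl a) (Inr b) = \<phi> a b" if "a \<in> X" "b \<in> Y" for a b
    using that by (simp add: K_def xi_def yi_def zeros)
  have K_YY: "K (Inr a) (Inr b) = Q a b" if "a \<in> Y" "b \<in> Y" for a b
    using that by (simp add: K_def xi_def yi_def zeros)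
  define \<kappa> where "\<kappa> s t = E (K s t)" for s t
  have E_sum: "E (\<lambda>v. \<Sum>k<n. T k v) = (\<lambda>v. \<Sum>k<n. E (T k) v)" if "\<And>k. k < n \<Longrightarrow> T k \<in> Bop" for n :: nat and T
    using linear_on_lincomb[OF opspace_Bop_whole lin, of "{..<n}" T "\<lambda>_. 1"] that by (simp add: scaleC_one)
  have bound: "(\<Sum>k<n. Re (kform \<kappa> n (\<lambda>i. t k i) z)) \<le> c * nsq {..<n} z"
    if T: "\<And>z. \<exists>r. (\<Sum>k<n. \<Sum>i<n. \<Sum>j<n. cinner (K (t k i) (t k j) (z j)) (z i)) = complex_of_real r \<and> r \<le> c * nsq {..<n} z"
    for t :: "nat \<Rightarrow> nat \<Rightarrow> ('h1 \<Rightarrow> 'h1) + ('h2 \<Rightarrow> 'h2)" and n z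
  proof -
    have swap: "(\<Sum>k<n. \<Sum>i<n. \<Sum>j<n. f i j k) = (\<Sum>i<n. \<Sum>j<n. \<Sum>k<n. f i j k)" for f :: "nat \<Rightarrow> nat \<Rightarrow> nat \<Rightarrow> complex"
    proof -
      have "(\<Sum>k<n. \<Sum>i<n. \<Sum>j<n. f i j k) = (\<Sum>i<n. \<Sum>k<n. \<Sum>j<n. f i j k)" by (rule sum.swap)
      also have "\<dots> = (\<Sum>i<n. \<Sum>j<n. \<Sum>k<n. f i j k)" by (intro sum.cong refl sum.swap)
      finally show ?thesis .
    qed
    define B where "B i j = (\<lambda>v. \<Sum>k<n. K (t k i) (t k j) v)" for i j
    have EB: "E (B i j) = (\<lambda>v. \<Sum>k<n. \<kappa> (t k i) (t k j) v)" for i j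
      unfolding B_def \<kappa>_def by (rule E_sum[OF KB])
    have "Re (\<Sum>i<n. \<Sum>j<n. cinner (E (B i j) (z j)) (z i)) \<le> c * nsq {..<n} z"
    proof (rule cp_unital_form_bound[where B = B, OF lin cp E_id[OF vN_id[OF vN]]])
      show "B i j \<in> Bop" for i j unfolding B_def by (intro Bop_sum_op KB)
      show "\<exists>r. (\<Sum>i<n. \<Sum>j<n. cinner (B i j (z j)) (z i)) = complex_of_real r \<and> r \<le> c * nsq {..<n} z" for z
        using T[of z] swap[of "\<lambda>i j k. cinner (K (t k i) (t k j) (z j)) (z i)"] by (simp add: B_def cinner_sum_left)
    qed
    also have "(\<Sum>i<n. \<Sum>j<n. cinner (E (B i j) (z j)) (z i)) = (\<Sum>k<n. kform \<kappa> n (\<lambda>i. t k i) z)"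
      unfolding kform_def using swap[of "\<lambda>i j k. cinner (\<kappa> (t k i) (t k j) (z j)) (z i)"]
      by (simp add: EB cinner_sum_left)
    finally show ?thesis by simp
  qed
  have "dominating_kernel X Y N \<phi> c \<kappa>"
  proof (unfold_locales)
    show "opspace X" "opspace Y" "vN_algebra N" "c > 0" using X Y vN c by auto
    show "\<kappa> s t \<in> N" for s t unfolding \<kappa>_def by (rule EN[OF KB])
    show "pd \<kappa>"
      unfolding pd_def \<kappa>_def
    proof (intro allI)
      fix n and t :: "nat \<Rightarrow> ('h1 \<Rightarrow> 'h1) + ('h2 \<Rightarrow> 'h2)"
      have "mpositive n (\<lambda>i j. K (t i) (t j))" unfolding K_def using xi yi by (rule pos)
      moreover have "(\<lambda>i j. K (t i) (t j)) \<in> Mn n Bop" using KB by (simp add: Mn_def)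
      ultimately show "mpositive n (\<lambda>i j. E (K (t i) (t j)))" using cp by (simp add: cp_on_def)
    qed
    show "\<kappa> (Inl x) (Inr y) = \<phi> x y" if "x \<in> X" "y \<in> Y" for x y
      using that by (simp add: \<kappa>_def K_XY E_id \<phi>N)
    note Xc = X[unfolded opspace_def] and Yc = Y[unfolded opspace_def]
    have E_oadd: "E (oadd S T) = oadd (E S) (E T)" and E_oscale: "E (oscale d S) = oscale d (E S)"
      if "S \<in> Bop" "T \<in> Bop" for S T d using lin that by (auto simp: linear_on_def)
    show "\<kappa> (Inl (oadd a b)) (Inl x) = oadd (\<kappa> (Inl a) (Inl x)) (\<kappa> (Inl b) (Inl x))" if "a \<in> X" "b \<in> X" "x \<in> X" for a b x
    proof -
      have "P (oadd a b) x = oadd (P a x) (P b x)" using Plin[OF that(3)] that by (simp add: linear_on_def)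
      moreover have "oadd a b \<in> X" using Xc that by blast
      ultimately show ?thesis using that by (simp add: \<kappa>_def K_XX E_oadd PB)
    qed
    show "\<kappa> (Inl (oscale d a)) (Inl x) = oscale d (\<kappa> (Inl a) (Inl x))" if "a \<in> X" "x \<in> X" for a d x
    proof -
      have "P (oscale d a) x = oscale d (P a x)" using Plin[OF that(2)] that by (simp add: linear_on_def)
      moreover have "oscale d a \<in> X" using Xc that by blast
      ultimately show ?thesis using that E_oscale[OF PB[OF that] PB[OF that]] by (simp add: \<kappa>_def K_XX)
    qed
    show "\<kappa> (Inr y) (Inr (oadd a b)) = oadd (\<kappa> (Inr y) (Inr a)) (\<kappa> (Inr y) (Inr b))" if "a \<in> Y" "b \<in> Y" "y \<in> Y" for a b y
    proof -
      have "Q y (oadd a b) = oadd (Q y a) (Q y b)" using Qlin[OF that(3)] that by (simp add: linear_on_def)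
      moreover have "oadd a b \<in> Y" using Yc that by blast
      ultimately show ?thesis using that by (simp add: \<kappa>_def K_YY E_oadd QB)
    qed
    show "\<kappa> (Inr y) (Inr (oscale d a)) = oscale d (\<kappa> (Inr y) (Inr a))" if "a \<in> Y" "y \<in> Y" for a d y
    proof -
      have "Q y (oscale d a) = oscale d (Q y a)" using Qlin[OF that(2)] that by (simp add: linear_on_def)
      moreover have "oscale d a \<in> Y" using Yc that by blast
      ultimately show ?thesis using that E_oscale[OF QB[OF that(2,1)] QB[OF that(2,1)]] by (simp add: \<kappa>_def K_YY)
    qed
    show "(\<Sum>k<n. Re (kform \<kappa> n (\<lambda>i. Inl (x i k)) z)) \<le> c * nsq {..<n} z"
      if x: "x \<in> Mn n X" "\<And>\<xi>. nsq {..<n} (\<lambda>k. \<Sum>i<n. adjoint (x i k) (\<xi> i)) \<le> nsq {..<n} \<xi>" for n x z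
    proof (rule bound)
      show "\<exists>r. (\<Sum>k<n. \<Sum>i<n. \<Sum>j<n. cinner (K (Inl (x i k)) (Inl (x j k)) (z j)) (z i)) = complex_of_real r \<and> r \<le> c * nsq {..<n} z" for z
        using A1.avg_contraction[of n n "\<lambda>k i. adjoint (x i k)" z] x(2) adjoint_Bop[OF XB[OF MnD[OF x(1)]]]
        by (simp add: K_XX MnD[OF x(1)] P_def)
    qed
    show "(\<Sum>k<n. Re (kform \<kappa> n (\<lambda>i. Inr (y k i)) z)) \<le> c * nsq {..<n} z"
      if y: "y \<in> Mn n Y" "\<And>\<xi>. nsq {..<n} (\<lambda>k. \<Sum>i<n. y k i (\<xi> i)) \<le> nsq {..<n} \<xi>" for n y z
    proof (rule bound)
      show "\<exists>r. (\<Sum>k<n. \<Sum>i<n. \<Sum>j<n. cinner (K (Inr (y k i)) (Inr (y k j)) (z j)) (z i)) = complex_of_real r \<and> r \<le> c * nsq {..<n} z" for z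
        using A2.avg_contraction[of n n y z] y(2) YB[OF MnD[OF y(1)]]
        by (simp add: K_YY MnD[OF y(1)] Q_def)
    qed
  qed
  then show ?thesis by blast
qed

section \<open>Degenerate cases and the conclusion\<close>

lemma cb_vals_bil_null:
  assumes "(\<lambda>v. 0) \<in> V" "(\<lambda>v. 0) \<in> W" "\<And>x y. x \<in> V \<Longrightarrow> y \<in> W \<Longrightarrow> f x y = (\<lambda>v. 0)"
  shows "cb_vals_bil V W f = {0}"
proof -
  have "mnorm n (amp2 n f x y) = 0" if "x \<in> Mn n V" "y \<in> Mn n W" for n x y
    by (rule mnorm_null) (use that assms(3) in \<open>simp add: amp2_def Mn_def\<close>)
  moreover have "(\<lambda>_ _ v. 0) \<in> Mn 1 V" "(\<lambda>_ _ v. 0) \<in> Mn 1 W" using assms by (simp_all add: Mn_def)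
  ultimately show ?thesis
    unfolding cb_vals_bil_def
    by (auto intro!: exI[of _ "1::nat"] exI[of _ "\<lambda>_ _ v. 0"])
qed

text \<open>Provides 1 by 1 matrices in the unit ball on which a nonzero value of \<phi> remains
  visible.\<close>

lemma mnorm_1_oscale_le:
  assumes "T \<in> Bop"
  shows "\<exists>r>0. mnorm 1 (\<lambda>_ _. oscale (of_real r) T) \<le> 1"
proof -
  obtain C where C: "C > 0" "\<And>v. cnorm (T v) \<le> C * cnorm v" using Bop_bound[OF assms] by blast
  have "mnorm 1 (\<lambda>_ _. oscale (of_real (1 / C)) T) \<le> 1"
  proof (rule mnorm_le)
    fix \<xi> :: "nat \<Rightarrow> 'a"
    have nsq1: "nsq {..<1::nat} \<zeta> = (cnorm (\<zeta> 0))\<^sup>2" for \<zeta> :: "nat \<Rightarrow> 'a" by (simp add: nsq_def)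
    have "cnorm (oscale (of_real (1 / C)) T (\<xi> 0)) \<le> cnorm (\<xi> 0)"
      using C(1) C(2)[of "\<xi> 0"] by (simp add: oscale_def cnorm_scaleC norm_divide field_simps)
    then show "nsq {..<1::nat} (\<lambda>i. \<Sum>j<1. oscale (of_real (1 / C)) T (\<xi> j)) \<le> 1\<^sup>2 * nsq {..<1} \<xi>"
      unfolding nsq1 by (simp add: power_mono)
  qed simp
  then show ?thesis using C(1) by (intro exI[of _ "1 / C"]) simp
qed

theorem theorem4p4:
  fixes X :: "('h1::chilbert \<Rightarrow> 'h1) set"
    and Y :: "('h2::chilbert \<Rightarrow> 'h2) set"
    and N :: "('k::chilbert \<Rightarrow> 'k) set"
    and \<phi> :: "('h1 \<Rightarrow> 'h1) \<Rightarrow> ('h2 \<Rightarrow> 'h2) \<Rightarrow> ('k \<Rightarrow> 'k)"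
  assumes "opspace X" and "opspace Y" and "injective_vN N"
    and "bilinear_on X Y \<phi>" and "\<forall>x\<in>X. \<forall>y\<in>Y. \<phi> x y \<in> N"
    and "cb_bil X Y \<phi>"
  shows "\<exists>\<Lambda> :: ((('h1 \<Rightarrow> 'h1) \<Rightarrow> ('k \<Rightarrow> 'k)) \<times> (('h2 \<Rightarrow> 'h2) \<Rightarrow> ('k \<Rightarrow> 'k))) set.
     (\<forall>p\<in>\<Lambda>. linear_on X (fst p) \<and> cb_lin X (fst p) \<and> fst p ` X \<subseteq> N
            \<and> linear_on Y (snd p) \<and> cb_lin Y (snd p) \<and> snd p ` Y \<subseteq> N)
   \<and> (\<forall>x\<in>X. \<forall>y\<in>Y. wsum \<Lambda> (\<lambda>p. fst p x \<circ> snd p y) (\<phi> x y))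
   \<and> (\<exists>\<Psi> \<Theta>.
        (\<forall>x1\<in>X. \<forall>x2\<in>X. wsum \<Lambda> (\<lambda>p. fst p x1 \<circ> adjoint (fst p x2)) (\<Psi> x1 (adjoint x2)))
      \<and> (\<forall>y1\<in>Y. \<forall>y2\<in>Y. wsum \<Lambda> (\<lambda>p. adjoint (snd p y1) \<circ> snd p y2) (\<Theta> (adjoint y1) y2))
      \<and> bilinear_on X (adj_set X) \<Psi> \<and> cb_bil X (adj_set X) \<Psi>
      \<and> bilinear_on (adj_set Y) Y \<Theta> \<and> cb_bil (adj_set Y) Y \<Theta>
      \<and> cbnorm_bil X Y \<phi> = sqrt (cbnorm_bil X (adj_set X) \<Psi>) * sqrt (cbnorm_bil (adj_set Y) Y \<Theta>))"
proof (cases "\<forall>x\<in>X. \<forall>y\<in>Y. \<phi> x y = (\<lambda>v. 0)")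
  case True
  \<comment> \<open>For \<phi> = 0 the norm is 0, which the main argument excludes. The empty index
    set and zero kernels serve instead.\<close>
  let ?z = "\<lambda>_ _ v. 0"
  have adj0: "(\<lambda>v. 0) \<in> adj_set W" if "opspace W" for W :: "('a::chilbert \<Rightarrow> 'a) set"
    using opspace_zero[OF that] by (auto simp: adj_set_def intro: image_eqI[of _ _ "\<lambda>v. 0"])
  have 1: "cb_vals_bil X Y \<phi> = {0}"
    using True opspace_zero[OF assms(1)] opspace_zero[OF assms(2)] by (intro cb_vals_bil_null) auto
  have 2: "cb_vals_bil X (adj_set X) (?z :: _ \<Rightarrow> _ \<Rightarrow> 'k \<Rightarrow> 'k) = {0}"
    using opspace_zero[OF assms(1)] adj0[OF assms(1)] by (intro cb_vals_bil_null) auto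
  have 3: "cb_vals_bil (adj_set Y) Y (?z :: _ \<Rightarrow> _ \<Rightarrow> 'k \<Rightarrow> 'k) = {0}"
    using opspace_zero[OF assms(2)] adj0[OF assms(2)] by (intro cb_vals_bil_null) auto
  show ?thesis
    by (rule exI[of _ "{}"], intro conjI exI[of _ ?z])
      (use True in \<open>auto simp: wsum_def bilinear_on_def linear_on_def oadd_def oscale_def cb_bil_def cbnorm_bil_def 1 2 3\<close>)
next
  case False
  then obtain x0 y0 where xy: "x0 \<in> X" "y0 \<in> Y" "\<phi> x0 y0 \<noteq> (\<lambda>v. 0)" by blast
  define c where "c = cbnorm_bil X Y \<phi>"
  have vN: "vN_algebra N" using assms(3) by (simp add: injective_vN_def)
  have \<phi>B: "\<phi> x y \<in> Bop" if "x \<in> X" "y \<in> Y" for x y using vN_BopD[OF vN] assms(5) that by blast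
  have lin: "linear_on X (\<lambda>x. \<phi> x y)" "linear_on Y (\<phi> x)" if "x \<in> X" "y \<in> Y" for x y
    using assms(4) that by (auto simp: bilinear_on_def)
  have "x0 \<noteq> (\<lambda>v. 0)" "y0 \<noteq> (\<lambda>v. 0)"
    using linear_on_zero[OF assms(1) lin(1)[OF xy(1,2)]] linear_on_zero[OF assms(2) lin(2)[OF xy(1,2)]] xy(3) by auto
  \<comment> \<open>Values of the nonzero operators x0 and y0 are the nonzero vectors of H1 and H2
    that the locale asks for.\<close>
  then obtain v1 v2 where v: "x0 v1 \<noteq> 0" "y0 v2 \<noteq> 0" by (metis ext)
  have val: "r \<le> c" if "r \<in> cb_vals_bil X Y \<phi>" for r
    unfolding c_def cbnorm_bil_def using that assms(6) by (intro cSup_upper) (auto simp: cb_bil_def)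
  \<comment> \<open>The supremum is positive: scaled into the unit ball, x0 and y0 still have a
    nonzero image under \<phi>.\<close>
  have "c > 0"
  proof (rule ccontr)
    assume c: "\<not> c > 0"
    obtain a b where a: "a > 0" "mnorm 1 (\<lambda>_ _. oscale (of_real a) x0) \<le> 1" and b: "b > 0" "mnorm 1 (\<lambda>_ _. oscale (of_real b) y0) \<le> 1"
      using mnorm_1_oscale_le opspace_Bop[OF assms(1) xy(1)] opspace_Bop[OF assms(2) xy(2)] by metis
    let ?x = "oscale (of_real a) x0" and ?y = "oscale (of_real b) y0"
    have mem: "?x \<in> X" "?y \<in> Y" using xy assms(1,2) by (auto intro: opspace_oscale)
    let ?A = "amp2 1 \<phi> (\<lambda>_ _. ?x) (\<lambda>_ _. ?y)"
    have "mnorm 1 ?A \<in> cb_vals_bil X Y \<phi>"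
      unfolding cb_vals_bil_def using a(2) b(2) mem
      by (intro CollectI exI[of _ "1::nat"] exI[of _ "\<lambda>_ _. ?x"] exI[of _ "\<lambda>_ _. ?y"]) (auto simp: Mn_def)
    then have "mnorm 1 ?A \<le> 0" using val c by fastforce
    moreover have AB: "?A \<in> Mn 1 Bop" using \<phi>B[OF mem] by (simp add: Mn_def amp2_def)
    ultimately have "mnorm 1 ?A = 0" using mnorm_ge0[OF AB] by simp
    then have "\<phi> ?x ?y w = 0" for w
      using mnorm_bound(1)[OF AB, of "\<lambda>_. w"] by (simp add: nsq_def amp2_def)
    moreover have "\<phi> ?x ?y = oscale (of_real a) (oscale (of_real b) (\<phi> x0 y0))"
      using lin(1)[OF xy(1) mem(2)] lin(2)[OF xy(1,2)] xy unfolding linear_on_def by metis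
    ultimately have "scaleC (of_real a) (scaleC (of_real b) (\<phi> x0 y0 w)) = 0" for w
      by (simp add: oscale_def)
    then have "cnorm (scaleC (of_real a) (scaleC (of_real b) (\<phi> x0 y0 w))) = 0" for w
      by simp
    then have "\<phi> x0 y0 w = 0" for w
      unfolding cnorm_scaleC using a(1) b(1) by simp
    then show False using xy(3) by auto
  qed
  interpret cb_bilinear X Y \<phi> c "x0 v1" "y0 v2"
  proof (unfold_locales)
    show "mnorm n (amp2 n \<phi> x y) \<le> c" if "n \<ge> 1" "x \<in> Mn n X" "y \<in> Mn n Y" "mnorm n x \<le> 1" "mnorm n y \<le> 1" for n x y
      using that by (intro val) (auto simp: cb_vals_bil_def)
  qed (use assms \<phi>B v \<open>c > 0\<close> in auto)
  obtain \<kappa> where "dominating_kernel X Y N \<phi> c \<kappa>"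
    using dominating_kernel_exists[OF assms(3)] assms(5) by blast
  then interpret D: dominating_kernel X Y N \<phi> c \<kappa> .
  show ?thesis
  proof (rule D.factorization, goal_cases)
    case (1 \<Lambda>)
    then show ?case
      by (intro exI[of _ \<Lambda>] exI[of _ D.\<Psi>] exI[of _ D.\<Theta>] conjI ballI)
        (use D.bilinear_\<Psi> D.bilinear_\<Theta> D.cb_\<Psi> D.cb_\<Theta> D.norm_identity[OF c_def] in auto)
  qed
qed

end
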